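(* Let $G$ be a chordal finite simple graph and $k$ a field. Then $$\operatorname{reg}(\mathcal{I}(G))=c+1,$$ where $c$ is the maximal number of pairwise $3$-disjoint edges in $G$.
   Context: For a simple graph $G$ on $\{x_1,\dots,x_n\}$, the edge ideal is $\mathcal{I}(G)=(x_ax_b : \{x_a,x_b\}\text{ an edge of }G)\subseteq R=k[x_1,\dots,x_n]$. $\operatorname{reg}(I)=\max\{j-i:\beta_{i,j}(I)\neq 0\}$, with the convention $\operatorname{reg}(0)=1$. $G$ is chordal if every cycle of length at least 4 has a chord. For edges $E,H$ of $G$, $\operatorname{dist}_G(E,H)$ is the minimal $\ell$ for which there are edges $E=E_0,E_1,\dots,E_\ell=H$ with $|E_i\cap E_{i+1}|=1$ for all $i$ ($\infty$ if none exist). Two edges are $3$-disjoint if $\operatorname{dist}_G(E,H)\ge3$; a set of edges is pairwise $3$-disjoint if every two distinct edges in it are $3$-disjoint. *)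

theory Defs
  imports Complex_Main "HOL-Library.Poly_Mapping" "HOL-Library.Extended_Nat"
begin

section \<open>Graphs\<close>

definition simple_graph :: "'v set \<Rightarrow> 'v set set \<Rightarrow> bool" where
  "simple_graph V E \<longleftrightarrow> finite V \<and> (\<forall>e\<in>E. e \<subseteq> V \<and> card e = 2)"

definition is_cycle :: "'v set set \<Rightarrow> 'v list \<Rightarrow> bool" where
  "is_cycle E vs \<longleftrightarrow> length vs \<ge> 3 \<and> distinct vs \<and>
     (\<forall>i<length vs. {vs ! i, vs ! (Suc i mod length vs)} \<in> E)"

text \<open>A chord joins two vertices of the cycle that are not consecutive on it.\<close>

definition has_chord :: "'v set set \<Rightarrow> 'v list \<Rightarrow> bool" where
  "has_chord E vs \<longleftrightarrow> (\<exists>i<length vs. \<exists>j<length vs.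
     {vs ! i, vs ! j} \<in> E \<and> i \<noteq> j \<and>
     j \<noteq> Suc i mod length vs \<and> i \<noteq> Suc j mod length vs)"

definition chordal :: "'v set set \<Rightarrow> bool" where
  "chordal E \<longleftrightarrow> (\<forall>vs. is_cycle E vs \<and> length vs \<ge> 4 \<longrightarrow> has_chord E vs)"

definition edge_dist :: "'v set set \<Rightarrow> 'v set \<Rightarrow> 'v set \<Rightarrow> enat" where
  "edge_dist E e h = Inf {enat l | l. \<exists>f. f 0 = e \<and> f l = h \<and>
     (\<forall>i\<le>l. f i \<in> E) \<and> (\<forall>i<l. card (f i \<inter> f (Suc i)) = 1)}"

definition three_disjoint :: "'v set set \<Rightarrow> 'v set \<Rightarrow> 'v set \<Rightarrow> bool" where
  "three_disjoint E e h \<longleftrightarrow> edge_dist E e h \<ge> 3"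

definition max_three_disjoint :: "'v set set \<Rightarrow> nat" where
  "max_three_disjoint E = Max {card S | S. S \<subseteq> E \<and> pairwise (three_disjoint E) S}"


section \<open>Polynomial rings and their ideals\<close>

type_synonym ('v, 'k) mpoly = "('v \<Rightarrow>\<^sub>0 nat) \<Rightarrow>\<^sub>0 'k"

text \<open>The polynomial ring with variables \<open>V\<close>, as a subring of the ring of all polynomials with
  variables in the type \<open>'v\<close>.\<close>

definition poly_ring :: "'v set \<Rightarrow> ('v, 'k::comm_ring_1) mpoly set" where
  "poly_ring V = {p. \<forall>m\<in>Poly_Mapping.keys p. Poly_Mapping.keys m \<subseteq> V}"

definition var :: "'v \<Rightarrow> ('v, 'k::comm_ring_1) mpoly" where
  "var v = Poly_Mapping.single (Poly_Mapping.single v 1) 1"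

definition monom_deg :: "('v \<Rightarrow>\<^sub>0 nat) \<Rightarrow> nat" where
  "monom_deg m = (\<Sum>v\<in>Poly_Mapping.keys m. Poly_Mapping.lookup m v)"

definition ideal_gen :: "'v set \<Rightarrow> ('v, 'k::comm_ring_1) mpoly set \<Rightarrow> ('v, 'k) mpoly set" where
  "ideal_gen V S = {\<Sum>s\<in>T. r s * s | T r. finite T \<and> T \<subseteq> S \<and> (\<forall>s\<in>T. r s \<in> poly_ring V)}"

definition edge_ideal :: "'v set \<Rightarrow> 'v set set \<Rightarrow> ('v, 'k::comm_ring_1) mpoly set" where
  "edge_ideal V E = ideal_gen V {var a * var b | a b. {a, b} \<in> E}"

definition irrelevant_ideal :: "'v set \<Rightarrow> ('v, 'k::comm_ring_1) mpoly set" where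
  "irrelevant_ideal V = ideal_gen V (var ` V)"


section \<open>Minimal graded free resolutions, Betti numbers and regularity\<close>

text \<open>The data of a sequence of graded free modules of finite rank
  \<open>\<dots> \<rightarrow> F\<^sub>1 \<rightarrow> F\<^sub>0 \<rightarrow> R\<close>. The module \<open>F\<^sub>i\<close> has the basis \<open>e\<^sub>q\<close> for \<open>q < rank i\<close>, where \<open>e\<^sub>q\<close> has
  degree \<open>shift i q\<close>; that is, it is the direct sum of the modules \<open>R(- shift i q)\<close>.
  The entry \<open>diff i p q\<close> is the \<open>p\<close>-th coordinate of the image in \<open>F\<^sub>i\<close> of the \<open>q\<close>-th basis element of
  \<open>F\<^sub>i\<^sub>+\<^sub>1\<close>, and \<open>aug q\<close> is the image in \<open>R\<close> of the \<open>q\<close>-th basis element of \<open>F\<^sub>0\<close>.\<close>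

record 'r free_complex =
  rank :: "nat \<Rightarrow> nat"
  shift :: "nat \<Rightarrow> nat \<Rightarrow> nat"
  aug :: "nat \<Rightarrow> 'r"
  diff :: "nat \<Rightarrow> nat \<Rightarrow> nat \<Rightarrow> 'r"

definition free_mod :: "'v set \<Rightarrow> nat \<Rightarrow> (nat \<Rightarrow> ('v, 'k::comm_ring_1) mpoly) set" where
  "free_mod V n = {f. (\<forall>q<n. f q \<in> poly_ring V) \<and> (\<forall>q\<ge>n. f q = 0)}"

definition aug_map ::
  "('v, 'k::comm_ring_1) mpoly free_complex \<Rightarrow> (nat \<Rightarrow> ('v, 'k) mpoly) \<Rightarrow> ('v, 'k) mpoly" where
  "aug_map F f = (\<Sum>q<rank F 0. f q * aug F q)"

definition diff_map ::
  "('v, 'k::comm_ring_1) mpoly free_complex \<Rightarrow> nat \<Rightarrow> (nat \<Rightarrow> ('v, 'k) mpoly) \<Rightarrow> nat \<Rightarrow> ('v, 'k) mpoly"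
  where
  "diff_map F i f = (\<lambda>p. if p < rank F i then \<Sum>q<rank F (Suc i). f q * diff F i p q else 0)"

text \<open>All maps are homogeneous of degree \<open>0\<close>. The equation for \<open>diff\<close> is stated additively, so that
  an entry has to vanish if \<open>shift F (Suc i) q < shift F i p\<close>.\<close>

definition graded_maps :: "'v set \<Rightarrow> ('v, 'k::comm_ring_1) mpoly free_complex \<Rightarrow> bool" where
  "graded_maps V F \<longleftrightarrow>
     (\<forall>q<rank F 0. aug F q \<in> poly_ring V \<and> (\<forall>m\<in>Poly_Mapping.keys (aug F q). monom_deg m = shift F 0 q)) \<and>
     (\<forall>i. \<forall>p<rank F i. \<forall>q<rank F (Suc i). diff F i p q \<in> poly_ring V \<and>
        (\<forall>m\<in>Poly_Mapping.keys (diff F i p q). monom_deg m + shift F i p = shift F (Suc i) q))"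

definition resolves :: "'v set \<Rightarrow> ('v, 'k::comm_ring_1) mpoly set \<Rightarrow> ('v, 'k) mpoly free_complex \<Rightarrow> bool"
  where
  "resolves V I F \<longleftrightarrow>
     aug_map F ` free_mod V (rank F 0) = I \<and>
     diff_map F 0 ` free_mod V (rank F 1) = {f \<in> free_mod V (rank F 0). aug_map F f = 0} \<and>
     (\<forall>i. diff_map F (Suc i) ` free_mod V (rank F (Suc (Suc i))) =
        {f \<in> free_mod V (rank F (Suc i)). diff_map F i f = (\<lambda>_. 0)})"

text \<open>Minimality: the image of \<open>F\<^sub>i\<^sub>+\<^sub>1\<close> is contained in \<open>\<mm> F\<^sub>i\<close>, where \<open>\<mm>\<close> is the ideal generated by the
  variables.\<close>

definition minimal_complex :: "'v set \<Rightarrow> ('v, 'k::comm_ring_1) mpoly free_complex \<Rightarrow> bool" where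
  "minimal_complex V F \<longleftrightarrow>
     (\<forall>i. \<forall>p<rank F i. \<forall>q<rank F (Suc i). diff F i p q \<in> irrelevant_ideal V)"

definition minimal_graded_free_resolution ::
  "'v set \<Rightarrow> ('v, 'k::comm_ring_1) mpoly set \<Rightarrow> ('v, 'k) mpoly free_complex \<Rightarrow> bool" where
  "minimal_graded_free_resolution V I F \<longleftrightarrow> graded_maps V F \<and> resolves V I F \<and> minimal_complex V F"

text \<open>Minimal graded free resolutions of a homogeneous ideal exist and are unique up to isomorphism,
  so that the numbers below do not depend on the choice.\<close>

definition graded_betti :: "'v set \<Rightarrow> ('v, 'k::field) mpoly set \<Rightarrow> nat \<Rightarrow> nat \<Rightarrow> nat" where
  "graded_betti V I i j =
     (let F = (SOME F. minimal_graded_free_resolution V I F)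
      in card {q. q < rank F i \<and> shift F i q = j})"

definition regularity :: "'v set \<Rightarrow> ('v, 'k::field) mpoly set \<Rightarrow> int" where
  "regularity V I = (if I = {0} then 1
     else Max {int j - int i | i j. graded_betti V I i j \<noteq> 0})"

end

theory Submission
  imports Defs "HOL-Library.Function_Algebras"
begin

text \<open>The regularity of an ideal can be read off from its Koszul homology. Let \<open>R\<close> be the polynomial
  ring, \<open>\<mm>\<close> the ideal generated by its variables, \<open>K\<close> the Koszul complex of the variables and
  \<open>F\<close> a minimal graded free resolution of \<open>I\<close>. Then \<open>F\<^sub>i\<close> has a basis element of degree \<open>j\<close> if and only
  if the homology of \<open>K \<otimes> I\<close> at index \<open>i\<close> is nonzero in degree \<open>j\<close>
  (\<open>shifts_of_minimal_resolution\<close>). The reason is dimension shifting: the Koszul complex of a free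
  module is exact at positive indices, so that a surjection from a free module onto \<open>Z\<close> with kernel
  \<open>Z' \<subseteq> \<mm>F\<close> identifies the homology of \<open>Z\<close> at \<open>p + 1\<close> with that of \<open>Z'\<close> at \<open>p\<close>
  (\<open>exact_at_kernel_iff\<close>), while the homology at \<open>0\<close> is \<open>Z/\<mm>Z\<close> and counts minimal generators
  (\<open>exact_at_zero_iff_no_generator\<close>). The same mechanism yields the existence of a minimal resolution:
  if the homology at every index vanishes in large degrees, then by the graded form of Nakayama's lemma
  every syzygy module is generated in bounded degrees, hence by finitely many elements
  (\<open>minimal_graded_free_resolution_exists\<close>). The bound on the Koszul homology of \<open>I\<close> thus replaces
  Hilbert's basis theorem.

  The edge ideal is spanned by monomials, so its Koszul complex splits into strands, one for each
  multidegree \<open>m\<close>; the strand is the chain complex of the simplicial complex of those sets \<open>S\<close> of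
  variables for which \<open>m\<close> divided by the product of \<open>S\<close> lies in the ideal
  (\<open>exact_at_monomial_span\<close>). If \<open>m\<close> is not squarefree, then this complex is a cone. If \<open>m\<close> is the
  product of a set \<open>W\<close> of variables, then it is the Alexander dual of the independence complex of the
  induced subgraph on \<open>W\<close>; with \<open>card W = p + 1 + r\<close>, the homology at sets of size \<open>p\<close> corresponds to the
  cohomology at independent sets of size \<open>r\<close> (\<open>comb_exact_iff_cohomology_vanishes\<close>).

  It remains to see in which sizes \<open>r\<close> the independence complexes of induced subgraphs of a chordal graph
  have cohomology. Three-disjoint edges are the edges of an induced matching. If all induced matchings
  inside \<open>W\<close> have fewer than \<open>r\<close> edges, then there is no cohomology at size \<open>r\<close>
  (\<open>cohomology_vanishes_chordal\<close>): take a simplicial vertex \<open>v\<close> of \<open>W\<close>. If \<open>v\<close> is isolated, the complex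
  is a cone. Otherwise let \<open>x\<close> be a neighbour of \<open>v\<close> and delete \<open>x\<close>; the error is controlled by the
  link of \<open>x\<close>, which is the independence complex of the non-neighbours of \<open>x\<close>. All neighbours of \<open>v\<close> are
  \<open>x\<close> or neighbours of \<open>x\<close>, so the edge \<open>{v, x}\<close> extends every induced matching among the
  non-neighbours of \<open>x\<close>, and the induction hypothesis applies to \<open>r - 1\<close>. Conversely, on the vertex set
  of an induced matching with \<open>c\<close> edges the independence complex is the boundary of a cross-polytope, a
  sphere of dimension \<open>c - 1\<close>, and it has cohomology at size \<open>c\<close>
  (\<open>cohomology_induced_matching_nonzero\<close>). With \<open>card W = 2 * c\<close> this is Koszul homology at index
  \<open>c - 1\<close> in degree \<open>2 * c\<close>, so that the largest value of \<open>j - i\<close> is \<open>c + 1\<close>.\<close>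

section \<open>Simplicial vertices of chordal graphs\<close>

definition simplicial_in :: "'v set set \<Rightarrow> 'v set \<Rightarrow> 'v \<Rightarrow> bool" where
  "simplicial_in E W v \<longleftrightarrow> (\<forall>a\<in>W. \<forall>b\<in>W. {v, a} \<in> E \<longrightarrow> {v, b} \<in> E \<longrightarrow> a \<noteq> b \<longrightarrow> {a, b} \<in> E)"

text \<open>If \<open>a\<close> and \<open>b\<close> were not adjacent, a shortest path between them whose interior avoids the closed
  neighbourhood of \<open>u\<close> would close up with \<open>u\<close> to a chordless cycle of length at least four.\<close>

lemma chordal_induced_path_ends_adjacent:
  assumes ch: "chordal E" and E2: "\<forall>e\<in>E. card e = 2"
    and f0: "f 0 = a" and fl: "f l = b" and fE: "\<forall>i<l. {f i, f (Suc i)} \<in> E"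
    and ua: "{u, a} \<in> E" and ub: "{u, b} \<in> E" and ab: "a \<noteq> b"
    and far: "\<forall>i. 0 < i \<and> i < l \<longrightarrow> f i \<noteq> u \<and> {u, f i} \<notin> E"
  shows "{a, b} \<in> E"
proof (rule ccontr)
  assume nab: "{a, b} \<notin> E"
  have noloop: "{y, y} \<notin> E" for y using E2 by force
  define P where "P n \<longleftrightarrow> (\<exists>g. g 0 = a \<and> g n = b \<and> (\<forall>i<n. {g i, g (Suc i)} \<in> E) \<and>
      (\<forall>i. 0 < i \<and> i < n \<longrightarrow> g i \<noteq> u \<and> {u, g i} \<notin> E))" for n
  have "P l" unfolding P_def using f0 fl fE far by blast
  define n where "n = (LEAST n. P n)"
  have "P n" unfolding n_def using \<open>P l\<close> by (rule LeastI)
  have least: "n \<le> k" if "P k" for k unfolding n_def using that by (rule Least_le)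
  from \<open>P n\<close> obtain g where g0: "g 0 = a" and gn: "g n = b"
    and gE: "\<forall>i<n. {g i, g (Suc i)} \<in> E"
    and gfar: "\<forall>i. 0 < i \<and> i < n \<longrightarrow> g i \<noteq> u \<and> {u, g i} \<notin> E" unfolding P_def by blast
  have n2: "n \<ge> 2"
  proof (rule ccontr)
    assume "\<not> n \<ge> 2"
    then have "n = 0 \<or> n = 1" by auto
    then show False using g0 gn ab nab gE by auto
  qed
  \<comment> \<open>Two vertices of a shortest path that are adjacent or equal are at most one step apart.\<close>
  have short: "j \<le> Suc i" if ij: "i < j" "j \<le> n" and adj: "{g i, g j} \<in> E" for i j
  proof (rule ccontr)
    assume nj: "\<not> j \<le> Suc i"
    define k where "k = j - Suc i"
    \<comment> \<open>The shortcut from \<open>i\<close> to \<open>j\<close> skips \<open>k\<close> vertices.\<close>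
    define h where "h t = (if t \<le> i then g t else g (t + k))" for t
    have "P (n - k)" unfolding P_def
    proof (intro exI[of _ h] conjI allI impI)
      show "h 0 = a" by (simp add: h_def g0)
      show "h (n - k) = b" using ij nj by (auto simp: h_def k_def gn)
      fix t assume t: "t < n - k"
      show "{h t, h (Suc t)} \<in> E"
      proof -
        consider "t < i" | "t = i" | "t > i" by linarith
        then show ?thesis
        proof cases
          case 1 then show ?thesis using gE ij by (simp add: h_def)
        next
          case 2
          have "Suc i + k = j" using nj by (simp add: k_def)
          then show ?thesis using 2 adj by (simp add: h_def)
        next
          case 3 then show ?thesis using gE t by (simp add: h_def)
        qed
      qed
    next
      fix t assume t: "0 < t \<and> t < n - k"
      then have "t < n" "t + k < n" by auto
      then show "h t \<noteq> u" "{u, h t} \<notin> E"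
        using gfar[rule_format, of t] gfar[rule_format, of "t + k"] t by (simp_all add: h_def)
    qed
    then have "n \<le> n - k" by (rule least)
    then show False using nj ij by (simp add: k_def)
  qed
  have inj: "g i \<noteq> g j" if ij: "i < j" "j \<le> n" for i j
  proof
    assume eq: "g i = g j"
    show False
    proof (cases "j = n")
      case True
      show False
      proof (cases i)
        case 0 then show False using eq True g0 gn ab by simp
      next
        case (Suc i')
        have "{g i', g j} \<in> E" using gE[rule_format, of i'] ij Suc eq by simp
        then have "j \<le> Suc i'" using short[of i' j] ij Suc by simp
        then show False using ij Suc by simp
      qed
    next
      case False
      have "{g i, g (Suc j)} \<in> E" using gE[rule_format, of j] ij False eq by simp
      then have "Suc j \<le> Suc i" using short[of i "Suc j"] ij False by simp
      then show False using ij by simp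
    qed
  qed
  define vs where "vs = map g [0..<Suc n] @ [u]"
  have len: "length vs = n + 2" by (simp add: vs_def)
  have nthg: "vs ! i = g i" if "i \<le> n" for i using that by (simp add: vs_def nth_append del: upt_Suc)
  have nthu: "vs ! Suc n = u" by (simp add: vs_def nth_append del: upt_Suc)
  have gu: "g i \<noteq> u" if "i \<le> n" for i
  proof -
    have "a \<noteq> u" "b \<noteq> u" using ua ub noloop by auto
    then show ?thesis using that gfar[rule_format, of i] g0 gn
      by (cases "i = 0"; cases "i = n") auto
  qed
  have "distinct vs"
  proof -
    have "inj_on g {0..<Suc n}"
      by (rule inj_onI) (metis atLeastLessThan_iff inj less_Suc_eq_le linorder_neqE_nat)
    moreover have "u \<notin> g ` {0..<Suc n}" using gu by (metis atLeastLessThan_iff imageE less_Suc_eq_le)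
    ultimately show ?thesis by (simp add: vs_def distinct_map del: upt_Suc)
  qed
  moreover have "{vs ! i, vs ! (Suc i mod length vs)} \<in> E" if i: "i < length vs" for i
  proof -
    consider "i < n" | "i = n" | "i = Suc n" using i len by linarith
    then show ?thesis
    proof cases
      case 1 then show ?thesis using gE by (simp add: len nthg)
    next
      case 2 then show ?thesis using ub gn by (simp add: len nthg nthu insert_commute)
    next
      case 3 then show ?thesis using ua g0 by (simp add: len nthg nthu)
    qed
  qed
  ultimately have "is_cycle E vs" using n2 len by (simp add: is_cycle_def)
  then have "has_chord E vs" using ch n2 len by (simp add: chordal_def)
  then obtain i j where ij: "i < length vs" "j < length vs" "{vs ! i, vs ! j} \<in> E" "i \<noteq> j"
    "j \<noteq> Suc i mod length vs" "i \<noteq> Suc j mod length vs" unfolding has_chord_def by blast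
  have key: False if "i < j" "j < length vs" "{vs ! i, vs ! j} \<in> E"
    "j \<noteq> Suc i mod length vs" "i \<noteq> Suc j mod length vs" for i j
  proof (cases "j = Suc n")
    case True
    then have "i \<noteq> 0" "i \<noteq> n" "i \<le> n" using that len by auto
    then have "{u, g i} \<notin> E" "{g i, u} \<in> E"
      using gfar[rule_format, of i] that(3) True nthg[of i] nthu by simp_all
    then show False by (simp add: insert_commute)
  next
    case False
    then have jn: "j \<le> n" using that len by simp
    then have "{g i, g j} \<in> E" using that nthg by simp
    then have "j \<le> Suc i" using short[of i j] that jn by simp
    then have "j = Suc i" using that by simp
    then show False using that(4) jn len by simp
  qed
  show False
  proof (cases "i < j")
    case True then show False using key ij by blast
  next
    case False then show False using key[of j i] ij by (simp add: insert_commute)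
  qed
qed

text \<open>Dirac's argument. Let \<open>C\<close> be a component of the subgraph on the non-neighbours of \<open>u\<close>. The neighbours
  \<open>S\<close> of \<open>C\<close> outside \<open>C\<close> form a clique by the previous lemma, so an induction applied to \<open>C \<union> S\<close> can be
  arranged to produce a simplicial vertex in \<open>C\<close>; this vertex has the same neighbours in \<open>W\<close> as in
  \<open>C \<union> S\<close>. Asking for a vertex not adjacent to a given one is what keeps the induction away from \<open>S\<close>.\<close>

lemma simplicial_vertex_avoiding:
  assumes "chordal E" and E2: "\<forall>e\<in>E. card e = 2"
    and "finite W" "u \<in> W" "w \<in> W" "w \<noteq> u" "{u, w} \<notin> E"
  shows "\<exists>v\<in>W. v \<noteq> u \<and> {u, v} \<notin> E \<and> simplicial_in E W v"
  using assms(3-)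
proof (induction "card W" arbitrary: W u w rule: less_induct)
  case less
  have noloop: "{y, y} \<notin> E" for y using E2 by force
  define A where "A = {y \<in> W. y \<noteq> u \<and> {u, y} \<notin> E}"
  define R where "R = {(a, b). a \<in> A \<and> b \<in> A \<and> {a, b} \<in> E}"
  define C where "C = {y. (w, y) \<in> R\<^sup>*}"
  define S where "S = {s \<in> W. {u, s} \<in> E \<and> (\<exists>y\<in>C. {s, y} \<in> E)}"
  have wA: "w \<in> A" using less.prems by (simp add: A_def)
  have CA: "C \<subseteq> A"
  proof
    fix y assume "y \<in> C"
    then have "(w, y) \<in> R\<^sup>*" by (simp add: C_def)
    then show "y \<in> A" by (induction) (auto simp: wA R_def)
  qed
  have wC: "w \<in> C" by (simp add: C_def)
  have nbr: "a \<in> C \<union> S" if "y \<in> C" "a \<in> W" "{y, a} \<in> E" for y a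
  proof (cases "{u, a} \<in> E")
    case True then show ?thesis using that by (auto simp: S_def insert_commute)
  next
    case False
    have yA: "y \<in> A" using that CA by blast
    then have "a \<noteq> u" using that by (auto simp: A_def insert_commute)
    then have "(y, a) \<in> R" using False that yA by (simp add: R_def A_def)
    then show ?thesis using that by (auto simp: C_def)
  qed
  have symR: "sym R" by (auto simp: R_def sym_def insert_commute)
  have clique: "{a, b} \<in> E" if a: "a \<in> S" and b: "b \<in> S" and ab: "a \<noteq> b" for a b
  proof -
    obtain p q where p: "p \<in> C" "{a, p} \<in> E" and q: "q \<in> C" "{b, q} \<in> E"
      using a b by (auto simp: S_def)
    have "(p, w) \<in> R\<^sup>*" using p symR by (metis C_def mem_Collect_eq sym_rtrancl symD)
    then have "(p, q) \<in> R\<^sup>*" using q by (auto simp: C_def)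
    then obtain l where "(p, q) \<in> R ^^ l" by (auto dest: rtrancl_imp_relpow)
    then obtain f where f: "f 0 = p" "f l = q" "\<forall>i<l. (f i, f (Suc i)) \<in> R"
      unfolding relpow_fun_conv by blast
    define g where "g i = (if i = 0 then a else if i = Suc (Suc l) then b else f (i - 1))" for i
    have fA: "f i \<in> A" if "i \<le> l" for i
    proof (cases "i = l")
      case True then show ?thesis using f q CA by auto
    next
      case False then show ?thesis using f(3)[rule_format, of i] that by (simp add: R_def)
    qed
    show ?thesis
    proof (rule chordal_induced_path_ends_adjacent[of E g a "Suc (Suc l)" b u])
      show "g 0 = a" "g (Suc (Suc l)) = b" by (simp_all add: g_def)
      show "\<forall>i<Suc (Suc l). {g i, g (Suc i)} \<in> E"
      proof (intro allI impI)
        fix i assume "i < Suc (Suc l)"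
        then consider "i = 0" | "i = Suc l" | k where "i = Suc k" "k < l"
          by (metis less_antisym not0_implies_Suc not_less_eq)
        then show "{g i, g (Suc i)} \<in> E"
        proof cases
          case 1 then show ?thesis using p f by (simp add: g_def)
        next
          case 2 then show ?thesis using q f by (simp add: g_def insert_commute)
        next
          case 3 then show ?thesis using f(3) by (auto simp: g_def R_def)
        qed
      qed
      show "{u, a} \<in> E" "{u, b} \<in> E" using a b by (simp_all add: S_def)
      show "\<forall>i. 0 < i \<and> i < Suc (Suc l) \<longrightarrow> g i \<noteq> u \<and> {u, g i} \<notin> E"
      proof (intro allI impI)
        fix i assume i: "0 < i \<and> i < Suc (Suc l)"
        then have "g i = f (i - 1)" "i - 1 \<le> l" by (auto simp: g_def)
        then show "g i \<noteq> u \<and> {u, g i} \<notin> E" using fA[of "i - 1"] by (simp add: A_def)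
      qed
    qed (use assms ab in auto)
  qed
  define W' where "W' = C \<union> S"
  have W'W: "W' \<subseteq> W" using CA by (auto simp: W'_def A_def S_def)
  have uW': "u \<notin> W'" using CA noloop by (auto simp: W'_def A_def S_def)
  have smaller: "card W' < card W" using W'W uW' less.prems by (intro psubset_card_mono) auto
  have finW': "finite W'" using W'W less.prems finite_subset by blast
  have lift: "simplicial_in E W v" if "v \<in> C" "simplicial_in E W' v" for v
    using that nbr unfolding simplicial_in_def W'_def by blast
  have fin: ?case if "v \<in> C" "simplicial_in E W' v" for v
    using lift[OF that] that CA by (auto simp: A_def)
  show ?case
  proof (cases "\<forall>p\<in>W'. \<forall>q\<in>W'. p \<noteq> q \<longrightarrow> {p, q} \<in> E")
    case True
    then have "simplicial_in E W' w" unfolding simplicial_in_def by blast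
    then show ?thesis using fin wC by blast
  next
    case False
    then obtain p q where pq: "p \<in> W'" "q \<in> W'" "p \<noteq> q" "{p, q} \<notin> E" by blast
    show ?thesis
    proof (cases "\<exists>s\<in>S. \<exists>t\<in>W'. t \<noteq> s \<and> {s, t} \<notin> E")
      case True
      then obtain s t where st: "s \<in> S" "t \<in> W'" "t \<noteq> s" "{s, t} \<notin> E" by blast
      then obtain v where v: "v \<in> W'" "v \<noteq> s" "{s, v} \<notin> E" "simplicial_in E W' v"
        using less.hyps[OF smaller finW', of s t] by (auto simp: W'_def)
      then have "v \<in> C" using clique[of s v] st by (auto simp: W'_def)
      then show ?thesis using fin v by blast
    next
      case False
      obtain v where v: "v \<in> W'" "v \<noteq> p" "{p, v} \<notin> E" "simplicial_in E W' v"
        using less.hyps[OF smaller finW', of p q] pq by auto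
      then have "v \<notin> S" using False pq by (metis insert_commute)
      then have "v \<in> C" using v by (auto simp: W'_def)
      then show ?thesis using fin v by blast
    qed
  qed
qed

lemma chordal_has_simplicial_vertex:
  assumes "chordal E" "\<forall>e\<in>E. card e = 2" "finite W" "W \<noteq> {}"
  shows "\<exists>v\<in>W. simplicial_in E W v"
proof (cases "\<forall>p\<in>W. \<forall>q\<in>W. p \<noteq> q \<longrightarrow> {p, q} \<in> E")
  case True
  then show ?thesis using assms(4) unfolding simplicial_in_def by blast
next
  case False
  then show ?thesis using simplicial_vertex_avoiding[OF assms(1-3)] by metis
qed

section \<open>Three-disjoint edges\<close>

definition gap :: "'v set set \<Rightarrow> 'v set \<Rightarrow> 'v set \<Rightarrow> bool" where
  "gap E e h \<longleftrightarrow> (\<forall>g\<in>E. g \<inter> e = {} \<or> g \<inter> h = {})"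

text \<open>Two distinct edges have distance 1 if they share a vertex and distance 2 if a third edge meets both.
  Both cases amount to an edge that meets \<open>e\<close> and \<open>h\<close>; in the first one \<open>e\<close> itself does.\<close>

lemma three_disjoint_iff_gap:
  assumes E2: "\<forall>e\<in>E. card e = 2" and e: "e \<in> E" and h: "h \<in> E" and "e \<noteq> h"
  shows "three_disjoint E e h \<longleftrightarrow> gap E e h"
proof -
  define L where "L = {l. \<exists>f. f 0 = e \<and> f l = h \<and>
     (\<forall>i\<le>l. f i \<in> E) \<and> (\<forall>i<l. card (f i \<inter> f (Suc i)) = 1)}"
  have "edge_dist E e h = Inf (enat ` L)"
    unfolding edge_dist_def L_def by (rule arg_cong[where f = Inf]) auto
  then have *: "three_disjoint E e h \<longleftrightarrow> (\<forall>l\<in>L. 3 \<le> l)"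
    by (simp add: three_disjoint_def le_Inf_iff numeral_eq_enat)
  have card1: "card (a \<inter> b) = 1" if "a \<in> E" "b \<in> E" "a \<noteq> b" "a \<inter> b \<noteq> {}" for a b
  proof -
    have fin: "finite a" "finite b" using E2 that by (metis card.infinite zero_neq_numeral)+
    have "a \<inter> b \<noteq> a"
      using E2 fin that by (metis card_subset_eq inf.cobounded2)
    then have "card (a \<inter> b) < card a" using fin by (intro psubset_card_mono) auto
    moreover have "card (a \<inter> b) > 0" using that fin by (simp add: card_gt_0_iff)
    ultimately show ?thesis using E2 that by auto
  qed
  show ?thesis
  proof
    assume td: "three_disjoint E e h"
    show "gap E e h"
    proof (rule ccontr)
      assume "\<not> gap E e h"
      then obtain g where g: "g \<in> E" "g \<inter> e \<noteq> {}" "g \<inter> h \<noteq> {}" by (auto simp: gap_def)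
      have "\<exists>l\<in>L. l < 3"
      proof (cases "e \<inter> h = {}")
        case False
        then have "card (e \<inter> h) = 1" using card1 e h \<open>e \<noteq> h\<close> by simp
        then have "1 \<in> L" unfolding L_def mem_Collect_eq using e h
          by (intro exI[of _ "\<lambda>i. if i = 0 then e else h"]) simp
        then show ?thesis by force
      next
        case True
        then have "g \<noteq> e" "g \<noteq> h" using g by auto
        then have "card (e \<inter> g) = 1" "card (g \<inter> h) = 1" using card1 g e h by (auto simp: Int_commute)
        then have "2 \<in> L" unfolding L_def mem_Collect_eq using g e h
          by (intro exI[of _ "\<lambda>i. if i = 0 then e else if i = 1 then g else h"])
            (simp add: less_Suc_eq numeral_2_eq_2)
        then show ?thesis by force
      qed
      then show False using td * by auto
    qed
  next
    assume gp: "gap E e h"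
    show "three_disjoint E e h" unfolding *
    proof (intro ballI, rule ccontr)
      fix l assume "l \<in> L" and l: "\<not> 3 \<le> l"
      then obtain f where f: "f 0 = e" "f l = h" "\<forall>i\<le>l. f i \<in> E"
        "\<forall>i<l. card (f i \<inter> f (Suc i)) = 1" unfolding L_def by blast
      from l consider "l = 0" | "l = 1" | "l = 2" by linarith
      then show False
      proof cases
        case 1 then show ?thesis using f \<open>e \<noteq> h\<close> by simp
      next
        case 2
        then have "e \<inter> h \<noteq> {}" using f by auto
        then show ?thesis using gp e unfolding gap_def by (metis Int_absorb inf_bot_left)
      next
        case 3
        then have "card (f 0 \<inter> f 1) = 1" "card (f 1 \<inter> f 2) = 1" "f 1 \<in> E"
          using f(3)[rule_format, of 1] f(4)[rule_format, of 0] f(4)[rule_format, of 1]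
          by (simp_all add: numeral_2_eq_2)
        then have "f 1 \<in> E" "e \<inter> f 1 \<noteq> {}" "f 1 \<inter> h \<noteq> {}" using f 3 by auto
        then show ?thesis using gp by (auto simp: gap_def Int_commute)
      qed
    qed
  qed
qed

definition induced_matching :: "'v set set \<Rightarrow> 'v set set \<Rightarrow> bool" where
  "induced_matching E M \<longleftrightarrow> M \<subseteq> E \<and> pairwise (gap E) M"

lemma max_three_disjoint_altdef:
  assumes "\<forall>e\<in>E. card e = 2"
  shows "max_three_disjoint E = Max (card ` {M. induced_matching E M})"
proof -
  have "pairwise (three_disjoint E) S \<longleftrightarrow> pairwise (gap E) S" if "S \<subseteq> E" for S
    using that three_disjoint_iff_gap[OF assms] unfolding pairwise_def by (simp add: subset_iff)
  then have "{S. S \<subseteq> E \<and> pairwise (three_disjoint E) S} = {M. induced_matching E M}"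
    unfolding induced_matching_def by (intro Collect_cong) blast
  then have "card ` {M. induced_matching E M} = card ` {S. S \<subseteq> E \<and> pairwise (three_disjoint E) S}"
    by simp
  also have "\<dots> = {card S |S. S \<subseteq> E \<and> pairwise (three_disjoint E) S}" by blast
  finally show ?thesis unfolding max_three_disjoint_def by simp
qed

section \<open>Cohomology of independence complexes\<close>

text \<open>The reason for \<open>d d = 0\<close> in each of the complexes below. The terms are cancelled in pairs, since a sum
  that equals its own negative need not vanish in characteristic two.\<close>

lemma antisym_sum_zero:
  fixes g :: "'a \<Rightarrow> 'a \<Rightarrow> 'b::ab_group_add"
  assumes "finite T" and "\<And>s t. s \<in> T \<Longrightarrow> t \<in> T \<Longrightarrow> s \<noteq> t \<Longrightarrow> g s t + g t s = 0"
  shows "(\<Sum>t\<in>T. \<Sum>s\<in>T - {t}. g t s) = 0"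
  using assms
proof (induction T)
  case (insert x T)
  have "(\<Sum>s\<in>insert x T - {t}. g t s) = g t x + (\<Sum>s\<in>T - {t}. g t s)" if "t \<in> T" for t
  proof -
    have "insert x T - {t} = insert x (T - {t})" "x \<notin> T - {t}" using that insert by auto
    then show ?thesis using insert by simp
  qed
  then have "(\<Sum>t\<in>T. \<Sum>s\<in>insert x T - {t}. g t s) = (\<Sum>t\<in>T. g t x) + (\<Sum>t\<in>T. \<Sum>s\<in>T - {t}. g t s)"
    by (simp add: sum.distrib)
  also have "(\<Sum>t\<in>T. \<Sum>s\<in>T - {t}. g t s) = 0" using insert by simp
  finally have "(\<Sum>t\<in>insert x T. \<Sum>s\<in>insert x T - {t}. g t s) = (\<Sum>t\<in>T. g x t) + (\<Sum>t\<in>T. g t x)"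
    using insert by simp
  also have "\<dots> = (\<Sum>t\<in>T. g x t + g t x)" by (simp add: sum.distrib)
  also have "\<dots> = 0"
  proof (rule sum.neutral, rule ballI)
    fix t assume "t \<in> T"
    then show "g x t + g t x = 0" using insert.prems[of x t] insert.hyps by auto
  qed
  finally show ?case .
qed simp

text \<open>Only this exchange rule for the incidence signs is ever needed. Keeping the signs abstract makes them
  stable under passing to links and to complements, for which a fixed order of the vertices would require
  extra signs.\<close>

definition sign_system :: "'v set \<Rightarrow> ('v \<Rightarrow> 'v set \<Rightarrow> 'k::field) \<Rightarrow> bool" where
  "sign_system W \<sigma> \<longleftrightarrow> (\<forall>s T. \<sigma> s T * \<sigma> s T = 1) \<and>
     (\<forall>s\<in>W. \<forall>t\<in>W. \<forall>T\<subseteq>W. s \<noteq> t \<longrightarrow> s \<notin> T \<longrightarrow> t \<notin> T \<longrightarrow>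
        \<sigma> s T * \<sigma> t (insert s T) = - (\<sigma> t T * \<sigma> s (insert t T)))"

lemma sign_system_square: "sign_system W \<sigma> \<Longrightarrow> \<sigma> s T * \<sigma> s T = 1"
  unfolding sign_system_def by blast

lemma sign_system_swap:
  "sign_system W \<sigma> \<Longrightarrow> s \<in> W \<Longrightarrow> t \<in> W \<Longrightarrow> U \<subseteq> W \<Longrightarrow> s \<noteq> t \<Longrightarrow> s \<notin> U \<Longrightarrow> t \<notin> U \<Longrightarrow>
    \<sigma> s U * \<sigma> t (insert s U) = - (\<sigma> t U * \<sigma> s (insert t U))"
  unfolding sign_system_def by blast

lemma sign_system_subset: "sign_system W \<sigma> \<Longrightarrow> W' \<subseteq> W \<Longrightarrow> sign_system W' \<sigma>"
  unfolding sign_system_def by (meson subset_trans subsetD)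

lemma sign_system_link:
  assumes "sign_system W \<sigma>" "W' \<subseteq> W" "x \<in> W" "x \<notin> W'"
  shows "sign_system W' (\<lambda>s U. \<sigma> s (insert x U))"
  unfolding sign_system_def
proof (intro conjI allI ballI impI)
  fix s T show "\<sigma> s (insert x T) * \<sigma> s (insert x T) = 1" using assms by (simp add: sign_system_def)
next
  fix s t T assume "s \<in> W'" "t \<in> W'" "T \<subseteq> W'" "s \<noteq> t" "s \<notin> T" "t \<notin> T"
  then have "s \<in> W" "t \<in> W" "insert x T \<subseteq> W" "s \<noteq> t" "s \<notin> insert x T" "t \<notin> insert x T" using assms by auto
  then show "\<sigma> s (insert x T) * \<sigma> t (insert x (insert s T)) = - (\<sigma> t (insert x T) * \<sigma> s (insert x (insert t T)))"
    using sign_system_swap[OF assms(1), of s t "insert x T"] by (simp add: insert_commute)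
qed

lemma sign_system_cross:
  assumes "sign_system W \<sigma>" "s \<in> W" "t \<in> W" "U \<subseteq> W" "s \<noteq> t" "s \<notin> U" "t \<notin> U"
  shows "\<sigma> s U * \<sigma> t U = - (\<sigma> t (insert s U) * \<sigma> s (insert t U))"
proof -
  have 1: "\<sigma> s U * \<sigma> t (insert s U) = - (\<sigma> t U * \<sigma> s (insert t U))"
    using assms by (rule sign_system_swap)
  have sq: "\<sigma> s T * \<sigma> s T = 1" for s T by (rule sign_system_square[OF assms(1)])
  have "\<sigma> s U * \<sigma> t U = \<sigma> s U * (\<sigma> t U * (\<sigma> t (insert s U) * \<sigma> t (insert s U)))" by (simp add: sq)
  also have "\<dots> = (\<sigma> s U * \<sigma> t (insert s U)) * \<sigma> t U * \<sigma> t (insert s U)" by (simp add: ac_simps)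
  also have "\<dots> = - (\<sigma> t U * \<sigma> t U) * (\<sigma> s (insert t U) * \<sigma> t (insert s U))" by (simp add: 1 ac_simps)
  finally show ?thesis by (simp add: sq ac_simps)
qed

text \<open>The simplicial coboundary; a cochain of dimension \<open>r - 1\<close> is represented by an arbitrary function on
  sets, of which only the values at \<open>r\<close>-element faces matter.\<close>

definition coboundary :: "('v \<Rightarrow> 'v set \<Rightarrow> 'k::field) \<Rightarrow> ('v set \<Rightarrow> 'k) \<Rightarrow> 'v set \<Rightarrow> 'k" where
  "coboundary \<sigma> d T = (\<Sum>t\<in>T. \<sigma> t (T - {t}) * d (T - {t}))"

lemma coboundary_coboundary:
  assumes \<sigma>: "sign_system W \<sigma>" and "finite W" "T \<subseteq> W"
  shows "coboundary \<sigma> (coboundary \<sigma> d) T = 0"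
proof -
  have fin: "finite T" using assms finite_subset by blast
  define g where "g t s = \<sigma> t (T - {t}) * \<sigma> s (T - {t} - {s}) * d (T - {t} - {s})" for t s
  have "coboundary \<sigma> (coboundary \<sigma> d) T = (\<Sum>t\<in>T. \<Sum>s\<in>T - {t}. g t s)"
    by (simp add: coboundary_def g_def sum_distrib_left mult.assoc)
  also have "\<dots> = 0"
  proof (rule antisym_sum_zero[OF fin])
    fix s t assume st: "s \<in> T" "t \<in> T" "s \<noteq> t"
    define U where "U = T - {s} - {t}"
    have U: "T - {s} = insert t U" "T - {t} = insert s U" "insert s U - {s} = U" "insert t U - {t} = U"
      using st by (auto simp: U_def)
    have "\<sigma> s U * \<sigma> t (insert s U) = - (\<sigma> t U * \<sigma> s (insert t U))"
      by (rule sign_system_swap[OF \<sigma>]) (use st assms(3) in \<open>auto simp: U_def\<close>)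
    then have "\<sigma> s (insert t U) * \<sigma> t U + \<sigma> t (insert s U) * \<sigma> s U = 0"
      by (simp add: mult.commute)
    moreover have "g s t + g t s = (\<sigma> s (insert t U) * \<sigma> t U + \<sigma> t (insert s U) * \<sigma> s U) * d U"
      unfolding g_def U by (rule distrib_right[symmetric])
    ultimately show "g s t + g t s = 0" by simp
  qed
  finally show ?thesis .
qed

text \<open>The coboundary at a face through \<open>x\<close> splits into a term in the deletion of \<open>x\<close> and the coboundary in
  the link of \<open>x\<close>, with the signs of the link.\<close>

lemma coboundary_insert:
  assumes "finite U" "x \<notin> U"
  shows "coboundary \<sigma> d (insert x U) =
    \<sigma> x U * d U + coboundary (\<lambda>s U. \<sigma> s (insert x U)) (\<lambda>U. d (insert x U)) U"
proof -
  have "(\<Sum>t\<in>U. \<sigma> t (insert x U - {t}) * d (insert x U - {t})) =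
      (\<Sum>t\<in>U. \<sigma> t (insert x (U - {t})) * d (insert x (U - {t})))"
    using assms by (intro sum.cong refl) (metis insert_Diff_if singletonD)
  then show ?thesis using assms by (simp add: coboundary_def)
qed

lemma coboundary_cong:
  assumes "\<And>t. t \<in> T \<Longrightarrow> d (T - {t}) = d' (T - {t})"
  shows "coboundary \<sigma> d T = coboundary \<sigma> d' T"
  using assms by (simp add: coboundary_def)

lemma coboundary_diff:
  "coboundary \<sigma> (\<lambda>T. c T - d T) T = coboundary \<sigma> c T - coboundary \<sigma> d T"
  by (simp add: coboundary_def sum_subtractf right_diff_distrib)

lemma coboundary_add:
  "coboundary \<sigma> (\<lambda>T. c T + d T) T = coboundary \<sigma> c T + coboundary \<sigma> d T"
  by (simp add: coboundary_def sum.distrib distrib_left)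

definition independent :: "'v set set \<Rightarrow> 'v set \<Rightarrow> bool" where
  "independent E T \<longleftrightarrow> (\<forall>e\<in>E. \<not> e \<subseteq> T)"

lemma independent_subset: "independent E T \<Longrightarrow> U \<subseteq> T \<Longrightarrow> independent E U"
  unfolding independent_def by blast

lemma independent_insert:
  assumes E2: "\<forall>e\<in>E. card e = 2" and "independent E T" and "\<And>y. y \<in> T \<Longrightarrow> {x, y} \<notin> E"
  shows "independent E (insert x T)"
  unfolding independent_def
proof (intro ballI notI)
  fix e assume e: "e \<in> E" "e \<subseteq> insert x T"
  then have "x \<in> e" using assms(2) unfolding independent_def by blast
  moreover have "card e = 2" using e E2 by blast
  ultimately obtain y where "e = {x, y}" "y \<noteq> x"
    by (metis card_2_iff insert_commute insert_iff singletonD)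
  then show False using e assms(3)[of y] by auto
qed

text \<open>Vanishing of the reduced cohomology, at faces with \<open>r\<close> vertices, of the complex of independent subsets
  of \<open>W\<close>.\<close>

definition cohomology_vanishes :: "'v set set \<Rightarrow> ('v \<Rightarrow> 'v set \<Rightarrow> 'k::field) \<Rightarrow> 'v set \<Rightarrow> nat \<Rightarrow> bool" where
  "cohomology_vanishes E \<sigma> W r \<longleftrightarrow> (\<forall>c.
     (\<forall>T\<subseteq>W. independent E T \<longrightarrow> card T = Suc r \<longrightarrow> coboundary \<sigma> c T = 0) \<longrightarrow>
     (\<exists>d. \<forall>T\<subseteq>W. independent E T \<longrightarrow> card T = r \<longrightarrow> coboundary \<sigma> d T = c T))"

text \<open>Removing the apex \<open>v\<close> is a contracting homotopy.\<close>

lemma cohomology_vanishes_cone: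
  assumes \<sigma>: "sign_system W \<sigma>" and W: "finite W" "v \<in> W"
    and iso: "\<And>T. T \<subseteq> W \<Longrightarrow> independent E T \<Longrightarrow> independent E (insert v T)"
  shows "cohomology_vanishes E \<sigma> W r"
  unfolding cohomology_vanishes_def
proof (intro allI impI)
  fix c :: "'a set \<Rightarrow> 'b"
  assume c: "\<forall>T\<subseteq>W. independent E T \<longrightarrow> card T = Suc r \<longrightarrow> coboundary \<sigma> c T = 0"
  have sq: "\<sigma> s T * \<sigma> s T = 1" for s T by (rule sign_system_square[OF \<sigma>])
  have sq': "\<sigma> s T * (\<sigma> s T * z) = z" for s T z by (metis mult.assoc mult.left_neutral sq)
  define d where "d U = (if v \<in> U then 0 else \<sigma> v U * c (insert v U))" for U
  show "\<exists>d. \<forall>T\<subseteq>W. independent E T \<longrightarrow> card T = r \<longrightarrow> coboundary \<sigma> d T = c T"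
  proof (intro exI[of _ d] allI impI)
    fix T assume T: "T \<subseteq> W" "independent E T" "card T = r"
    have fT: "finite T" using T W finite_subset by blast
    show "coboundary \<sigma> d T = c T"
    proof (cases "v \<in> T")
      case True
      define U where "U = T - {v}"
      have U: "T = insert v U" "v \<notin> U" "finite U" using True fT by (auto simp: U_def)
      show ?thesis unfolding U(1) coboundary_insert[OF U(3,2)]
        using U(2) by (simp add: d_def coboundary_def sq')
    next
      case False
      have "0 = coboundary \<sigma> c (insert v T)"
        using c T W iso[of T] False fT by simp
      also have "\<dots> = \<sigma> v T * c T + (\<Sum>t\<in>T. \<sigma> t (insert v (T - {t})) * c (insert v (T - {t})))"
        unfolding coboundary_insert[OF fT False] by (simp add: coboundary_def)
      finally have 0: "\<sigma> v T * (\<Sum>t\<in>T. \<sigma> t (insert v (T - {t})) * c (insert v (T - {t}))) = - c T"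
        by (metis (no_types) add.commute add_eq_0_iff mult_minus_right sq')
      have "coboundary \<sigma> d T = (\<Sum>t\<in>T. - (\<sigma> v T * (\<sigma> t (insert v (T - {t})) * c (insert v (T - {t})))))"
        unfolding coboundary_def
      proof (rule sum.cong[OF refl])
        fix t assume t: "t \<in> T"
        have "\<sigma> t (T - {t}) * \<sigma> v (T - {t}) = - (\<sigma> v (insert t (T - {t})) * \<sigma> t (insert v (T - {t})))"
          by (rule sign_system_cross[OF \<sigma>]) (use t T W False in auto)
        moreover have "insert t (T - {t}) = T" using t by auto
        ultimately have e: "\<sigma> t (T - {t}) * \<sigma> v (T - {t}) = - (\<sigma> v T * \<sigma> t (insert v (T - {t})))" by simp
        have "\<sigma> t (T - {t}) * d (T - {t}) = (\<sigma> t (T - {t}) * \<sigma> v (T - {t})) * c (insert v (T - {t}))"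
          using False by (simp add: d_def)
        also have "\<dots> = - (\<sigma> v T * (\<sigma> t (insert v (T - {t})) * c (insert v (T - {t}))))"
          unfolding e by simp
        finally show "\<sigma> t (T - {t}) * d (T - {t}) = - (\<sigma> v T * (\<sigma> t (insert v (T - {t})) * c (insert v (T - {t}))))" .
      qed
      also have "\<dots> = - (\<sigma> v T * (\<Sum>t\<in>T. \<sigma> t (insert v (T - {t})) * c (insert v (T - {t}))))"
        by (simp add: sum_negf sum_distrib_left)
      finally show ?thesis using 0 by simp
    qed
  qed
qed

text \<open>The part of the long exact sequence of deletion and link that is needed. After a cocycle has been
  corrected by a cochain of the deletion, it is supported on faces through \<open>x\<close>, and such a cocycle is a
  cocycle of the link in one dimension less.\<close>

lemma cohomology_vanishes_delete_link:
  assumes \<sigma>: "sign_system W \<sigma>" and E2: "\<forall>e\<in>E. card e = 2" and W: "finite W" "x \<in> W"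
    and del: "cohomology_vanishes E \<sigma> (W - {x}) (Suc r)"
    and link: "cohomology_vanishes E (\<lambda>s U. \<sigma> s (insert x U)) {y \<in> W. y \<noteq> x \<and> {x, y} \<notin> E} r"
  shows "cohomology_vanishes E \<sigma> W (Suc r)"
  unfolding cohomology_vanishes_def
proof (intro allI impI)
  fix c :: "'a set \<Rightarrow> 'b"
  assume c: "\<forall>T\<subseteq>W. independent E T \<longrightarrow> card T = Suc (Suc r) \<longrightarrow> coboundary \<sigma> c T = 0"
  define L where "L = {y \<in> W. y \<noteq> x \<and> {x, y} \<notin> E}"
  have indL: "insert x U \<subseteq> W" "independent E (insert x U)" if "U \<subseteq> L" "independent E U" for U
  proof -
    show "insert x U \<subseteq> W" using that W by (auto simp: L_def)
    show "independent E (insert x U)"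
      using that by (intro independent_insert[OF E2]) (auto simp: L_def)
  qed
  have "\<forall>T\<subseteq>W - {x}. independent E T \<longrightarrow> card T = Suc (Suc r) \<longrightarrow> coboundary \<sigma> c T = 0"
    using c by blast
  then obtain d where d: "\<And>T. T \<subseteq> W - {x} \<Longrightarrow> independent E T \<Longrightarrow> card T = Suc r \<Longrightarrow> coboundary \<sigma> d T = c T"
    using del unfolding cohomology_vanishes_def by blast
  \<comment> \<open>The values of \<open>d\<close> at faces through \<open>x\<close> are uncontrolled and have to be discarded.\<close>
  define d0 where "d0 U = (if x \<in> U then 0 else d U)" for U
  define c' where "c' T = c T - coboundary \<sigma> d0 T" for T
  have c'0: "c' T = 0" if "T \<subseteq> W - {x}" "independent E T" "card T = Suc r" for T
  proof -
    have "coboundary \<sigma> d0 T = coboundary \<sigma> d T"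
      using that by (intro coboundary_cong) (auto simp: d0_def)
    then show ?thesis using d that by (simp add: c'_def)
  qed
  have c'c: "coboundary \<sigma> c' T = 0" if "T \<subseteq> W" "independent E T" "card T = Suc (Suc r)" for T
    using c that coboundary_coboundary[OF \<sigma> W(1)] unfolding c'_def coboundary_diff by simp
  define \<tau> where "\<tau> = (\<lambda>s U. \<sigma> s (insert x U))"
  have "\<forall>U\<subseteq>L. independent E U \<longrightarrow> card U = Suc r \<longrightarrow> coboundary \<tau> (\<lambda>U. c' (insert x U)) U = 0"
  proof (intro allI impI)
    fix U assume U: "U \<subseteq> L" "independent E U" "card U = Suc r"
    have fU: "finite U" "x \<notin> U" using U W finite_subset[of U W] by (auto simp: L_def)
    have "coboundary \<sigma> c' (insert x U) = 0" using indL U fU by (intro c'c) auto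
    moreover have "c' U = 0" using U by (intro c'0) (auto simp: L_def)
    ultimately show "coboundary \<tau> (\<lambda>U. c' (insert x U)) U = 0"
      using coboundary_insert[OF fU, of \<sigma> c'] by (simp add: \<tau>_def)
  qed
  then obtain d2 where d2: "\<And>U. U \<subseteq> L \<Longrightarrow> independent E U \<Longrightarrow> card U = r \<Longrightarrow> coboundary \<tau> d2 U = c' (insert x U)"
    using link unfolding cohomology_vanishes_def L_def[symmetric] \<tau>_def[symmetric] by blast
  define d1 where "d1 T = (if x \<in> T then d2 (T - {x}) else 0)" for T
  show "\<exists>d. \<forall>T\<subseteq>W. independent E T \<longrightarrow> card T = Suc r \<longrightarrow> coboundary \<sigma> d T = c T"
  proof (intro exI[of _ "\<lambda>T. d0 T + d1 T"] allI impI)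
    fix T assume T: "T \<subseteq> W" "independent E T" "card T = Suc r"
    have "coboundary \<sigma> d1 T = c' T"
    proof (cases "x \<in> T")
      case False
      then have "coboundary \<sigma> d1 T = 0" by (simp add: coboundary_def d1_def)
      then show ?thesis using c'0 T False by auto
    next
      case True
      define U where "U = T - {x}"
      have fU: "T = insert x U" "x \<notin> U" "finite U"
        using True finite_subset[OF T(1) W(1)] by (auto simp: U_def)
      have U: "U \<subseteq> L" "independent E U" "card U = r"
        using T fU unfolding L_def independent_def by auto
      have "coboundary \<tau> (\<lambda>U. d1 (insert x U)) U = coboundary \<tau> d2 U"
        using fU(2) by (intro coboundary_cong) (auto simp: d1_def)
      then show ?thesis unfolding fU(1) coboundary_insert[OF fU(3,2)]
        using d2[OF U] fU(2) by (simp add: \<tau>_def d1_def)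
    qed
    then show "coboundary \<sigma> (\<lambda>T. d0 T + d1 T) T = c T"
      unfolding coboundary_add by (simp add: c'_def)
  qed
qed

text \<open>Here chordality enters: the neighbourhood of a simplicial vertex \<open>v\<close> is contained in the closed
  neighbourhood of each neighbour \<open>x\<close> of \<open>v\<close>, so no edge joins \<open>{v, x}\<close> to a non-neighbour of \<open>x\<close>, and the
  bound for induced matchings drops by one on passing to the link of \<open>x\<close>.\<close>

theorem cohomology_vanishes_chordal:
  fixes \<sigma> :: "'v \<Rightarrow> 'v set \<Rightarrow> 'k::field"
  assumes ch: "chordal E" and E2: "\<forall>e\<in>E. card e = 2"
    and "finite W" "sign_system W \<sigma>"
    and "\<And>M. induced_matching E M \<Longrightarrow> \<Union>M \<subseteq> W \<Longrightarrow> card M < r"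
  shows "cohomology_vanishes E \<sigma> W r"
  using assms(3-)
proof (induction "card W" arbitrary: W \<sigma> r rule: less_induct)
  case less
  have noloop: "{y, y} \<notin> E" for y using E2 by force
  have "card ({} :: 'v set set) < r"
    by (rule less.prems) (auto simp: induced_matching_def)
  then obtain r' where r': "r = Suc r'" by (cases r) auto
  show ?case
  proof (cases "W = {}")
    case True then show ?thesis by (simp add: cohomology_vanishes_def r')
  next
    case False
    then obtain v where v: "v \<in> W" "simplicial_in E W v"
      using chordal_has_simplicial_vertex[OF ch E2 less.prems(1)] by blast
    show ?thesis
    proof (cases "\<exists>x\<in>W. {v, x} \<in> E")
      case False
      then have "independent E (insert v T)" if "T \<subseteq> W" "independent E T" for T
        using that by (intro independent_insert[OF E2]) auto
      \<comment> \<open>An isolated vertex can be added to every independent set.\<close>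
      then show ?thesis by (rule cohomology_vanishes_cone[OF less.prems(2,1) v(1)])
    next
      case True
      then obtain x where x: "x \<in> W" "{v, x} \<in> E" by blast
      define L where "L = {y \<in> W. y \<noteq> x \<and> {x, y} \<notin> E}"
      have LW: "L \<subseteq> W" "x \<notin> L" by (auto simp: L_def)
      have del: "cohomology_vanishes E \<sigma> (W - {x}) r"
      proof (rule less.hyps)
        show "card (W - {x}) < card W" using x less.prems by (intro psubset_card_mono) auto
        show "sign_system (W - {x}) \<sigma>" using less.prems(2) sign_system_subset by blast
        show "finite (W - {x})" using less.prems(1) by simp
        show "card M < r" if "induced_matching E M" "\<Union>M \<subseteq> W - {x}" for M
          by (rule less.prems(3)) (use that in blast)+
      qed
      have link: "cohomology_vanishes E (\<lambda>s U. \<sigma> s (insert x U)) L r'"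
      proof (rule less.hyps)
        show "card L < card W" using x less.prems LW by (intro psubset_card_mono) auto
        show "finite L" using less.prems LW finite_subset by blast
        show "sign_system L (\<lambda>s U. \<sigma> s (insert x U))"
          using less.prems(2) LW x by (intro sign_system_link) auto
        fix M assume M: "induced_matching E M" "\<Union>M \<subseteq> L"
        have vL: "v \<notin> L" using x by (auto simp: L_def insert_commute)
        have gp: "gap E {v, x} e" if e: "e \<in> M" for e
          unfolding gap_def
        proof (intro ballI, rule ccontr)
          fix g assume g: "g \<in> E" "\<not> (g \<inter> {v, x} = {} \<or> g \<inter> e = {})"
          then obtain y where y: "y \<in> g" "y \<in> e" by auto
          then have yL: "y \<in> L" using M e by auto
          obtain z where z: "z \<in> g" "z = v \<or> z = x" using g by auto
          then have "z \<noteq> y" using yL vL LW by auto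
          moreover have "card g = 2" using g E2 by blast
          ultimately have gz: "g = {z, y}" using y z by (metis card_2_iff doubleton_eq_iff insert_iff singletonD)
          have "{x, y} \<in> E"
          proof (cases "z = x")
            case True then show ?thesis using gz g by simp
          next
            case False
            then have "{v, y} \<in> E" using z gz g by simp
            then show ?thesis using v x yL unfolding simplicial_in_def L_def by blast
          qed
          then show False using yL by (simp add: L_def)
        qed
        have notin: "{v, x} \<notin> M" using M LW by auto
        have "induced_matching E (insert {v, x} M)"
          using M x gp unfolding induced_matching_def pairwise_insert
          by (auto simp: gap_def)
        moreover have "\<Union>(insert {v, x} M) \<subseteq> W" using M LW v x by auto
        ultimately have "card (insert {v, x} M) < r" using less.prems by blast
        moreover have "finite M" using M LW less.prems(1)
          by (meson finite_subset finite_UnionD subset_trans)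
        ultimately show "card M < r'" using notin r' by simp
      qed
      show ?thesis unfolding r'
        by (rule cohomology_vanishes_delete_link[OF less.prems(2) E2 less.prems(1) x(1)])
          (use del link r' L_def in auto)
    qed
  qed
qed

text \<open>The independent transversals of an induced matching form an iterated suspension, one suspension for each
  edge \<open>{a, b}\<close>. A cochain that is not a coboundary is carried along by extending it to the faces through
  \<open>a\<close> and by zero to the faces through \<open>b\<close>.\<close>

lemma induced_matching_fundamental_cocycle:
  fixes \<sigma> :: "'v \<Rightarrow> 'v set \<Rightarrow> 'k::field"
  assumes E2: "\<forall>e\<in>E. card e = 2" and "finite M" "induced_matching E M" "sign_system (\<Union>M) \<sigma>"
  shows "\<exists>c. \<forall>d. \<exists>T\<subseteq>\<Union>M. independent E T \<and> card T = card M \<and> coboundary \<sigma> d T \<noteq> c T"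
  using assms(2-)
proof (induction M arbitrary: \<sigma>)
  case empty
  have "independent E {}" using E2 by (force simp: independent_def)
  then show ?case by (intro exI[of _ "\<lambda>_. 1"]) (auto simp: coboundary_def)
next
  case (insert e M)
  note \<sigma> = insert.prems(2)
  have sq: "\<sigma> s T * \<sigma> s T = 1" for s T by (rule sign_system_square[OF \<sigma>])
  have sq': "\<sigma> s T * (\<sigma> s T * z) = z" for s T z by (metis mult.assoc mult.left_neutral sq)
  have eE: "e \<in> E" using insert.prems by (auto simp: induced_matching_def)
  then obtain a b where ab: "e = {a, b}" "a \<noteq> b" using E2 by (meson card_2_iff)
  have M: "induced_matching E M" and gp: "\<And>h. h \<in> M \<Longrightarrow> gap E e h"
    using insert.prems insert.hyps unfolding induced_matching_def pairwise_insert by auto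
  have disj: "e \<inter> \<Union>M = {}"
  proof -
    have "e \<inter> h = {}" if "h \<in> M" for h using gp[OF that] eE ab unfolding gap_def by auto
    then show ?thesis by auto
  qed
  define W where "W = \<Union>M"
  have aW: "a \<notin> W" "b \<notin> W" using disj ab by (auto simp: W_def)
  have finM: "finite h" if "h \<in> M" for h using that M E2 unfolding induced_matching_def
    by (metis card.infinite subsetD zero_neq_numeral)
  have finW: "finite W" unfolding W_def using insert.hyps finM by auto
  have sub: "W \<subseteq> \<Union>(insert e M)" "a \<in> \<Union>(insert e M)" "b \<in> \<Union>(insert e M)"
    using ab by (auto simp: W_def)
  have ind: "independent E (insert y U)" if y: "y \<in> e" and U: "U \<subseteq> W" "independent E U" for y U
  proof (rule independent_insert[OF E2 U(2)])
    fix z assume "z \<in> U"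
    then obtain h where "h \<in> M" "z \<in> h" using U by (auto simp: W_def)
    then show "{y, z} \<notin> E" using gp[of h] y unfolding gap_def by (meson disjoint_iff insertI1 insert_iff)
  qed
  define \<tau> where "\<tau> = (\<lambda>s U. \<sigma> s (insert a U))"
  have "sign_system W \<tau>" unfolding \<tau>_def by (rule sign_system_link[OF \<sigma> sub(1,2) aW(1)])
  then obtain c where c: "\<And>d. \<exists>T\<subseteq>W. independent E T \<and> card T = card M \<and> coboundary \<tau> d T \<noteq> c T"
    using insert.IH[OF M] unfolding W_def by blast
  \<comment> \<open>The cochain on the matching with \<open>e\<close> is \<open>c\<close> on the side of \<open>a\<close> and zero on the side of \<open>b\<close>.\<close>
  define c' where "c' T = (if a \<in> T then c (T - {a}) else 0)" for T
  have "\<exists>T\<subseteq>\<Union>(insert e M). independent E T \<and> card T = card (insert e M) \<and> coboundary \<sigma> d T \<noteq> c' T" for d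
  proof (rule ccontr)
    assume "\<not> ?thesis"
    then have all: "\<And>T. T \<subseteq> \<Union>(insert e M) \<Longrightarrow> independent E T \<Longrightarrow> card T = card (insert e M) \<Longrightarrow> coboundary \<sigma> d T = c' T"
      by blast
    \<comment> \<open>Comparing the equations at \<open>U + a\<close> and \<open>U + b\<close> eliminates the value of \<open>d\<close> at \<open>U\<close>.\<close>
    define h where "h U = \<sigma> a U * (\<sigma> a U * d (insert a U) - \<sigma> b U * d (insert b U))" for U
    obtain U where U: "U \<subseteq> W" "independent E U" "card U = card M" "coboundary \<tau> h U \<noteq> c U"
      using c by blast
    have fU: "finite U" using U finW finite_subset by blast
    have aU: "a \<notin> U" "b \<notin> U" using U aW by auto
    have cardU: "card (insert y U) = card (insert e M)" if "y \<notin> U" for y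
      using that fU U insert.hyps by simp
    have A: "coboundary \<sigma> d (insert a U) = c U"
      using all[of "insert a U"] ind[of a U] U ab cardU aU sub by (auto simp: c'_def)
    have B: "coboundary \<sigma> d (insert b U) = 0"
      using all[of "insert b U"] ind[of b U] U ab cardU aU sub by (auto simp: c'_def)
    define g where "g y = (\<Sum>t\<in>U. \<sigma> t (U - {t}) * (\<sigma> y (U - {t}) * d (insert y (U - {t}))))" for y
    have expand: "\<sigma> y U * coboundary \<sigma> d (insert y U) = d U - g y" if y: "y \<in> {a, b}" for y
    proof -
      have yU: "y \<notin> U" using y aU by auto
      have "\<sigma> y U * coboundary (\<lambda>s U. \<sigma> s (insert y U)) (\<lambda>U. d (insert y U)) U = - g y"
        unfolding coboundary_def g_def sum_distrib_left sum_negf[symmetric]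
      proof (rule sum.cong[OF refl])
        fix t assume t: "t \<in> U"
        have "\<sigma> t (U - {t}) * \<sigma> y (U - {t}) = - (\<sigma> y (insert t (U - {t})) * \<sigma> t (insert y (U - {t})))"
          by (rule sign_system_cross[OF \<sigma>]) (use t y U sub yU in auto)
        moreover have "insert t (U - {t}) = U" using t by auto
        ultimately have e: "\<sigma> t (U - {t}) * \<sigma> y (U - {t}) = - (\<sigma> y U * \<sigma> t (insert y (U - {t})))" by simp
        have "- (\<sigma> t (U - {t}) * (\<sigma> y (U - {t}) * d (insert y (U - {t})))) =
          - (\<sigma> t (U - {t}) * \<sigma> y (U - {t})) * d (insert y (U - {t}))" by simp
        then show "\<sigma> y U * (\<sigma> t (insert y (U - {t})) * d (insert y (U - {t}))) =
          - (\<sigma> t (U - {t}) * (\<sigma> y (U - {t}) * d (insert y (U - {t}))))"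
          unfolding e by simp
      qed
      then show ?thesis unfolding coboundary_insert[OF fU yU] by (simp add: distrib_left sq')
    qed
    have ga: "\<sigma> a U * c U = d U - g a" using expand[of a] A by simp
    have gb: "d U = g b" using expand[of b] B by simp
    have "c U = \<sigma> a U * (g b - g a)" using ga gb by (metis sq')
    also have "\<dots> = (\<Sum>t\<in>U. \<tau> t (U - {t}) * h (U - {t}))"
      unfolding g_def sum_subtractf[symmetric] sum_distrib_left
    proof (rule sum.cong[OF refl])
      fix t assume t: "t \<in> U"
      have "\<sigma> t (U - {t}) * \<sigma> a (insert t (U - {t})) = - (\<sigma> a (U - {t}) * \<sigma> t (insert a (U - {t})))"
        by (rule sign_system_swap[OF \<sigma>]) (use U sub t aU in auto)
      moreover have "insert t (U - {t}) = U" using t by auto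
      ultimately have e: "\<sigma> a U * \<sigma> t (U - {t}) = - (\<sigma> a (U - {t}) * \<tau> t (U - {t}))"
        by (simp add: \<tau>_def mult.commute)
      have "\<sigma> a U * (\<sigma> t (U - {t}) * (\<sigma> b (U - {t}) * d (insert b (U - {t}))) -
         \<sigma> t (U - {t}) * (\<sigma> a (U - {t}) * d (insert a (U - {t})))) =
         (\<sigma> a U * \<sigma> t (U - {t})) * (\<sigma> b (U - {t}) * d (insert b (U - {t})) - \<sigma> a (U - {t}) * d (insert a (U - {t})))"
        by (simp add: algebra_simps)
      then show "\<sigma> a U * (\<sigma> t (U - {t}) * (\<sigma> b (U - {t}) * d (insert b (U - {t}))) -
         \<sigma> t (U - {t}) * (\<sigma> a (U - {t}) * d (insert a (U - {t})))) = \<tau> t (U - {t}) * h (U - {t})"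
        unfolding e h_def by (simp add: algebra_simps)
    qed
    finally have "coboundary \<tau> h U = c U" by (simp only: coboundary_def)
    then show False using U(4) by contradiction
  qed
  then show ?case by blast
qed

lemma card_independent_in_matching:
  assumes E2: "\<forall>e\<in>E. card e = 2" and M: "finite M" "M \<subseteq> E" and T: "T \<subseteq> \<Union>M" "independent E T"
  shows "card T \<le> card M"
proof -
  have "T = (\<Union>e\<in>M. e \<inter> T)" using T by auto
  then have "card T \<le> (\<Sum>e\<in>M. card (e \<inter> T))" using card_UN_le[OF M(1)] by metis
  also have "\<dots> \<le> (\<Sum>e\<in>M. 1)"
  proof (rule sum_mono)
    fix e assume e: "e \<in> M"
    then have ce: "card e = 2" using E2 M by blast
    have "\<not> e \<subseteq> T" using e M T unfolding independent_def by blast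
    then have "e \<inter> T \<subset> e" by auto
    then have "card (e \<inter> T) < card e" using ce by (intro psubset_card_mono) (auto intro: card_ge_0_finite)
    then show "card (e \<inter> T) \<le> 1" using ce by simp
  qed
  finally show ?thesis by simp
qed

text \<open>Every top-dimensional cochain is a cocycle, because an independent set contains at most one vertex of
  each edge.\<close>

theorem cohomology_induced_matching_nonzero:
  fixes \<sigma> :: "'v \<Rightarrow> 'v set \<Rightarrow> 'k::field"
  assumes E2: "\<forall>e\<in>E. card e = 2" and M: "finite M" "induced_matching E M" and "sign_system (\<Union>M) \<sigma>"
  shows "\<not> cohomology_vanishes E \<sigma> (\<Union>M) (card M)"
proof -
  obtain c where c: "\<And>d. \<exists>T\<subseteq>\<Union>M. independent E T \<and> card T = card M \<and> coboundary \<sigma> d T \<noteq> c T"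
    using induced_matching_fundamental_cocycle[OF assms] by blast
  have "coboundary \<sigma> c T = 0" if "T \<subseteq> \<Union>M" "independent E T" "card T = Suc (card M)" for T
    using card_independent_in_matching[OF E2 M(1) _ that(1,2)] M that by (simp add: induced_matching_def)
  moreover have "\<not> (\<exists>d. \<forall>T\<subseteq>\<Union>M. independent E T \<longrightarrow> card T = card M \<longrightarrow> coboundary \<sigma> d T = c T)"
  proof
    assume "\<exists>d. \<forall>T\<subseteq>\<Union>M. independent E T \<longrightarrow> card T = card M \<longrightarrow> coboundary \<sigma> d T = c T"
    then obtain d where d: "\<And>T. T \<subseteq> \<Union>M \<Longrightarrow> independent E T \<Longrightarrow> card T = card M \<Longrightarrow> coboundary \<sigma> d T = c T"
      by (elim exE) blast
    from c[of d] show False using d by (elim exE conjE) simp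
  qed
  ultimately show ?thesis unfolding cohomology_vanishes_def not_all not_imp
    by (intro exI[of _ c] conjI allI impI)
qed

section \<open>Monomials and polynomials\<close>

abbreviation coeff :: "('a \<Rightarrow>\<^sub>0 'b::zero) \<Rightarrow> 'a \<Rightarrow> 'b" where
  "coeff \<equiv> Poly_Mapping.lookup"

abbreviation supp :: "('a \<Rightarrow>\<^sub>0 'b::zero) \<Rightarrow> 'a set" where
  "supp \<equiv> Poly_Mapping.keys"

abbreviation sing :: "'a \<Rightarrow> 'b \<Rightarrow> ('a \<Rightarrow>\<^sub>0 'b::zero)" where
  "sing \<equiv> Poly_Mapping.single"

lemma sum_fun_apply: "(\<Sum>i\<in>I. f i) x = (\<Sum>i\<in>I. f i x)"
  by (induction I rule: infinite_finite_induct) simp_all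

lemma coeff_single_mult:
  fixes p :: "('v, 'k::comm_ring_1) mpoly"
  shows "coeff (sing u a * p) (u + m) = a * coeff p m"
    and "(\<And>m'. m \<noteq> u + m') \<Longrightarrow> coeff (sing u a * p) m = 0"
proof -
  have *: "coeff (sing u a * p) m = a * (\<Sum>q. coeff p q when m = u + q)" for m
    by (simp add: lookup_mult lookup_single when_mult)
  show "coeff (sing u a * p) (u + m) = a * coeff p m" by (simp add: *)
  show "coeff (sing u a * p) m = 0" if "\<And>m'. m \<noteq> u + m'" using that by (simp add: *)
qed

lemma coeff_const_mult:
  fixes p :: "('v, 'k::comm_ring_1) mpoly"
  shows "coeff (sing 0 a * p) m = a * coeff p m"
  using coeff_single_mult(1)[of 0 a p m] by simp

lemma split_var: "s \<in> supp m \<Longrightarrow> m = sing s 1 + (m - sing s (1::nat))"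
  by (rule poly_mapping_eqI) (auto simp: lookup_add lookup_minus lookup_single when_def in_keys_iff)

lemma coeff_var_mult:
  fixes p :: "('v, 'k::comm_ring_1) mpoly"
  shows "coeff (var s * p) m = (if s \<in> supp m then coeff p (m - sing s 1) else 0)"
proof (cases "s \<in> supp m")
  case True
  then show ?thesis using coeff_single_mult(1)[of "sing s 1" 1 p "m - sing s 1"] split_var[OF True]
    by (simp add: var_def)
next
  case False
  have "m \<noteq> sing s 1 + m'" for m' using False by (auto simp: in_keys_iff lookup_add)
  then show ?thesis using False by (simp add: var_def coeff_single_mult(2))
qed

lemma coeff_sign_mult:
  fixes p :: "('v, 'k::comm_ring_1) mpoly"
  shows "coeff ((- 1) ^ k * p) m = (- 1) ^ k * coeff p m"
  by (cases "even k") simp_all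

lemma monom_deg_altdef: "finite A \<Longrightarrow> supp m \<subseteq> A \<Longrightarrow> monom_deg m = (\<Sum>v\<in>A. coeff m v)"
  unfolding monom_deg_def by (rule sum.mono_neutral_left) (auto simp: in_keys_iff)

lemma monom_deg_add: "monom_deg (a + b) = monom_deg a + monom_deg b"
proof -
  let ?A = "supp a \<union> supp b"
  have "monom_deg (a + b) = (\<Sum>v\<in>?A. coeff (a + b) v)" "monom_deg a = (\<Sum>v\<in>?A. coeff a v)"
    "monom_deg b = (\<Sum>v\<in>?A. coeff b v)"
    by (rule monom_deg_altdef; use keys_add[of a b] in auto)+
  then show ?thesis by (simp add: lookup_add sum.distrib)
qed

lemma monom_deg_zero [simp]: "monom_deg 0 = 0"
  by (simp add: monom_deg_def)

lemma monom_deg_single [simp]: "monom_deg (sing v n) = n"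
  by (cases "n = 0") (simp_all add: monom_deg_def)

lemma monom_deg_eq_0_iff: "monom_deg m = 0 \<longleftrightarrow> m = 0"
proof
  assume "monom_deg m = 0"
  then have "\<forall>v\<in>supp m. coeff m v = 0" by (simp add: monom_deg_def)
  then show "m = 0" by (intro poly_mapping_eqI) (metis in_keys_iff lookup_zero)
qed simp

lemma supp_add_monom: "supp (a + b :: 'v \<Rightarrow>\<^sub>0 nat) = supp a \<union> supp b"
  by (auto simp: in_keys_iff lookup_add)

lemma finite_monoms_of_degree:
  assumes "finite V"
  shows "finite {m :: 'v \<Rightarrow>\<^sub>0 nat. supp m \<subseteq> V \<and> monom_deg m \<le> j}"
proof -
  have "finite {f. \<forall>v. (v \<in> V \<longrightarrow> f v \<in> {..j}) \<and> (v \<notin> V \<longrightarrow> f v = (0::nat))}"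
    using assms by (intro finite_set_of_finite_funs) auto
  moreover have "coeff ` {m :: 'v \<Rightarrow>\<^sub>0 nat. supp m \<subseteq> V \<and> monom_deg m \<le> j} \<subseteq>
      {f. \<forall>v. (v \<in> V \<longrightarrow> f v \<in> {..j}) \<and> (v \<notin> V \<longrightarrow> f v = (0::nat))}"
  proof (clarsimp, intro conjI impI)
    fix m :: "'v \<Rightarrow>\<^sub>0 nat" and v
    assume m: "supp m \<subseteq> V" "monom_deg m \<le> j"
    show "v \<notin> V \<Longrightarrow> coeff m v = 0" using m by (auto simp: in_keys_iff)
    assume "v \<in> V"
    then have "coeff m v \<le> monom_deg m"
      unfolding monom_deg_altdef[OF assms m(1)] using assms by (intro member_le_sum) auto
    then show "coeff m v \<le> j" using m by simp
  qed
  ultimately have "finite (coeff ` {m :: 'v \<Rightarrow>\<^sub>0 nat. supp m \<subseteq> V \<and> monom_deg m \<le> j})"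
    using finite_subset by blast
  then show ?thesis by (rule finite_imageD) (auto intro: inj_onI poly_mapping_eqI)
qed

definition sqfree_monom :: "'v set \<Rightarrow> 'v \<Rightarrow>\<^sub>0 nat" where
  "sqfree_monom S = (\<Sum>s\<in>S. sing s 1)"

lemma coeff_sqfree_monom: "finite S \<Longrightarrow> coeff (sqfree_monom S) v = (if v \<in> S then 1 else 0)"
  by (simp add: sqfree_monom_def lookup_sum lookup_single when_def)

lemma supp_sqfree_monom: "finite S \<Longrightarrow> supp (sqfree_monom S) = S"
  by (auto simp: in_keys_iff coeff_sqfree_monom split: if_splits)

lemma monom_deg_sqfree_monom: "finite S \<Longrightarrow> monom_deg (sqfree_monom S) = card S"
  by (simp add: monom_deg_def supp_sqfree_monom coeff_sqfree_monom)

lemma sqfree_monom_empty [simp]: "sqfree_monom {} = 0"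
  by (simp add: sqfree_monom_def)

lemma sqfree_monom_insert:
  "finite S \<Longrightarrow> s \<notin> S \<Longrightarrow> sqfree_monom (insert s S) = sqfree_monom S + sing s 1"
  by (simp add: sqfree_monom_def add.commute)

lemma split_sqfree_monom:
  assumes "finite S" "S \<subseteq> supp m"
  shows "m - sqfree_monom S + sqfree_monom S = m"
  using assms by (intro poly_mapping_eqI)
    (auto simp: lookup_add lookup_minus coeff_sqfree_monom in_keys_iff)

definition poly_filter :: "('a \<Rightarrow> bool) \<Rightarrow> ('a \<Rightarrow>\<^sub>0 'b::comm_monoid_add) \<Rightarrow> ('a \<Rightarrow>\<^sub>0 'b)" where
  "poly_filter P p = (\<Sum>m\<in>{m \<in> supp p. P m}. sing m (coeff p m))"

lemma coeff_poly_filter: "coeff (poly_filter P p) m = (if P m then coeff p m else 0)"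
  by (auto simp: poly_filter_def lookup_sum lookup_single when_def in_keys_iff)

lemma supp_poly_filter: "supp (poly_filter P p) = {m \<in> supp p. P m}"
  by (auto simp: in_keys_iff coeff_poly_filter split: if_splits)

lemma poly_filter_add: "poly_filter P (p + q) = poly_filter P p + poly_filter P q"
  by (rule poly_mapping_eqI) (simp add: coeff_poly_filter lookup_add)

lemma poly_filter_sum: "poly_filter P (\<Sum>i\<in>I. p i) = (\<Sum>i\<in>I. poly_filter P (p i))"
  by (rule poly_mapping_eqI) (simp add: coeff_poly_filter lookup_sum)

lemma poly_eq_sum_monoms: "p = (\<Sum>m\<in>supp p. sing m (coeff p m))"
  by (rule poly_mapping_eqI) (simp add: lookup_sum lookup_single when_def in_keys_iff)

lemma supp_empty_iff: "supp p \<subseteq> {} \<longleftrightarrow> p = 0"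
proof
  assume "supp p \<subseteq> {}"
  then have "coeff p m = 0" for m by (auto simp: in_keys_iff)
  then show "p = 0" by (intro poly_mapping_eqI) simp
qed simp

lemma poly_ring_zero [simp]: "0 \<in> poly_ring V"
  by (simp add: poly_ring_def)

lemma poly_ring_single: "supp m \<subseteq> V \<Longrightarrow> sing m a \<in> poly_ring V"
  by (simp add: poly_ring_def)

lemma poly_ring_one [simp]: "1 \<in> poly_ring V"
  by (simp add: poly_ring_def)

lemma poly_ring_var: "v \<in> V \<Longrightarrow> var v \<in> poly_ring V"
  by (simp add: var_def poly_ring_def)

lemma poly_ring_add: "p \<in> poly_ring V \<Longrightarrow> q \<in> poly_ring V \<Longrightarrow> p + q \<in> poly_ring V"
  unfolding poly_ring_def using keys_add[of p q] by blast

lemma poly_ring_mult: "p \<in> poly_ring V \<Longrightarrow> q \<in> poly_ring V \<Longrightarrow> p * q \<in> poly_ring V"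
  unfolding poly_ring_def mem_Collect_eq
proof
  fix m assume pq: "\<forall>m\<in>supp p. supp m \<subseteq> V" "\<forall>m\<in>supp q. supp m \<subseteq> V" and "m \<in> supp (p * q)"
  then obtain a b where "m = a + b" "a \<in> supp p" "b \<in> supp q" using keys_mult[of p q] by blast
  then show "supp m \<subseteq> V" using pq by (simp add: supp_add_monom)
qed

lemma poly_ring_uminus: "p \<in> poly_ring V \<Longrightarrow> - p \<in> poly_ring V"
  by (simp add: poly_ring_def in_keys_iff)

lemma poly_ring_sum: "(\<And>i. i \<in> I \<Longrightarrow> p i \<in> poly_ring V) \<Longrightarrow> (\<Sum>i\<in>I. p i) \<in> poly_ring V"
  by (induction I rule: infinite_finite_induct) (auto intro: poly_ring_add)

lemma poly_ring_sign: "(- 1) ^ k \<in> poly_ring V"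
  by (cases "even k") (auto intro: poly_ring_uminus)

text \<open>The polynomials without constant term form an ideal.\<close>

lemma coeff_mult_zero_monom:
  fixes p q :: "('v, 'k::comm_ring_1) mpoly"
  assumes "coeff q 0 = 0"
  shows "coeff (p * q) 0 = 0"
proof (rule ccontr)
  assume "coeff (p * q) 0 \<noteq> 0"
  then have "0 \<in> supp (p * q)" by (simp add: in_keys_iff)
  then obtain a b where ab: "0 = a + b" "b \<in> supp q" using keys_mult[of p q] by blast
  then have "monom_deg b = 0" by (metis add_is_0 monom_deg_add monom_deg_zero)
  then show False using ab assms by (simp add: monom_deg_eq_0_iff in_keys_iff)
qed

text \<open>Membership in a monomial ideal is decided monomial by monomial. This describes both the irrelevant
  ideal and the edge ideal through the supports of their elements.\<close>

lemma ideal_gen_monomials: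
  assumes U: "\<And>u. u \<in> U \<Longrightarrow> supp u \<subseteq> V"
  shows "ideal_gen V ((\<lambda>u. sing u 1) ` U) =
    {p :: ('v, 'k::comm_ring_1) mpoly. \<forall>m\<in>supp p. \<exists>u\<in>U. \<exists>x. supp x \<subseteq> V \<and> m = x + u}"
proof (intro equalityI subsetI CollectI ballI)
  fix p :: "('v, 'k) mpoly" and m
  assume "p \<in> ideal_gen V ((\<lambda>u. sing u 1) ` U)" and m: "m \<in> supp p"
  then obtain T r where p: "p = (\<Sum>s\<in>T. r s * s)" "T \<subseteq> (\<lambda>u. sing u 1) ` U" "\<forall>s\<in>T. r s \<in> poly_ring V"
    unfolding ideal_gen_def by blast
  have "\<exists>s\<in>T. m \<in> supp (r s * s)"
  proof (rule ccontr)
    assume "\<not> ?thesis"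
    then have "coeff p m = 0" unfolding p(1) by (simp add: lookup_sum in_keys_iff)
    then show False using m by (simp add: in_keys_iff)
  qed
  then obtain s where s: "s \<in> T" "m \<in> supp (r s * s)" by blast
  then obtain x y where xy: "m = x + y" "x \<in> supp (r s)" "y \<in> supp s" using keys_mult[of "r s" s] by blast
  obtain u where u: "u \<in> U" "s = sing u 1" using p(2) s(1) by blast
  have "y = u" using xy(3) u(2) by simp
  moreover have "supp x \<subseteq> V" using p(3) s(1) xy(2) by (simp add: poly_ring_def)
  ultimately show "\<exists>u\<in>U. \<exists>x. supp x \<subseteq> V \<and> m = x + u" using u(1) xy(1) by blast
next
  fix p :: "('v, 'k) mpoly"
  assume "p \<in> {p. \<forall>m\<in>supp p. \<exists>u\<in>U. \<exists>x. supp x \<subseteq> V \<and> m = x + u}"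
  then have "\<forall>m\<in>supp p. \<exists>ux. fst ux \<in> U \<and> supp (snd ux) \<subseteq> V \<and> m = snd ux + fst ux"
    by (simp add: split_paired_Ex) blast
  from bchoice[OF this] obtain ux where
    ux: "\<And>m. m \<in> supp p \<Longrightarrow> fst (ux m) \<in> U \<and> supp (snd (ux m)) \<subseteq> V \<and> m = snd (ux m) + fst (ux m)"
    by blast
  define g :: "('v \<Rightarrow>\<^sub>0 nat) \<Rightarrow> ('v, 'k) mpoly" where "g m = sing (fst (ux m)) 1" for m
  define r where "r s = (\<Sum>m\<in>{m \<in> supp p. g m = s}. sing (snd (ux m)) (coeff p m))" for s
  have "(\<Sum>s\<in>g ` supp p. r s * s) = (\<Sum>s\<in>g ` supp p. \<Sum>m\<in>{m \<in> supp p. g m = s}. sing m (coeff p m))"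
    unfolding r_def sum_distrib_right
  proof (intro sum.cong refl)
    fix s m assume m: "m \<in> {m \<in> supp p. g m = s}"
    then have "sing (snd (ux m)) (coeff p m) * s = sing (snd (ux m) + fst (ux m)) (coeff p m)"
      by (auto simp: g_def mult_single)
    then show "sing (snd (ux m)) (coeff p m) * s = sing m (coeff p m)" using ux m by simp
  qed
  also have "\<dots> = (\<Sum>m\<in>supp p. sing m (coeff p m))" by (rule sum.image_gen[symmetric]) simp
  finally have "p = (\<Sum>s\<in>g ` supp p. r s * s)" using poly_eq_sum_monoms[of p] by simp
  moreover have "g ` supp p \<subseteq> (\<lambda>u. sing u 1) ` U" using ux unfolding g_def by blast
  moreover have "r s \<in> poly_ring V" for s
    unfolding r_def using ux by (intro poly_ring_sum poly_ring_single) simp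
  ultimately show "p \<in> ideal_gen V ((\<lambda>u. sing u 1) ` U)"
    unfolding ideal_gen_def by (intro CollectI exI[of _ "g ` supp p"] exI[of _ r]) simp
qed

lemma irrelevant_ideal_iff:
  fixes p :: "('v, 'k::comm_ring_1) mpoly"
  shows "p \<in> irrelevant_ideal V \<longleftrightarrow> p \<in> poly_ring V \<and> coeff p 0 = 0"
proof -
  have "var ` V = (\<lambda>u. sing u (1::'k)) ` ((\<lambda>v. sing v 1) ` V)" by (auto simp: var_def image_image)
  then have "irrelevant_ideal V = {p :: ('v, 'k) mpoly. \<forall>m\<in>supp p. \<exists>u\<in>(\<lambda>v. sing v 1) ` V. \<exists>x. supp x \<subseteq> V \<and> m = x + u}"
    unfolding irrelevant_ideal_def by (simp only:) (rule ideal_gen_monomials, auto)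
  moreover have "(\<exists>u\<in>(\<lambda>v. sing v 1) ` V. \<exists>x. supp x \<subseteq> V \<and> m = x + u) \<longleftrightarrow> supp m \<subseteq> V \<and> m \<noteq> 0"
    for m :: "'v \<Rightarrow>\<^sub>0 nat"
  proof
    assume "\<exists>u\<in>(\<lambda>v. sing v 1) ` V. \<exists>x. supp x \<subseteq> V \<and> m = x + u"
    then obtain v x where vx: "v \<in> V" "supp x \<subseteq> V" "m = x + sing v 1" by blast
    then have "supp m = supp x \<union> {v}" by (simp add: supp_add_monom)
    then show "supp m \<subseteq> V \<and> m \<noteq> 0" using vx by auto
  next
    assume m: "supp m \<subseteq> V \<and> m \<noteq> 0"
    then have "\<not> supp m \<subseteq> {}" using supp_empty_iff by blast
    then obtain v where v: "v \<in> supp m" by blast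
    have "supp (m - sing v 1) \<subseteq> V" using m by (auto simp: in_keys_iff lookup_minus)
    then show "\<exists>u\<in>(\<lambda>v. sing v 1) ` V. \<exists>x. supp x \<subseteq> V \<and> m = x + u"
      using split_var[OF v] v m by (intro bexI[of _ "sing v 1"] exI[of _ "m - sing v 1"]) (auto simp: add.commute)
  qed
  ultimately show ?thesis by (auto simp: poly_ring_def in_keys_iff)
qed

section \<open>Graded submodules of free modules\<close>

type_synonym ('v, 'k) poly_vec = "nat \<Rightarrow> ('v, 'k) mpoly"

definition smul :: "('v, 'k::comm_ring_1) mpoly \<Rightarrow> ('v, 'k) poly_vec \<Rightarrow> ('v, 'k) poly_vec" where
  "smul p f = (\<lambda>q. p * f q)"

lemma smul_apply [simp]: "smul p f q = p * f q"
  by (simp add: smul_def)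

text \<open>The parameter \<open>p\<close> is an index in the Koszul complex: the coefficient of a \<open>p\<close>-element set counts with
  degree increased by \<open>p\<close>. Adding \<open>p\<close> on the left-hand side avoids truncated subtraction.\<close>

definition homogeneous :: "(nat \<Rightarrow> nat) \<Rightarrow> nat \<Rightarrow> nat \<Rightarrow> ('v, 'k::comm_ring_1) poly_vec \<Rightarrow> bool" where
  "homogeneous sh p j f \<longleftrightarrow> (\<forall>q. \<forall>m\<in>supp (f q). monom_deg m + sh q + p = j)"

definition hom_part :: "(nat \<Rightarrow> nat) \<Rightarrow> nat \<Rightarrow> nat \<Rightarrow> ('v, 'k::comm_ring_1) poly_vec \<Rightarrow> ('v, 'k) poly_vec" where
  "hom_part sh p j f = (\<lambda>q. poly_filter (\<lambda>m. monom_deg m + sh q + p = j) (f q))"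

lemma homogeneous_hom_part: "homogeneous sh p j (hom_part sh p j f)"
  by (simp add: homogeneous_def hom_part_def supp_poly_filter)

lemma hom_part_homogeneous: "homogeneous sh p j f \<Longrightarrow> hom_part sh p j f = f"
proof (rule ext, rule poly_mapping_eqI)
  fix q m assume "homogeneous sh p j f"
  then have "coeff (f q) m \<noteq> 0 \<Longrightarrow> monom_deg m + sh q + p = j"
    by (simp add: homogeneous_def in_keys_iff)
  then show "coeff (hom_part sh p j f q) m = coeff (f q) m"
    by (auto simp: hom_part_def coeff_poly_filter)
qed

lemma hom_part_shift: "hom_part sh p (j + p) f = hom_part sh 0 j f"
  by (simp add: hom_part_def)

lemma hom_part_degree_zero: "j < p \<Longrightarrow> hom_part sh p j f = 0"
  by (rule ext, rule poly_mapping_eqI) (simp add: hom_part_def coeff_poly_filter)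

lemma homogeneous_zero [simp]: "homogeneous sh p j 0"
  by (simp add: homogeneous_def)

lemma homogeneous_add: "homogeneous sh p j f \<Longrightarrow> homogeneous sh p j g \<Longrightarrow> homogeneous sh p j (f + g)"
  unfolding homogeneous_def plus_fun_apply using keys_add by (metis Un_iff subsetD)

lemma homogeneous_sum:
  "(\<And>i. i \<in> I \<Longrightarrow> homogeneous sh p j (f i)) \<Longrightarrow> homogeneous sh p j (\<Sum>i\<in>I. f i)"
  by (induction I rule: infinite_finite_induct) (auto intro: homogeneous_add)

lemma homogeneous_smul:
  assumes "homogeneous sh p j f" "\<And>m. m \<in> supp a \<Longrightarrow> monom_deg m = d"
  shows "homogeneous sh p (d + j) (smul a f)"
  unfolding homogeneous_def
proof (intro allI ballI)
  fix q m assume "m \<in> supp (smul a f q)"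
  then obtain x y where xy: "m = x + y" "x \<in> supp a" "y \<in> supp (f q)"
    using keys_mult[of a "f q"] unfolding smul_apply by blast
  have "monom_deg y + sh q + p = j" using xy(3) assms(1) unfolding homogeneous_def by blast
  then show "monom_deg m + sh q + p = d + j" using assms(2)[OF xy(2)] xy(1) by (simp add: monom_deg_add)
qed

text \<open>Closure under taking homogeneous parts is what makes a submodule graded.\<close>

definition graded_submodule ::
  "'v set \<Rightarrow> (nat \<Rightarrow> nat) \<Rightarrow> nat \<Rightarrow> ('v, 'k::comm_ring_1) poly_vec set \<Rightarrow> bool" where
  "graded_submodule V sh n Z \<longleftrightarrow> Z \<subseteq> free_mod V n \<and> 0 \<in> Z \<and> (\<forall>f\<in>Z. \<forall>g\<in>Z. f + g \<in> Z) \<and>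
     (\<forall>a\<in>poly_ring V. \<forall>f\<in>Z. smul a f \<in> Z) \<and> (\<forall>j. \<forall>f\<in>Z. hom_part sh 0 j f \<in> Z)"

context
  fixes V :: "'v set" and sh n and Z :: "('v, 'k::comm_ring_1) poly_vec set"
  assumes Z: "graded_submodule V sh n Z"
begin

lemma graded_submodule_free: "f \<in> Z \<Longrightarrow> f \<in> free_mod V n"
  using Z unfolding graded_submodule_def by blast

lemma graded_submodule_zero: "0 \<in> Z"
  using Z unfolding graded_submodule_def by blast

lemma graded_submodule_add: "f \<in> Z \<Longrightarrow> g \<in> Z \<Longrightarrow> f + g \<in> Z"
  using Z unfolding graded_submodule_def by blast

lemma graded_submodule_smul: "a \<in> poly_ring V \<Longrightarrow> f \<in> Z \<Longrightarrow> smul a f \<in> Z"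
  using Z unfolding graded_submodule_def by blast

lemma graded_submodule_hom_part: "f \<in> Z \<Longrightarrow> hom_part sh p j f \<in> Z"
proof (cases "p \<le> j")
  case True
  assume "f \<in> Z"
  then have "hom_part sh 0 (j - p) f \<in> Z" using Z unfolding graded_submodule_def by blast
  then show ?thesis using hom_part_shift[of sh p "j - p" f] True by simp
next
  case False
  then show ?thesis by (simp add: hom_part_degree_zero graded_submodule_zero)
qed

lemma graded_submodule_uminus: "f \<in> Z \<Longrightarrow> - f \<in> Z"
proof -
  assume "f \<in> Z"
  then have "smul (- 1) f \<in> Z" by (intro graded_submodule_smul poly_ring_uminus) auto
  moreover have "smul (- 1) f = - f" by (rule ext) simp
  ultimately show ?thesis by simp
qed

lemma graded_submodule_diff: "f \<in> Z \<Longrightarrow> g \<in> Z \<Longrightarrow> f - g \<in> Z"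
  using graded_submodule_add[of f "- g"] graded_submodule_uminus[of g]
  by (simp add: fun_eq_iff fun_diff_def plus_fun_def)

lemma graded_submodule_sum: "(\<And>i. i \<in> I \<Longrightarrow> f i \<in> Z) \<Longrightarrow> (\<Sum>i\<in>I. f i) \<in> Z"
  by (induction I rule: infinite_finite_induct) (auto intro: graded_submodule_add graded_submodule_zero)

end

definition monomial_span :: "(nat \<Rightarrow> ('v \<Rightarrow>\<^sub>0 nat) set) \<Rightarrow> ('v, 'k::comm_ring_1) poly_vec set" where
  "monomial_span B = {f. \<forall>q. supp (f q) \<subseteq> B q}"

lemma graded_submodule_monomial_span:
  assumes "\<And>q. n \<le> q \<Longrightarrow> B q = {}" and "\<And>q m. m \<in> B q \<Longrightarrow> supp m \<subseteq> V"
    and "\<And>q m u. m \<in> B q \<Longrightarrow> supp u \<subseteq> V \<Longrightarrow> u + m \<in> B q"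
  shows "graded_submodule V sh n (monomial_span B :: ('v, 'k::comm_ring_1) poly_vec set)"
  unfolding graded_submodule_def
proof (intro conjI ballI allI)
  show "monomial_span B \<subseteq> (free_mod V n :: ('v, 'k) poly_vec set)"
  proof
    fix f :: "('v, 'k) poly_vec"
    assume f: "f \<in> monomial_span B"
    have "f q = 0" if "q \<ge> n" for q
    proof -
      have "supp (f q) \<subseteq> B q" using f unfolding monomial_span_def by blast
      then show ?thesis unfolding assms(1)[OF that] by (simp only: supp_empty_iff)
    qed
    then show "f \<in> free_mod V n"
      using f assms(2) unfolding monomial_span_def free_mod_def poly_ring_def by blast
  qed
  show "0 \<in> (monomial_span B :: ('v, 'k) poly_vec set)" by (simp add: monomial_span_def)
next
  fix f g :: "('v, 'k) poly_vec" assume "f \<in> monomial_span B" "g \<in> monomial_span B"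
  then show "f + g \<in> monomial_span B"
    by (auto simp: monomial_span_def intro!: order.trans[OF keys_add])
next
  fix a :: "('v, 'k) mpoly" and f :: "('v, 'k) poly_vec"
  assume a: "a \<in> poly_ring V" and f: "f \<in> monomial_span B"
  show "smul a f \<in> monomial_span B" unfolding monomial_span_def mem_Collect_eq
  proof (intro allI subsetI)
    fix q m assume "m \<in> supp (smul a f q)"
    then obtain x y where "m = x + y" and "x \<in> supp a" and "y \<in> supp (f q)"
      using keys_mult[of a "f q"] unfolding smul_apply by blast
    moreover have "supp x \<subseteq> V" using a \<open>x \<in> supp a\<close> by (simp add: poly_ring_def)
    moreover have "y \<in> B q" using f \<open>y \<in> supp (f q)\<close> by (auto simp: monomial_span_def)
    ultimately show "m \<in> B q" using assms(3) by simp
  qed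
next
  fix j and f :: "('v, 'k) poly_vec" assume "f \<in> monomial_span B"
  then show "hom_part sh 0 j f \<in> monomial_span B"
    by (auto simp: monomial_span_def hom_part_def supp_poly_filter)
qed

lemma free_mod_eq_monomial_span:
  "(free_mod V n :: ('v, 'k::comm_ring_1) poly_vec set) = monomial_span (\<lambda>q. if q < n then {m. supp m \<subseteq> V} else {})"
proof (rule set_eqI)
  fix f :: "('v, 'k) poly_vec"
  have "supp (f q) \<subseteq> (if q < n then {m. supp m \<subseteq> V} else {}) \<longleftrightarrow>
      (q < n \<longrightarrow> f q \<in> poly_ring V) \<and> (q \<ge> n \<longrightarrow> f q = 0)" for q
  proof (cases "q < n")
    case True
    then show ?thesis by (auto simp: poly_ring_def)
  next
    case False
    then show ?thesis using supp_empty_iff[of "f q"] by simp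
  qed
  then show "f \<in> free_mod V n \<longleftrightarrow> f \<in> monomial_span (\<lambda>q. if q < n then {m. supp m \<subseteq> V} else {})"
    unfolding free_mod_def monomial_span_def mem_Collect_eq by (simp only: all_conj_distrib)
qed

lemma graded_submodule_free_mod: "graded_submodule V sh n (free_mod V n :: ('v, 'k::comm_ring_1) poly_vec set)"
  unfolding free_mod_eq_monomial_span
  by (rule graded_submodule_monomial_span) (auto simp: supp_add_monom split: if_splits)

section \<open>The Koszul complex\<close>

text \<open>The incidence signs are \<open>(-1) ^ sign_exp s T\<close>. Keeping the exponent rather than the sign lets the same
  data act on polynomials and on their coefficients. The parity condition is the exchange rule of a sign
  system.\<close>

locale koszul =
  fixes V :: "'v set" and sign_exp :: "'v \<Rightarrow> 'v set \<Rightarrow> nat"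
  assumes finV: "finite V"
    and sign_exp: "\<And>s t T. s \<in> V \<Longrightarrow> t \<in> V \<Longrightarrow> s \<noteq> t \<Longrightarrow> s \<notin> T \<Longrightarrow> t \<notin> T \<Longrightarrow>
      odd (sign_exp s T + sign_exp t (insert s T) + sign_exp t T + sign_exp s (insert t T))"
begin

lemma finite_V: "S \<subseteq> V \<Longrightarrow> finite S"
  using finV finite_subset by blast

definition ksign :: "'v \<Rightarrow> 'v set \<Rightarrow> 'r::comm_ring_1" where
  "ksign s T = (- 1) ^ sign_exp s T"

lemma ksign_square: "ksign s T * ksign s T = (1 :: 'r::comm_ring_1)"
  by (simp add: ksign_def power_add[symmetric] mult_2[symmetric])

lemma ksign_square_left: "ksign s T * (ksign s T * x) = (x :: 'r::comm_ring_1)"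
  by (simp add: mult.assoc[symmetric] ksign_square)

lemma ksign_swap:
  assumes "s \<in> V" "t \<in> V" "s \<noteq> t" "s \<notin> T" "t \<notin> T"
  shows "ksign s T * ksign t (insert s T) = - (ksign t T * ksign s (insert t T) :: 'r::comm_ring_1)"
proof -
  have "odd ((sign_exp s T + sign_exp t (insert s T)) + (sign_exp t T + sign_exp s (insert t T)))"
    using sign_exp[OF assms] by (simp add: add.assoc)
  then show ?thesis
    unfolding ksign_def power_add[symmetric] by (auto simp: minus_one_power_iff)
qed

text \<open>The exchange rule multiplied by two of its four factors.\<close>

lemma ksign_cross:
  assumes "s \<in> V" "t \<in> V" "s \<noteq> t" "s \<notin> T" "t \<notin> T"
  shows "ksign s (insert t T) * ksign t (insert s T) = - (ksign s T * ksign t T :: 'r::comm_ring_1)"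
proof -
  have "odd ((sign_exp s (insert t T) + sign_exp t (insert s T)) + (sign_exp s T + sign_exp t T))"
    using sign_exp[OF assms] by (simp add: ac_simps)
  then show ?thesis
    unfolding ksign_def power_add[symmetric] by (auto simp: minus_one_power_iff)
qed

lemma coeff_ksign_mult:
  fixes p :: "('v, 'k::comm_ring_1) mpoly"
  shows "coeff (ksign s T * p) m = ksign s T * coeff p m"
  by (simp add: ksign_def coeff_sign_mult)

lemma ksign_poly_ring: "(ksign s T :: ('v, 'k::comm_ring_1) mpoly) \<in> poly_ring V"
  by (simp add: ksign_def poly_ring_sign)

text \<open>An element of the Koszul complex with coefficients in \<open>Z\<close> is a family of elements of \<open>Z\<close> indexed by
  the subsets of \<open>V\<close>; the set \<open>S\<close> stands for the exterior product of the basis elements in \<open>S\<close>.\<close>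

definition koszul_diff :: "('v set \<Rightarrow> ('v, 'k::comm_ring_1) poly_vec) \<Rightarrow> 'v set \<Rightarrow> ('v, 'k) poly_vec" where
  "koszul_diff c T = (\<Sum>s\<in>V - T. smul (ksign s T * var s) (c (insert s T)))"

lemma koszul_diff_apply: "koszul_diff c T q = (\<Sum>s\<in>V - T. ksign s T * var s * c (insert s T) q)"
  by (simp add: koszul_diff_def sum_fun_apply)

lemma koszul_diff_diff: "koszul_diff (c - d) = koszul_diff c - koszul_diff d"
  by (rule ext, rule ext) (simp add: koszul_diff_apply sum_subtractf right_diff_distrib)

lemma koszul_diff_zero: "koszul_diff 0 = 0"
  by (rule ext, rule ext) (simp add: koszul_diff_apply)

lemma koszul_diff_koszul_diff: "koszul_diff (koszul_diff c) = (0 :: 'v set \<Rightarrow> ('v, 'k::comm_ring_1) poly_vec)"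
proof (rule ext, rule ext)
  fix T q
  define g :: "'v \<Rightarrow> 'v \<Rightarrow> ('v, 'k) mpoly" where
    "g s t = (ksign s T * ksign t (insert s T)) * (var s * var t * c (insert t (insert s T)) q)" for s t
  have "V - insert s T = V - T - {s}" for s by auto
  then have "koszul_diff (koszul_diff c) T q = (\<Sum>s\<in>V - T. \<Sum>t\<in>V - T - {s}. g s t)"
    by (simp add: koszul_diff_apply g_def sum_distrib_left ac_simps)
  also have "\<dots> = 0"
  proof (rule antisym_sum_zero)
    show "finite (V - T)" using finV by simp
    fix t s assume st: "t \<in> V - T" "s \<in> V - T" "t \<noteq> s"
    have "g t s = - (g s t)"
      unfolding g_def using ksign_swap[of t s T, where 'r = "('v, 'k) mpoly"] st
      by (simp add: insert_commute mult.commute)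
    then show "g t s + g s t = 0" by simp
  qed
  finally show "koszul_diff (koszul_diff c) T q = 0 T q" by simp
qed

text \<open>The elements at index \<open>p\<close> of total degree \<open>j\<close>, where a set of size \<open>p\<close> contributes \<open>p\<close> to the degree.\<close>

definition chain ::
  "(nat \<Rightarrow> nat) \<Rightarrow> ('v, 'k::comm_ring_1) poly_vec set \<Rightarrow> nat \<Rightarrow> nat \<Rightarrow> ('v set \<Rightarrow> ('v, 'k) poly_vec) \<Rightarrow> bool" where
  "chain sh Z p j c \<longleftrightarrow> (\<forall>S. if S \<subseteq> V \<and> card S = p then c S \<in> Z \<and> homogeneous sh p j (c S) else c S = 0)"

text \<open>The Koszul homology of \<open>Z\<close> at index \<open>p\<close> vanishes in degree \<open>j\<close>. At \<open>p = 0\<close> every chain is a cycle,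
  and the condition says that all elements of \<open>Z\<close> of degree \<open>j\<close> lie in the product of the irrelevant
  ideal with \<open>Z\<close>.\<close>

definition exact_at :: "(nat \<Rightarrow> nat) \<Rightarrow> ('v, 'k::comm_ring_1) poly_vec set \<Rightarrow> nat \<Rightarrow> nat \<Rightarrow> bool" where
  "exact_at sh Z p j \<longleftrightarrow>
     (\<forall>c. chain sh Z p j c \<longrightarrow> koszul_diff c = 0 \<longrightarrow> (\<exists>d. chain sh Z (Suc p) j d \<and> koszul_diff d = c))"

lemma chain_in: "chain sh Z p j c \<Longrightarrow> S \<subseteq> V \<Longrightarrow> card S = p \<Longrightarrow> c S \<in> Z"
  and chain_homogeneous: "chain sh Z p j c \<Longrightarrow> S \<subseteq> V \<Longrightarrow> card S = p \<Longrightarrow> homogeneous sh p j (c S)"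
  and chain_outside: "chain sh Z p j c \<Longrightarrow> \<not> (S \<subseteq> V \<and> card S = p) \<Longrightarrow> c S = 0"
  unfolding chain_def by metis+

lemma chainI:
  assumes "\<And>S. S \<subseteq> V \<Longrightarrow> card S = p \<Longrightarrow> c S \<in> Z"
    and "\<And>S. S \<subseteq> V \<Longrightarrow> card S = p \<Longrightarrow> homogeneous sh p j (c S)"
    and "\<And>S. \<not> (S \<subseteq> V \<and> card S = p) \<Longrightarrow> c S = 0"
  shows "chain sh Z p j c"
  unfolding chain_def using assms by simp

lemma chain_mono: "chain sh Z p j c \<Longrightarrow> Z \<subseteq> Z' \<Longrightarrow> chain sh Z' p j c"
  unfolding chain_def by (meson subsetD)

lemma chain_diff:
  assumes Z: "graded_submodule V sh n Z" and c: "chain sh Z p j c" and d: "chain sh Z p j d"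
  shows "chain sh Z p j (c - d)"
proof (rule chainI)
  fix S assume S: "S \<subseteq> V" "card S = p"
  show "(c - d) S \<in> Z"
    using graded_submodule_diff[OF Z chain_in[OF c S] chain_in[OF d S]] by simp
  have "homogeneous sh p j (- d S)"
    using chain_homogeneous[OF d S] by (simp add: homogeneous_def in_keys_iff)
  then show "homogeneous sh p j ((c - d) S)"
    using homogeneous_add[OF chain_homogeneous[OF c S]] by (metis minus_apply ab_group_add_class.ab_diff_conv_add_uminus)
next
  fix S assume "\<not> (S \<subseteq> V \<and> card S = p)"
  then show "(c - d) S = 0" using chain_outside[OF c] chain_outside[OF d] by simp
qed

lemma chain_koszul_diff:
  assumes Z: "graded_submodule V sh n Z" and c: "chain sh Z (Suc p) j c"
  shows "chain sh Z p j (koszul_diff c)"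
proof (rule chainI)
  fix T assume T: "T \<subseteq> V" "card T = p"
  have fT: "finite T" using T finV finite_subset by blast
  have S: "insert s T \<subseteq> V" "card (insert s T) = Suc p" if "s \<in> V - T" for s
    using that T fT by auto
  show "koszul_diff c T \<in> Z" unfolding koszul_diff_def
    by (intro graded_submodule_sum[OF Z] graded_submodule_smul[OF Z] poly_ring_mult ksign_poly_ring
        poly_ring_var chain_in[OF c] S) auto
  have "homogeneous sh p j (smul (ksign s T * var s) (c (insert s T)))" if s: "s \<in> V - T" for s
    unfolding homogeneous_def
  proof (intro allI ballI)
    fix q m assume "m \<in> supp (smul (ksign s T * var s) (c (insert s T)) q)"
    then have "coeff (ksign s T * (var s * c (insert s T) q)) m \<noteq> 0"
      by (simp add: in_keys_iff mult.assoc)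
    then have "coeff (var s * c (insert s T) q) m \<noteq> 0" unfolding coeff_ksign_mult by auto
    then have m: "s \<in> supp m" "m - sing s 1 \<in> supp (c (insert s T) q)"
      by (auto simp: coeff_var_mult in_keys_iff split: if_splits)
    then have "monom_deg (m - sing s 1) + sh q + Suc p = j"
      using chain_homogeneous[OF c S[OF s]] unfolding homogeneous_def by blast
    moreover have "monom_deg m = 1 + monom_deg (m - sing s 1)"
      using split_var[OF m(1)] monom_deg_add[of "sing s 1" "m - sing s 1"] by simp
    ultimately show "monom_deg m + sh q + p = j" by simp
  qed
  then show "homogeneous sh p j (koszul_diff c T)" unfolding koszul_diff_def by (rule homogeneous_sum)
next
  fix T assume T: "\<not> (T \<subseteq> V \<and> card T = p)"
  have "c (insert s T) = 0" if s: "s \<in> V - T" for s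
  proof (rule chain_outside[OF c], rule notI)
    assume a: "insert s T \<subseteq> V \<and> card (insert s T) = Suc p"
    then have "finite T" by (metis card.infinite finite_insert nat.distinct(1))
    then show False using a T s by simp
  qed
  then show "koszul_diff c T = 0" by (intro ext) (simp add: koszul_diff_apply)
qed

text \<open>The part of the Koszul complex in a single multidegree has one-dimensional components: it is the
  simplicial chain complex of a family of subsets of \<open>V\<close>, with \<open>p\<close>-element sets in position \<open>p\<close> and the
  empty set included.\<close>

definition strand_diff :: "('v set \<Rightarrow> 'k::comm_ring_1) \<Rightarrow> 'v set \<Rightarrow> 'k" where
  "strand_diff f T = (\<Sum>s\<in>V - T. ksign s T * f (insert s T))"

definition comb_chain :: "'v set set \<Rightarrow> nat \<Rightarrow> ('v set \<Rightarrow> 'k::comm_ring_1) \<Rightarrow> bool" where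
  "comb_chain \<F> p f \<longleftrightarrow> (\<forall>S. f S \<noteq> 0 \<longrightarrow> S \<in> \<F> \<and> card S = p)"

text \<open>The first argument only fixes the field of coefficients.\<close>

definition comb_exact :: "'k::comm_ring_1 itself \<Rightarrow> 'v set set \<Rightarrow> nat \<Rightarrow> bool" where
  "comb_exact (k :: 'k itself) \<F> p \<longleftrightarrow> (\<forall>f :: 'v set \<Rightarrow> 'k. comb_chain \<F> p f \<longrightarrow> (\<forall>T\<subseteq>V. strand_diff f T = 0) \<longrightarrow>
     (\<exists>g. comb_chain \<F> (Suc p) g \<and> (\<forall>T\<subseteq>V. strand_diff g T = f T)))"

text \<open>Joining the apex \<open>v\<close> is a contracting homotopy.\<close>

lemma comb_exact_cone:
  assumes v: "v \<in> V" and sub: "\<F> \<subseteq> Pow V" and cone: "\<And>S. S \<in> \<F> \<Longrightarrow> insert v S \<in> \<F>"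
  shows "comb_exact TYPE('k::comm_ring_1) \<F> p"
  unfolding comb_exact_def
proof (intro allI impI)
  fix f :: "'v set \<Rightarrow> 'k"
  assume f: "comb_chain \<F> p f" and cyc: "\<forall>T\<subseteq>V. strand_diff f T = 0"
  define g where "g S = (if v \<in> S then ksign v (S - {v}) * f (S - {v}) else 0)" for S
  have "comb_chain \<F> (Suc p) g" unfolding comb_chain_def
  proof (intro allI impI)
    fix S assume "g S \<noteq> 0"
    then have S: "v \<in> S" "f (S - {v}) \<noteq> 0" by (auto simp: g_def split: if_splits)
    then have F: "S - {v} \<in> \<F>" "card (S - {v}) = p" using f unfolding comb_chain_def by blast+
    then have "finite (S - {v})" using sub finV finite_subset by blast
    then have "card (insert v (S - {v})) = Suc p" using F(2) by (subst card_insert_disjoint) simp_all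
    moreover have "insert v (S - {v}) \<in> \<F>" using cone[OF F(1)] .
    moreover have "insert v (S - {v}) = S" using S(1) by (rule insert_Diff)
    ultimately show "S \<in> \<F> \<and> card S = Suc p" by simp
  qed
  moreover have "strand_diff g T = f T" if T: "T \<subseteq> V" for T
  proof (cases "v \<in> T")
    case False
    have "strand_diff g T = (\<Sum>s\<in>{v}. ksign s T * g (insert s T))"
      unfolding strand_diff_def using finV v False
      by (intro sum.mono_neutral_right) (auto simp: g_def)
    also have "\<dots> = f T" using False by (simp add: g_def ksign_square_left)
    finally show ?thesis .
  next
    case True
    define U where "U = T - {v}"
    have U: "T = insert v U" "v \<notin> U" "U \<subseteq> V" using True T by (auto simp: U_def)
    have VU: "V - U = insert v (V - T)" "v \<notin> V - T" using U v by auto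
    have "strand_diff g T = (\<Sum>s\<in>V - T. - (ksign v U * (ksign s U * f (insert s U))))"
      unfolding strand_diff_def
    proof (rule sum.cong[OF refl])
      fix s assume s: "s \<in> V - T"
      then have "insert s T - {v} = insert s U" "v \<in> insert s T" using U by auto
      then have "ksign s T * g (insert s T) = (ksign s (insert v U) * ksign v (insert s U)) * f (insert s U)"
        by (simp add: g_def U(1) mult.assoc)
      also have "\<dots> = - (ksign s U * ksign v U) * f (insert s U)"
        using s U v by (subst ksign_cross) auto
      finally show "ksign s T * g (insert s T) = - (ksign v U * (ksign s U * f (insert s U)))"
        by (simp add: ac_simps)
    qed
    also have "\<dots> = - (ksign v U * (\<Sum>s\<in>V - T. ksign s U * f (insert s U)))"
      by (simp add: sum_negf sum_distrib_left)
    also have "(\<Sum>s\<in>V - T. ksign s U * f (insert s U)) = - (ksign v U * f T)"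
    proof -
      have "0 = strand_diff f U" using cyc U by simp
      also have "\<dots> = ksign v U * f T + (\<Sum>s\<in>V - T. ksign s U * f (insert s U))"
        unfolding strand_diff_def VU(1) using VU(2) finV U(1) by simp
      finally show ?thesis by (simp add: eq_neg_iff_add_eq_0 add.commute)
    qed
    finally show ?thesis by (simp add: ksign_square_left)
  qed
  ultimately show "\<exists>g. comb_chain \<F> (Suc p) g \<and> (\<forall>T\<subseteq>V. strand_diff g T = f T)" by blast
qed

text \<open>The coefficient at the set \<open>S\<close> of the component in multidegree \<open>m\<close>: the set \<open>S\<close> itself accounts for
  the squarefree monomial of \<open>S\<close>, and the rest of \<open>m\<close> comes from the coefficient of \<open>S\<close>.\<close>

definition strand ::
  "('v set \<Rightarrow> ('v, 'k::comm_ring_1) poly_vec) \<Rightarrow> nat \<Rightarrow> ('v \<Rightarrow>\<^sub>0 nat) \<Rightarrow> 'v set \<Rightarrow> 'k" where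
  "strand c q m S = (if S \<subseteq> supp m then coeff (c S q) (m - sqfree_monom S) else 0)"

lemma strand_add_sqfree: "finite S \<Longrightarrow> strand c q (m + sqfree_monom S) S = coeff (c S q) m"
  by (simp add: strand_def supp_add_monom supp_sqfree_monom)

lemma strand_koszul_diff:
  assumes "finite T"
  shows "strand (koszul_diff c) q m T = strand_diff (strand c q m) T"
proof (cases "T \<subseteq> supp m")
  case False
  then show ?thesis by (simp add: strand_def strand_diff_def)
next
  case True
  have "coeff (ksign s T * (var s * c (insert s T) q)) (m - sqfree_monom T) =
      ksign s T * strand c q m (insert s T)" if s: "s \<in> V - T" for s
  proof -
    have "s \<in> supp (m - sqfree_monom T) \<longleftrightarrow> s \<in> supp m"
      using s assms by (simp add: in_keys_iff lookup_minus coeff_sqfree_monom)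
    moreover have "m - sqfree_monom T - sing s 1 = m - sqfree_monom (insert s T)"
      using s assms by (simp add: sqfree_monom_insert diff_diff_add)
    ultimately show ?thesis
      unfolding coeff_ksign_mult coeff_var_mult using True by (simp add: strand_def)
  qed
  then show ?thesis using True
    by (simp add: strand_def[of "koszul_diff c"] strand_diff_def koszul_diff_apply lookup_sum mult.assoc)
qed

definition monomial_strand :: "(nat \<Rightarrow> ('v \<Rightarrow>\<^sub>0 nat) set) \<Rightarrow> nat \<Rightarrow> ('v \<Rightarrow>\<^sub>0 nat) \<Rightarrow> 'v set set" where
  "monomial_strand B q m = {S. S \<subseteq> supp m \<and> m - sqfree_monom S \<in> B q}"

lemma comb_chain_strand:
  assumes "chain sh (monomial_span B) p j c"
  shows "comb_chain (monomial_strand B q m) p (strand c q m)"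
  unfolding comb_chain_def
proof (intro allI impI)
  fix S assume "strand c q m S \<noteq> 0"
  then have S: "S \<subseteq> supp m" "coeff (c S q) (m - sqfree_monom S) \<noteq> 0"
    by (auto simp: strand_def split: if_splits)
  then have "c S \<noteq> 0" by auto
  then have Sp: "S \<subseteq> V" "card S = p" using chain_outside[OF assms] by blast+
  then have "c S \<in> monomial_span B" using chain_in[OF assms] by blast
  then have "m - sqfree_monom S \<in> B q" using S(2)
    unfolding in_keys_iff[symmetric] monomial_span_def by blast
  then show "S \<in> monomial_strand B q m \<and> card S = p" using S Sp by (simp add: monomial_strand_def)
qed

lemma chain_eq_if_strands_eq:
  assumes "chain sh Z p j c" "chain sh' Z' p j' d"
    and "\<And>q m S. S \<subseteq> V \<Longrightarrow> card S = p \<Longrightarrow> strand c q m S = strand d q m S"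
  shows "c = d"
proof (rule ext)
  fix S
  show "c S = d S"
  proof (cases "S \<subseteq> V \<and> card S = p")
    case True
    then have fS: "finite S" using finV finite_subset by blast
    have "coeff (c S q) m = coeff (d S q) m" for q m
      using assms(3)[of S q "m + sqfree_monom S"] True
      by (simp add: strand_add_sqfree[OF fS])
    then show ?thesis by (intro ext poly_mapping_eqI)
  next
    case False
    then show ?thesis using chain_outside[OF assms(1)] chain_outside[OF assms(2)] by simp
  qed
qed

text \<open>Chains of the strands are assembled to a chain of the Koszul complex. Fixing the total degree \<open>j\<close> leaves
  finitely many multidegrees, so the assembled coefficients are polynomials.\<close>

lemma boundary_if_strands_boundaries:
  fixes c :: "'v set \<Rightarrow> ('v, 'k::comm_ring_1) poly_vec"
  assumes Z: "graded_submodule V sh n (monomial_span B :: ('v, 'k) poly_vec set)"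
    and BV: "\<And>q m. m \<in> B q \<Longrightarrow> supp m \<subseteq> V"
    and c: "chain sh (monomial_span B) p j c"
    and bd: "\<And>q m. supp m \<subseteq> V \<Longrightarrow> monom_deg m + sh q = j \<Longrightarrow>
      \<exists>g. comb_chain (monomial_strand B q m) (Suc p) g \<and> (\<forall>T\<subseteq>V. strand_diff g T = strand c q m T)"
  shows "\<exists>d. chain sh (monomial_span B) (Suc p) j d \<and> koszul_diff d = c"
proof -
  define M where "M q = {m. supp m \<subseteq> V \<and> monom_deg m + sh q = j}" for q
  have finM: "finite (M q)" for q
    by (rule finite_subset[OF _ finite_monoms_of_degree[OF finV, of j]]) (auto simp: M_def)
  define D where "D q m = (SOME g. comb_chain (monomial_strand B q m) (Suc p) g \<and>
    (\<forall>T\<subseteq>V. strand_diff g T = strand c q m T))" for q m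
  have D: "comb_chain (monomial_strand B q m) (Suc p) (D q m)"
    "\<And>T. T \<subseteq> V \<Longrightarrow> strand_diff (D q m) T = strand c q m T" if "m \<in> M q" for q m
    using someI_ex[OF bd[of m q]] that unfolding D_def M_def by blast+
  define d :: "'v set \<Rightarrow> ('v, 'k) poly_vec" where
    "d S q = (if S \<subseteq> V \<and> card S = Suc p
      then \<Sum>m\<in>{m \<in> M q. S \<subseteq> supp m}. sing (m - sqfree_monom S) (D q m S) else 0)" for S q
  have strand_d: "strand d q m S = (if m \<in> M q then D q m S else 0)" if S: "S \<subseteq> V" "card S = Suc p" for q m S
  proof (cases "S \<subseteq> supp m")
    case False
    then show ?thesis using D(1)[of m q] by (auto simp: strand_def comb_chain_def monomial_strand_def)
  next
    case True
    have fS: "finite S" using S finV finite_subset by blast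
    have eq: "m' - sqfree_monom S = m - sqfree_monom S \<longleftrightarrow> m' = m" if "S \<subseteq> supp m'" for m'
      using split_sqfree_monom[OF fS that] split_sqfree_monom[OF fS True] by metis
    have "strand d q m S = (\<Sum>m'\<in>{m' \<in> M q. S \<subseteq> supp m'}. if m' = m then D q m' S else 0)"
      using True S eq by (auto simp: strand_def d_def lookup_sum lookup_single when_def intro!: sum.cong)
    also have "\<dots> = (if m \<in> M q then D q m S else 0)" using True finM by simp
    finally show ?thesis .
  qed
  have in_supp: "\<exists>m\<in>M q. S \<subseteq> supp m \<and> m' = m - sqfree_monom S \<and> D q m S \<noteq> 0"
    if "m' \<in> supp (d S q)" "S \<subseteq> V" "card S = Suc p" for m' S q
  proof (rule ccontr)
    assume "\<not> ?thesis"
    then have "coeff (d S q) m' = 0"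
      using that by (auto simp: d_def lookup_sum lookup_single when_def intro!: sum.neutral)
    then show False using that by (simp add: in_keys_iff)
  qed
  have d: "chain sh (monomial_span B) (Suc p) j d"
  proof (rule chainI)
    fix S assume S: "S \<subseteq> V" "card S = Suc p"
    have fS: "finite S" using S finV finite_subset by blast
    show "d S \<in> monomial_span B" unfolding monomial_span_def mem_Collect_eq
    proof (intro allI subsetI)
      fix q m' assume "m' \<in> supp (d S q)"
      then obtain m where "m \<in> M q" "m' = m - sqfree_monom S" "D q m S \<noteq> 0" using in_supp S by blast
      then show "m' \<in> B q" using D(1)[of m q] by (auto simp: comb_chain_def monomial_strand_def)
    qed
    show "homogeneous sh (Suc p) j (d S)" unfolding homogeneous_def
    proof (intro allI ballI)
      fix q m' assume "m' \<in> supp (d S q)"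
      then obtain m where m: "m \<in> M q" "S \<subseteq> supp m" "m' = m - sqfree_monom S" using in_supp S by blast
      then have "monom_deg m = monom_deg m' + Suc p"
        using split_sqfree_monom[OF fS m(2)] monom_deg_add[of m' "sqfree_monom S"]
          monom_deg_sqfree_monom[OF fS] S by simp
      then show "monom_deg m' + sh q + Suc p = j" using m by (simp add: M_def)
    qed
  next
    fix S assume "\<not> (S \<subseteq> V \<and> card S = Suc p)"
    then show "d S = 0" by (auto simp: d_def fun_eq_iff)
  qed
  have "koszul_diff d = c"
  proof (rule chain_eq_if_strands_eq[OF chain_koszul_diff[OF Z d] c])
    fix q m T assume T: "T \<subseteq> V" "card T = p"
    have fT: "finite T" using T finV finite_subset by blast
    have "strand (koszul_diff d) q m T = (\<Sum>s\<in>V - T. ksign s T * (if m \<in> M q then D q m (insert s T) else 0))"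
      unfolding strand_koszul_diff[OF fT] strand_diff_def using T fT by (intro sum.cong refl) (simp add: strand_d)
    also have "\<dots> = (if m \<in> M q then strand_diff (D q m) T else 0)" by (simp add: strand_diff_def)
    also have "\<dots> = strand c q m T"
    proof (cases "m \<in> M q")
      case True then show ?thesis using D(2) T by simp
    next
      case False
      have "strand c q m T = 0"
      proof (rule ccontr)
        assume "strand c q m T \<noteq> 0"
        then have *: "T \<subseteq> supp m" "m - sqfree_monom T \<in> supp (c T q)"
          by (auto simp: strand_def in_keys_iff split: if_splits)
        then have "supp (m - sqfree_monom T) \<subseteq> V"
          using chain_in[OF c T] BV unfolding monomial_span_def by blast
        then have "supp m \<subseteq> V"
          using split_sqfree_monom[OF fT *(1)] supp_add_monom[of "m - sqfree_monom T" "sqfree_monom T"]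
            supp_sqfree_monom[OF fT] T by simp
        moreover have "monom_deg (m - sqfree_monom T) + sh q + p = j"
          using chain_homogeneous[OF c T] * unfolding homogeneous_def by blast
        then have "monom_deg m + sh q = j"
          using split_sqfree_monom[OF fT *(1)] monom_deg_add[of "m - sqfree_monom T" "sqfree_monom T"]
            monom_deg_sqfree_monom[OF fT] T by simp
        ultimately show False using False by (simp add: M_def)
      qed
      then show ?thesis using False by simp
    qed
    finally show "strand (koszul_diff d) q m T = strand c q m T" .
  qed
  then show ?thesis using d by blast
qed

lemma strand_diff_strand_cycle:
  assumes "koszul_diff c = 0" "T \<subseteq> V"
  shows "strand_diff (strand c q m) T = 0"
proof -
  have "strand_diff (strand c q m) T = strand (koszul_diff c) q m T"
    using strand_koszul_diff[of T c q m] finite_subset[OF assms(2) finV] by simp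
  also have "\<dots> = 0" unfolding assms(1) strand_def by (cases "T \<subseteq> supp m") simp_all
  finally show ?thesis .
qed

text \<open>The Koszul complex of a module spanned by monomials is the direct sum of its strands.\<close>

theorem exact_at_monomial_span:
  assumes Z: "graded_submodule V sh n (monomial_span B :: ('v, 'k::comm_ring_1) poly_vec set)"
    and BV: "\<And>q m. m \<in> B q \<Longrightarrow> supp m \<subseteq> V"
  shows "exact_at sh (monomial_span B :: ('v, 'k) poly_vec set) p j \<longleftrightarrow>
    (\<forall>q m. supp m \<subseteq> V \<longrightarrow> monom_deg m + sh q = j \<longrightarrow> comb_exact TYPE('k) (monomial_strand B q m) p)"
    (is "?L \<longleftrightarrow> ?R")
proof
  assume R: ?R
  show ?L unfolding exact_at_def
  proof (intro allI impI)
    fix c :: "'v set \<Rightarrow> ('v, 'k) poly_vec"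
    assume c: "chain sh (monomial_span B) p j c" "koszul_diff c = 0"
    show "\<exists>d. chain sh (monomial_span B) (Suc p) j d \<and> koszul_diff d = c"
    proof (rule boundary_if_strands_boundaries[OF Z BV c(1)])
      fix q m assume m: "supp m \<subseteq> V" "monom_deg m + sh q = j"
      then have "comb_exact TYPE('k) (monomial_strand B q m) p" using R by blast
      then show "\<exists>g. comb_chain (monomial_strand B q m) (Suc p) g \<and> (\<forall>T\<subseteq>V. strand_diff g T = strand c q m T)"
        using comb_chain_strand[OF c(1), of q m] strand_diff_strand_cycle[OF c(2), of _ q m]
        unfolding comb_exact_def by simp
    qed simp_all
  qed
next
  assume L: ?L
  show ?R
  proof (intro allI impI)
    fix q m assume m: "supp m \<subseteq> V" "monom_deg m + sh q = j"
    show "comb_exact TYPE('k) (monomial_strand B q m) p" unfolding comb_exact_def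
    proof (intro allI impI)
      fix f :: "'v set \<Rightarrow> 'k"
      assume f: "comb_chain (monomial_strand B q m) p f" and cyc: "\<forall>T\<subseteq>V. strand_diff f T = 0"
      have f0: "S \<subseteq> supp m" "m - sqfree_monom S \<in> B q" "S \<subseteq> V" "card S = p" "finite S" if "f S \<noteq> 0" for S
      proof -
        show "S \<subseteq> supp m" "m - sqfree_monom S \<in> B q" "card S = p"
          using f that unfolding comb_chain_def monomial_strand_def by blast+
        then show "S \<subseteq> V" using m by blast
        then show "finite S" using finV finite_subset by blast
      qed
      define c :: "'v set \<Rightarrow> ('v, 'k) poly_vec" where
        "c S q' = (if q' = q then sing (m - sqfree_monom S) (f S) else 0)" for S q'
      have c: "chain sh (monomial_span B) p j c"
      proof (rule chainI)
        fix S assume S: "S \<subseteq> V" "card S = p"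
        show "c S \<in> monomial_span B" using f0(2)[of S] by (auto simp: monomial_span_def c_def)
        show "homogeneous sh p j (c S)" unfolding homogeneous_def
        proof (intro allI ballI)
          fix q' m' assume m': "m' \<in> supp (c S q')"
          then have *: "q' = q" "f S \<noteq> 0" "m' = m - sqfree_monom S" by (auto simp: c_def split: if_splits)
          have "monom_deg m = monom_deg m' + p"
            using split_sqfree_monom[OF f0(5,1)[OF *(2)]] monom_deg_add[of m' "sqfree_monom S"]
              monom_deg_sqfree_monom[OF f0(5)[OF *(2)]] S * by simp
          then show "monom_deg m' + sh q' + p = j" using m * by simp
        qed
      next
        fix S assume "\<not> (S \<subseteq> V \<and> card S = p)"
        then have "f S = 0" using f0 by blast
        then show "c S = 0" by (simp add: c_def fun_eq_iff)
      qed
      have strand_c: "strand c q' m' S = (if q' = q \<and> m' = m then f S else 0)" if S: "S \<subseteq> V" for q' m' S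
      proof (cases "f S = 0")
        case True then show ?thesis by (simp add: strand_def c_def)
      next
        case False
        note S = f0[OF False]
        have "m - sqfree_monom S = m' - sqfree_monom S \<longleftrightarrow> m' = m" if "S \<subseteq> supp m'"
          using split_sqfree_monom[OF S(5) that] split_sqfree_monom[OF S(5) S(1)] by metis
        then show ?thesis using S(1) by (auto simp: strand_def c_def lookup_single when_def)
      qed
      have strand_diff_c: "strand_diff (strand c q' m') T = (if q' = q \<and> m' = m then strand_diff f T else 0)" if T: "T \<subseteq> V" for q' m' T
      proof -
        have "strand_diff (strand c q' m') T = (\<Sum>s\<in>V - T. ksign s T * (if q' = q \<and> m' = m then f (insert s T) else 0))"
          unfolding strand_diff_def using T by (intro sum.cong refl) (simp add: strand_c)
        then show ?thesis by (cases "q' = q \<and> m' = m") (auto simp: strand_diff_def)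
      qed
      have "koszul_diff c = 0"
      proof (rule ext, rule ext, rule poly_mapping_eqI)
        fix T q' m'
        show "coeff (koszul_diff c T q') m' = coeff ((0 :: 'v set \<Rightarrow> ('v, 'k) poly_vec) T q') m'"
        proof (cases "T \<subseteq> V")
          case True
          then have fT: "finite T" using finV finite_subset by blast
          have "coeff (koszul_diff c T q') m' = strand_diff (strand c q' (m' + sqfree_monom T)) T"
            by (simp only: strand_koszul_diff[OF fT, symmetric] strand_add_sqfree[OF fT])
          then show ?thesis using cyc True by (simp add: strand_diff_c)
        next
          case False
          then have "c (insert s T) = 0" for s using chain_outside[OF c] by blast
          then show ?thesis by (simp add: koszul_diff_apply)
        qed
      qed
      then obtain d where d: "chain sh (monomial_span B) (Suc p) j d" "koszul_diff d = c"
        using L c unfolding exact_at_def by blast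
      have "strand_diff (strand d q m) T = f T" if T: "T \<subseteq> V" for T
        using strand_koszul_diff[of T d q m] finite_subset[OF T finV] strand_c[OF T, of q m] d(2) by simp
      then show "\<exists>g. comb_chain (monomial_strand B q m) (Suc p) g \<and> (\<forall>T\<subseteq>V. strand_diff g T = f T)"
        using comb_chain_strand[OF d(1), of q m] by blast
    qed
  qed
qed

end

section \<open>Graded maps between free modules and their kernels\<close>

definition mat_map ::
  "nat \<Rightarrow> nat \<Rightarrow> (nat \<Rightarrow> nat \<Rightarrow> ('v, 'k::comm_ring_1) mpoly) \<Rightarrow> ('v, 'k) poly_vec \<Rightarrow> ('v, 'k) poly_vec" where
  "mat_map n r A f = (\<lambda>p. if p < n then \<Sum>q<r. f q * A p q else 0)"

lemma mat_map_zero: "mat_map n r A 0 = 0"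
  by (rule ext) (simp add: mat_map_def)

lemma mat_map_add: "mat_map n r A (f + g) = mat_map n r A f + mat_map n r A g"
  by (rule ext) (simp add: mat_map_def distrib_right sum.distrib)

lemma mat_map_diff: "mat_map n r A (f - g) = mat_map n r A f - mat_map n r A g"
  by (rule ext) (simp add: mat_map_def left_diff_distrib sum_subtractf)

lemma mat_map_smul: "mat_map n r A (smul a f) = smul a (mat_map n r A f)"
  by (rule ext) (simp add: mat_map_def sum_distrib_left mult.assoc)

lemma mat_map_sum: "mat_map n r A (\<Sum>i\<in>I. f i) = (\<Sum>i\<in>I. mat_map n r A (f i))"
proof (rule ext)
  fix p
  have "(\<Sum>q<r. (\<Sum>i\<in>I. f i q) * A p q) = (\<Sum>i\<in>I. \<Sum>q<r. f i q * A p q)"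
    unfolding sum_distrib_right by (rule sum.swap)
  then show "mat_map n r A (\<Sum>i\<in>I. f i) p = (\<Sum>i\<in>I. mat_map n r A (f i)) p"
    by (simp add: mat_map_def sum_fun_apply)
qed

definition graded_matrix ::
  "'v set \<Rightarrow> (nat \<Rightarrow> nat) \<Rightarrow> nat \<Rightarrow> (nat \<Rightarrow> nat) \<Rightarrow> nat \<Rightarrow> (nat \<Rightarrow> nat \<Rightarrow> ('v, 'k::comm_ring_1) mpoly) \<Rightarrow> bool"
  where
  "graded_matrix V sh n e r A \<longleftrightarrow> (\<forall>p<n. \<forall>q<r. A p q \<in> poly_ring V \<and>
     (\<forall>m\<in>supp (A p q). monom_deg m + sh p = e q))"

text \<open>Multiplication by a homogeneous polynomial commutes with taking homogeneous parts, up to a shift.\<close>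

lemma poly_filter_degree_mult:
  fixes a b :: "('v, 'k::comm_ring_1) mpoly"
  assumes "\<And>m. m \<in> supp b \<Longrightarrow> monom_deg m + s = e"
  shows "poly_filter (\<lambda>m. monom_deg m + s = j) (a * b) = poly_filter (\<lambda>m. monom_deg m + e = j) a * b"
proof -
  let ?P = "\<lambda>m :: 'v \<Rightarrow>\<^sub>0 nat. monom_deg m + s = j"
  let ?Q = "\<lambda>m :: 'v \<Rightarrow>\<^sub>0 nat. monom_deg m + e = j"
  define a1 where "a1 = poly_filter ?Q a"
  define a2 where "a2 = poly_filter (\<lambda>m. \<not> ?Q m) a"
  have a: "a = a1 + a2"
    by (rule poly_mapping_eqI) (simp add: a1_def a2_def lookup_add coeff_poly_filter)
  have deg: "monom_deg x + e = monom_deg m + s" if "m = x + y" "y \<in> supp b" for m x y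
    using assms[OF that(2)] that(1) by (simp add: monom_deg_add)
  have "poly_filter ?P (a1 * b) = a1 * b"
  proof (rule poly_mapping_eqI)
    fix m
    have "?P m" if mem: "m \<in> supp (a1 * b)"
    proof -
      obtain x y where "m = x + y" "x \<in> supp a1" "y \<in> supp b" using keys_mult[of a1 b] mem by blast
      then show ?thesis using deg by (simp add: a1_def supp_poly_filter)
    qed
    then show "coeff (poly_filter ?P (a1 * b)) m = coeff (a1 * b) m"
      by (auto simp: coeff_poly_filter in_keys_iff)
  qed
  moreover have "poly_filter ?P (a2 * b) = 0"
  proof (rule poly_mapping_eqI)
    fix m
    have "\<not> ?P m" if mem: "m \<in> supp (a2 * b)"
    proof -
      obtain x y where "m = x + y" "x \<in> supp a2" "y \<in> supp b" using keys_mult[of a2 b] mem by blast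
      then show ?thesis using deg by (simp add: a2_def supp_poly_filter)
    qed
    then show "coeff (poly_filter ?P (a2 * b)) m = coeff 0 m"
      by (auto simp: coeff_poly_filter in_keys_iff)
  qed
  moreover have "poly_filter ?P (a * b) = poly_filter ?P (a1 * b) + poly_filter ?P (a2 * b)"
    by (subst a) (simp only: distrib_right poly_filter_add)
  ultimately show ?thesis unfolding a1_def by simp
qed

lemma hom_part_mat_map:
  assumes "graded_matrix V sh n e r A"
  shows "hom_part sh p j (mat_map n r A f) = mat_map n r A (hom_part e p j f)"
proof (rule ext)
  fix i
  show "hom_part sh p j (mat_map n r A f) i = mat_map n r A (hom_part e p j f) i"
  proof (cases "i < n")
    case False
    then show ?thesis by (simp add: hom_part_def mat_map_def poly_filter_def)
  next
    case True
    have "poly_filter (\<lambda>m. monom_deg m + (sh i + p) = j) (f q * A i q) =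
        poly_filter (\<lambda>m. monom_deg m + (e q + p) = j) (f q) * A i q" if "q < r" for q
      by (rule poly_filter_degree_mult) (use assms True that in \<open>simp add: graded_matrix_def add.assoc[symmetric]\<close>)
    then show ?thesis using True
      by (simp add: hom_part_def mat_map_def poly_filter_sum add.assoc)
  qed
qed

lemma homogeneous_mat_map:
  assumes "graded_matrix V sh n e r A" "homogeneous e p j f"
  shows "homogeneous sh p j (mat_map n r A f)"
  using hom_part_mat_map[OF assms(1), of p j f] homogeneous_hom_part hom_part_homogeneous[OF assms(2)]
  by metis

definition mat_kernel ::
  "'v set \<Rightarrow> nat \<Rightarrow> nat \<Rightarrow> (nat \<Rightarrow> nat \<Rightarrow> ('v, 'k::comm_ring_1) mpoly) \<Rightarrow> ('v, 'k) poly_vec set" where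
  "mat_kernel V n r A = {f \<in> free_mod V r. mat_map n r A f = 0}"

lemma graded_submodule_mat_kernel:
  fixes A :: "nat \<Rightarrow> nat \<Rightarrow> ('v, 'k::comm_ring_1) mpoly"
  assumes A: "graded_matrix V sh n e r A"
  shows "graded_submodule V e r (mat_kernel V n r A)"
proof -
  have F: "graded_submodule V e r (free_mod V r :: ('v, 'k) poly_vec set)"
    by (rule graded_submodule_free_mod)
  show ?thesis unfolding graded_submodule_def
  proof (intro conjI ballI allI)
    show "mat_kernel V n r A \<subseteq> free_mod V r" by (auto simp: mat_kernel_def)
    show "0 \<in> mat_kernel V n r A"
      using graded_submodule_zero[OF F] by (simp add: mat_kernel_def mat_map_zero)
  next
    fix f g assume "f \<in> mat_kernel V n r A" "g \<in> mat_kernel V n r A"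
    then show "f + g \<in> mat_kernel V n r A"
      using graded_submodule_add[OF F] by (simp add: mat_kernel_def mat_map_add)
  next
    fix a :: "('v, 'k) mpoly" and f assume "a \<in> poly_ring V" "f \<in> mat_kernel V n r A"
    then show "smul a f \<in> mat_kernel V n r A"
      using graded_submodule_smul[OF F, of a f]
      by (simp add: mat_kernel_def mat_map_smul) (simp add: smul_def zero_fun_def)
  next
    fix j f assume "f \<in> mat_kernel V n r A"
    then have f: "f \<in> free_mod V r" "mat_map n r A f = 0" by (auto simp: mat_kernel_def)
    have "mat_map n r A (hom_part e 0 j f) = hom_part sh 0 j 0"
      using hom_part_mat_map[OF A, of 0 j f] f(2) by simp
    also have "\<dots> = 0" by (rule hom_part_homogeneous) simp
    finally show "hom_part e 0 j f \<in> mat_kernel V n r A"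
      using graded_submodule_hom_part[OF F f(1)] by (simp add: mat_kernel_def)
  qed
qed

context koszul
begin

lemma comb_chain_outside: "comb_chain \<F> p f \<Longrightarrow> card S \<noteq> p \<Longrightarrow> f S = 0"
  by (auto simp: comb_chain_def)

definition free_monomials :: "nat \<Rightarrow> nat \<Rightarrow> ('v \<Rightarrow>\<^sub>0 nat) set" where
  "free_monomials n q = (if q < n then {m. supp m \<subseteq> V} else {})"

lemma free_mod_monomials: "free_mod V n = (monomial_span (free_monomials n) :: ('v, 'k::comm_ring_1) poly_vec set)"
  unfolding free_mod_eq_monomial_span free_monomials_def ..

lemma supp_free_monomials: "m \<in> free_monomials n q \<Longrightarrow> supp m \<subseteq> V"
  by (auto simp: free_monomials_def split: if_splits)

lemma comb_exact_free_strand: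
  assumes m: "supp m \<subseteq> V" "m \<noteq> 0"
  shows "comb_exact TYPE('k::comm_ring_1) (monomial_strand (free_monomials n) q m) p"
proof -
  obtain v where v: "v \<in> supp m" using m(2) supp_empty_iff by blast
  show ?thesis
  proof (rule comb_exact_cone)
    show "v \<in> V" using v m by blast
    show "monomial_strand (free_monomials n) q m \<subseteq> Pow V" using m by (auto simp: monomial_strand_def)
    fix S assume S: "S \<in> monomial_strand (free_monomials n) q m"
    have "supp (m - sqfree_monom (insert v S)) \<subseteq> supp m"
      by (auto simp: in_keys_iff lookup_minus)
    then show "insert v S \<in> monomial_strand (free_monomials n) q m"
      using S v m by (auto simp: monomial_strand_def free_monomials_def split: if_splits)
  qed
qed

text \<open>In multidegree \<open>m \<noteq> 0\<close> the strand of a free module is a full simplex on the support of \<open>m\<close>; in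
  multidegree \<open>0\<close> it consists of the empty set alone, which has size \<open>0\<close>.\<close>

lemma exact_at_free_mod:
  assumes "p \<ge> 1"
  shows "exact_at sh (free_mod V n :: ('v, 'k::comm_ring_1) poly_vec set) p j"
proof -
  have zero: "comb_exact TYPE('k) (monomial_strand (free_monomials n) q 0) p" for q
    unfolding comb_exact_def
  proof (intro allI impI)
    fix f :: "'v set \<Rightarrow> 'k"
    assume "comb_chain (monomial_strand (free_monomials n) q 0) p f"
    then have "f S = 0" for S
      using assms unfolding comb_chain_def monomial_strand_def by force
    then show "\<exists>g. comb_chain (monomial_strand (free_monomials n) q 0) (Suc p) g \<and> (\<forall>T\<subseteq>V. strand_diff g T = f T)"
      by (intro exI[of _ "\<lambda>_. 0"]) (simp add: comb_chain_def strand_diff_def)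
  qed
  have graded: "graded_submodule V sh n (monomial_span (free_monomials n) :: ('v, 'k) poly_vec set)"
    unfolding free_mod_monomials[symmetric] by (rule graded_submodule_free_mod)
  have "comb_exact TYPE('k) (monomial_strand (free_monomials n) q m) p" if "supp m \<subseteq> V" for q m
  proof (cases "m = 0")
    case True then show ?thesis using zero by simp
  next
    case False then show ?thesis using that by (intro comb_exact_free_strand)
  qed
  then show ?thesis
    unfolding free_mod_monomials
    by (subst exact_at_monomial_span[OF graded]) (simp_all add: supp_free_monomials)
qed

text \<open>At index \<open>0\<close> the only obstruction sits in multidegree \<open>0\<close>: the homology is the free module modulo the
  irrelevant ideal.\<close>

lemma zero_chain_boundary:
  fixes c :: "'v set \<Rightarrow> ('v, 'k::comm_ring_1) poly_vec"
  assumes c: "chain sh (free_mod V n) 0 j c" and c0: "\<And>q. coeff (c {} q) 0 = 0"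
  shows "\<exists>d. chain sh (free_mod V n) (Suc 0) j d \<and> koszul_diff d = c"
  unfolding free_mod_monomials
proof (rule boundary_if_strands_boundaries[OF _ supp_free_monomials])
  show "graded_submodule V sh n (monomial_span (free_monomials n) :: ('v, 'k) poly_vec set)"
    unfolding free_mod_monomials[symmetric] by (rule graded_submodule_free_mod)
  show ch: "chain sh (monomial_span (free_monomials n)) 0 j c"
    using c unfolding free_mod_monomials .
  fix q and m :: "'v \<Rightarrow>\<^sub>0 nat" assume m: "supp m \<subseteq> V"
  note cs = comb_chain_strand[OF ch, of q m]
  have pos: "f S = 0" if "comb_chain \<F> 0 f" "S \<noteq> {}" "S \<subseteq> V" for \<F> S and f :: "'v set \<Rightarrow> 'k"
    using that finite_V[of S] by (intro comb_chain_outside[OF that(1)]) auto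
  show "\<exists>g. comb_chain (monomial_strand (free_monomials n) q m) (Suc 0) g \<and> (\<forall>T\<subseteq>V. strand_diff g T = strand c q m T)"
  proof (cases "m = 0")
    case False
    have "strand_diff (strand c q m) T = 0" if "T \<subseteq> V" for T
      unfolding strand_diff_def
    proof (rule sum.neutral, rule ballI)
      fix s assume "s \<in> V - T"
      then have "strand c q m (insert s T) = 0" using that by (intro pos[OF cs]) auto
      then show "ksign s T * strand c q m (insert s T) = 0" by simp
    qed
    then show ?thesis
      using comb_exact_free_strand[OF m False, where 'k = 'k and p = 0] cs unfolding comb_exact_def by simp
  next
    case True
    have "strand c q m T = 0" if "T \<subseteq> V" for T
    proof (cases "T = {}")
      case T: True then show ?thesis using c0 True by (simp add: strand_def)
    next
      case False then show ?thesis using pos[OF cs] that by blast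
    qed
    then show ?thesis by (intro exI[of _ "\<lambda>_. 0"]) (simp add: comb_chain_def strand_diff_def)
  qed
qed

lemma coeff_koszul_diff_zero: "coeff (koszul_diff d T q) 0 = 0"
  by (simp add: koszul_diff_apply lookup_sum coeff_ksign_mult coeff_var_mult mult.assoc)

lemma koszul_diff_mat_map: "koszul_diff (\<lambda>S. mat_map n r A (c S)) = (\<lambda>T. mat_map n r A (koszul_diff c T))"
  by (rule ext) (simp add: koszul_diff_def mat_map_sum mat_map_smul)

lemma chain_mat_map:
  assumes A: "graded_matrix V sh n e r A" and c: "chain e (free_mod V r) p j c"
  shows "chain sh (mat_map n r A ` free_mod V r) p j (\<lambda>S. mat_map n r A (c S))"
proof (rule chainI)
  fix S assume "S \<subseteq> V" "card S = p"
  then show "mat_map n r A (c S) \<in> mat_map n r A ` free_mod V r" "homogeneous sh p j (mat_map n r A (c S))"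
    using chain_in[OF c] chain_homogeneous[OF c] homogeneous_mat_map[OF A] by auto
next
  fix S assume "\<not> (S \<subseteq> V \<and> card S = p)"
  then show "mat_map n r A (c S) = 0" using chain_outside[OF c] by (simp add: mat_map_zero)
qed

text \<open>A graded surjection is surjective in each degree: take the homogeneous part of any preimage.\<close>

lemma chain_lift:
  assumes A: "graded_matrix V sh n e r A"
    and c: "chain sh (mat_map n r A ` free_mod V r) p j c"
  obtains c' where "chain e (free_mod V r) p j c'" "c = (\<lambda>S. mat_map n r A (c' S))"
proof -
  define l where "l S = (SOME f. f \<in> free_mod V r \<and> mat_map n r A f = c S)" for S
  have l: "l S \<in> free_mod V r" "mat_map n r A (l S) = c S" if "S \<subseteq> V" "card S = p" for S
  proof -
    have "\<exists>f. f \<in> free_mod V r \<and> mat_map n r A f = c S" using chain_in[OF c that] by auto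
    from someI_ex[OF this] show "l S \<in> free_mod V r" "mat_map n r A (l S) = c S"
      unfolding l_def by blast+
  qed
  define c' where "c' S = (if S \<subseteq> V \<and> card S = p then hom_part e p j (l S) else 0)" for S
  have "chain e (free_mod V r) p j c'"
    by (rule chainI)
      (auto simp: c'_def homogeneous_hom_part graded_submodule_hom_part[OF graded_submodule_free_mod] l)
  moreover have "c S = mat_map n r A (c' S)" for S
  proof (cases "S \<subseteq> V \<and> card S = p")
    case True
    then have "mat_map n r A (c' S) = hom_part sh p j (c S)"
      using hom_part_mat_map[OF A, of p j "l S"] l[of S] by (simp add: c'_def)
    then show ?thesis using hom_part_homogeneous[OF chain_homogeneous[OF c]] True by simp
  next
    case False
    then have "c S = 0" "c' S = 0" using chain_outside[OF c False] by (auto simp: c'_def)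
    then show ?thesis by (simp only: mat_map_zero)
  qed
  ultimately show ?thesis using that by blast
qed

lemma chain_mat_kernel:
  assumes "chain e (free_mod V r) p j c" "\<And>S. mat_map n r A (c S) = 0"
  shows "chain e (mat_kernel V n r A) p j c"
  using assms unfolding chain_def mat_kernel_def by simp

text \<open>Dimension shifting along \<open>0 \<rightarrow> Z' \<rightarrow> F \<rightarrow> Z \<rightarrow> 0\<close>. For \<open>p > 0\<close> this is the long exact sequence and
  the exactness of the Koszul complex of \<open>F\<close>; for \<open>p = 0\<close> the hypothesis on the kernel makes the map
  from the homology of \<open>Z'\<close> to that of \<open>F\<close> zero.\<close>

theorem exact_at_kernel_iff:
  fixes A :: "nat \<Rightarrow> nat \<Rightarrow> ('v, 'k::comm_ring_1) mpoly"
  assumes A: "graded_matrix V sh n e r A"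
    and min: "\<And>f q. f \<in> mat_kernel V n r A \<Longrightarrow> coeff (f q) 0 = 0"
  shows "exact_at e (mat_kernel V n r A) p j \<longleftrightarrow> exact_at sh (mat_map n r A ` free_mod V r) (Suc p) j"
proof
  let ?\<phi> = "mat_map n r A" and ?F = "free_mod V r :: ('v, 'k) poly_vec set"
  have F: "graded_submodule V e r ?F" by (rule graded_submodule_free_mod)
  have F_exact: "exact_at e ?F i j" if "i \<ge> 1" for i
    using that by (rule exact_at_free_mod)
  have KF: "mat_kernel V n r A \<subseteq> ?F" by (auto simp: mat_kernel_def)
  {
    assume ex: "exact_at sh (?\<phi> ` ?F) (Suc p) j"
    show "exact_at e (mat_kernel V n r A) p j" unfolding exact_at_def
    proof (intro allI impI)
      fix c :: "'v set \<Rightarrow> ('v, 'k) poly_vec"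
      assume c: "chain e (mat_kernel V n r A) p j c" "koszul_diff c = 0"
      have cF: "chain e ?F p j c" using chain_mono[OF c(1) KF] .
      have "\<exists>d. chain e ?F (Suc p) j d \<and> koszul_diff d = c"
      proof (cases "p = 0")
        case True
        have "coeff (c {} q) 0 = 0" for q
          using chain_in[OF c(1), of "{}"] min True by simp
        then show ?thesis using zero_chain_boundary[of e r j c] cF True by simp
      next
        case False
        then have "p \<ge> 1" by simp
        then show ?thesis using F_exact[of p] cF c(2) unfolding exact_at_def by blast
      qed
      then obtain d where d: "chain e ?F (Suc p) j d" "koszul_diff d = c" by blast
      have "?\<phi> (c S) = 0" for S
      proof (cases "S \<subseteq> V \<and> card S = p")
        case True then show ?thesis using chain_in[OF c(1)] by (simp add: mat_kernel_def)
      next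
        case False then show ?thesis using chain_outside[OF c(1)] by (simp add: mat_map_zero)
      qed
      then have "koszul_diff (\<lambda>S. ?\<phi> (d S)) = 0" unfolding koszul_diff_mat_map d(2) by (simp add: zero_fun_def)
      then obtain g where g: "chain sh (?\<phi> ` ?F) (Suc (Suc p)) j g" "koszul_diff g = (\<lambda>S. ?\<phi> (d S))"
        using ex chain_mat_map[OF A d(1)] unfolding exact_at_def by blast
      obtain g' where g': "chain e ?F (Suc (Suc p)) j g'" "g = (\<lambda>S. ?\<phi> (g' S))"
        using chain_lift[OF A g(1)] by blast
      have ch: "chain e ?F (Suc p) j (d - koszul_diff g')"
        by (rule chain_diff[OF F d(1) chain_koszul_diff[OF F g'(1)]])
      have "?\<phi> ((d - koszul_diff g') S) = 0" for S
        using g(2) unfolding g'(2) koszul_diff_mat_map by (simp add: mat_map_diff fun_eq_iff)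
      then have "chain e (mat_kernel V n r A) (Suc p) j (d - koszul_diff g')"
        by (rule chain_mat_kernel[OF ch])
      moreover have "koszul_diff (d - koszul_diff g') = c" by (simp add: koszul_diff_diff koszul_diff_koszul_diff d(2))
      ultimately show "\<exists>d. chain e (mat_kernel V n r A) (Suc p) j d \<and> koszul_diff d = c" by blast
    qed
  }
  {
    assume ex: "exact_at e (mat_kernel V n r A) p j"
    show "exact_at sh (?\<phi> ` ?F) (Suc p) j" unfolding exact_at_def
    proof (intro allI impI)
      fix c assume c: "chain sh (?\<phi> ` ?F) (Suc p) j c" "koszul_diff c = 0"
      obtain c' where c': "chain e ?F (Suc p) j c'" "c = (\<lambda>S. ?\<phi> (c' S))"
        using chain_lift[OF A c(1)] by blast
      have "?\<phi> (koszul_diff c' S) = 0" for S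
        using c(2) unfolding c'(2) koszul_diff_mat_map by (simp add: fun_eq_iff)
      then have "chain e (mat_kernel V n r A) p j (koszul_diff c')"
        by (rule chain_mat_kernel[OF chain_koszul_diff[OF F c'(1)]])
      then obtain g where g: "chain e (mat_kernel V n r A) (Suc p) j g" "koszul_diff g = koszul_diff c'"
        using ex koszul_diff_koszul_diff[of c'] unfolding exact_at_def by blast
      have "chain e ?F (Suc p) j (c' - g)" by (rule chain_diff[OF F c'(1) chain_mono[OF g(1) KF]])
      moreover have "koszul_diff (c' - g) = 0" by (simp add: koszul_diff_diff g(2))
      ultimately obtain d where d: "chain e ?F (Suc (Suc p)) j d" "koszul_diff d = c' - g"
        using F_exact[of "Suc p"] unfolding exact_at_def by auto
      have "?\<phi> (g S) = 0" for S
      proof (cases "S \<subseteq> V \<and> card S = Suc p")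
        case True then show ?thesis using chain_in[OF g(1)] by (simp add: mat_kernel_def)
      next
        case False then show ?thesis using chain_outside[OF g(1)] by (simp add: mat_map_zero)
      qed
      then have "koszul_diff (\<lambda>S. ?\<phi> (d S)) = c"
        unfolding koszul_diff_mat_map d(2) c'(2) by (simp add: mat_map_diff)
      then show "\<exists>d. chain sh (?\<phi> ` ?F) (Suc (Suc p)) j d \<and> koszul_diff d = c"
        using chain_mat_map[OF A d(1)] by blast
    qed
  }
qed

definition unit_vec :: "nat \<Rightarrow> ('v, 'k::comm_ring_1) poly_vec" where
  "unit_vec q = (\<lambda>p. if p = q then 1 else 0)"

lemma unit_vec_free_mod: "q < r \<Longrightarrow> unit_vec q \<in> free_mod V r"
  by (simp add: unit_vec_def free_mod_def)

text \<open>Since the kernel consists of vectors without constant terms, no basis element of the free module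
  becomes superfluous modulo the irrelevant ideal: \<open>Z/\<mm>Z\<close> has one basis element for each of them.\<close>

theorem exact_at_zero_iff_no_generator:
  fixes A :: "nat \<Rightarrow> nat \<Rightarrow> ('v, 'k::comm_ring_1) mpoly"
  assumes A: "graded_matrix V sh n e r A"
    and min: "\<And>f q. f \<in> mat_kernel V n r A \<Longrightarrow> coeff (f q) 0 = 0"
  shows "exact_at sh (mat_map n r A ` free_mod V r) 0 j \<longleftrightarrow> (\<forall>q<r. e q \<noteq> j)"
proof
  let ?\<phi> = "mat_map n r A" and ?F = "free_mod V r :: ('v, 'k) poly_vec set"
  have F: "graded_submodule V e r (free_mod V r :: ('v, 'k) poly_vec set)"
    by (rule graded_submodule_free_mod)
  {
    assume ex: "exact_at sh (?\<phi> ` ?F) 0 j"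
    show "\<forall>q<r. e q \<noteq> j"
    proof (intro allI impI notI)
      fix q assume q: "q < r" "e q = j"
      define u :: "'v set \<Rightarrow> ('v, 'k) poly_vec" where "u S = (if S = {} then unit_vec q else 0)" for S
      have card0: "S = {}" if "S \<subseteq> V" "card S = 0" for S using that finite_subset[OF that(1) finV] by simp
      have u: "chain e ?F 0 j u"
      proof (rule chainI)
        fix S assume "S \<subseteq> V" "card S = 0"
        then have "u S = unit_vec q" using card0 by (simp add: u_def)
        then show "u S \<in> ?F" "homogeneous e 0 j (u S)"
          using q unit_vec_free_mod[OF q(1)] by (auto simp: homogeneous_def unit_vec_def)
      next
        fix S assume "\<not> (S \<subseteq> V \<and> card S = 0)"
        then show "u S = 0" by (auto simp: u_def)
      qed
      have "koszul_diff u = 0" by (rule ext, rule ext) (simp add: koszul_diff_apply u_def)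
      then have "koszul_diff (\<lambda>S. ?\<phi> (u S)) = 0" unfolding koszul_diff_mat_map by (intro ext) (simp add: mat_map_zero)
      then obtain d where d: "chain sh (?\<phi> ` ?F) (Suc 0) j d" "koszul_diff d = (\<lambda>S. ?\<phi> (u S))"
        using ex chain_mat_map[OF A u] unfolding exact_at_def by blast
      obtain d' where d': "chain e ?F (Suc 0) j d'" "d = (\<lambda>S. ?\<phi> (d' S))"
        using chain_lift[OF A d(1)] by blast
      have "?\<phi> ((u - koszul_diff d') {}) = 0"
        using d(2) unfolding d'(2) koszul_diff_mat_map by (simp add: mat_map_diff fun_eq_iff)
      moreover have "(u - koszul_diff d') {} \<in> ?F"
        using chain_in[OF chain_diff[OF F u chain_koszul_diff[OF F d'(1)]], of "{}"] by simp
      ultimately have "(u - koszul_diff d') {} \<in> mat_kernel V n r A" unfolding mat_kernel_def by blast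
      then have "coeff ((u - koszul_diff d') {} q) 0 = 0" by (rule min)
      then have "coeff (u {} q) 0 = 0" by (simp add: lookup_minus coeff_koszul_diff_zero)
      then show False by (simp add: u_def unit_vec_def)
    qed
  }
  {
    assume no: "\<forall>q<r. e q \<noteq> j"
    show "exact_at sh (?\<phi> ` ?F) 0 j" unfolding exact_at_def
    proof (intro allI impI)
      fix c assume c: "chain sh (?\<phi> ` ?F) 0 j c"
      obtain c' where c': "chain e ?F 0 j c'" "c = (\<lambda>S. ?\<phi> (c' S))"
        using chain_lift[OF A c] by blast
      have "coeff (c' {} q) 0 = 0" for q
      proof (rule ccontr)
        assume nz: "coeff (c' {} q) 0 \<noteq> 0"
        have "q < r"
        proof (rule ccontr)
          assume "\<not> q < r"
          then have "c' {} q = 0" using chain_in[OF c'(1), of "{}"] by (simp add: free_mod_def)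
          then show False using nz by simp
        qed
        moreover have "homogeneous e 0 j (c' {})" using chain_homogeneous[OF c'(1), of "{}"] by simp
        then have "e q = j" using nz unfolding homogeneous_def by (metis add_0 add_0_right in_keys_iff monom_deg_zero)
        ultimately show False using no by blast
      qed
      then obtain d where d: "chain e ?F (Suc 0) j d" "koszul_diff d = c'"
        using zero_chain_boundary[OF c'(1)] by blast
      then have "koszul_diff (\<lambda>S. ?\<phi> (d S)) = c" unfolding koszul_diff_mat_map c'(2) by simp
      then show "\<exists>d. chain sh (?\<phi> ` ?F) (Suc 0) j d \<and> koszul_diff d = c"
        using chain_mat_map[OF A d(1)] by blast
    qed
  }
qed

end

section \<open>Existence of minimal graded free resolutions\<close>

text \<open>A space of vectors with coefficients at finitely many fixed monomials is finite-dimensional; the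
  induction eliminates one coefficient at a time.\<close>

lemma finite_dim_span:
  fixes W :: "('v, 'k::field) poly_vec set"
  assumes "finite X" and "0 \<in> W" and "\<And>f g. f \<in> W \<Longrightarrow> g \<in> W \<Longrightarrow> f + g \<in> W"
    and "\<And>a f. f \<in> W \<Longrightarrow> smul (sing 0 a) f \<in> W"
    and "\<And>f q m. f \<in> W \<Longrightarrow> coeff (f q) m \<noteq> 0 \<Longrightarrow> (q, m) \<in> X"
  shows "\<exists>B\<subseteq>W. finite B \<and> (\<forall>w\<in>W. \<exists>a. w = (\<Sum>b\<in>B. smul (sing 0 (a b)) b))"
  using assms
proof (induction X arbitrary: W)
  case empty
  have "w = 0" if "w \<in> W" for w
    using empty.prems(4)[OF that] by (intro ext poly_mapping_eqI) auto
  then have "w = (\<Sum>b\<in>{}. smul (sing 0 (a b)) b)" if "w \<in> W" for w a using that by (simp only: sum.empty)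
  then show ?case by blast
next
  case (insert x X)
  obtain q0 m0 where x: "x = (q0, m0)" by (cases x)
  define W' where "W' = {w \<in> W. coeff (w q0) m0 = 0}"
  have "\<exists>B\<subseteq>W'. finite B \<and> (\<forall>w\<in>W'. \<exists>a. w = (\<Sum>b\<in>B. smul (sing 0 (a b)) b))"
  proof (rule insert.IH)
    show "(q, m) \<in> X" if "f \<in> W'" "coeff (f q) m \<noteq> 0" for f q m
      using insert.prems(4)[of f q m] that by (auto simp: W'_def x)
  qed (use insert.prems(1-3) in \<open>auto simp: W'_def lookup_add coeff_const_mult\<close>)
  then obtain B where B: "B \<subseteq> W'" "finite B" "\<And>w. w \<in> W' \<Longrightarrow> \<exists>a. w = (\<Sum>b\<in>B. smul (sing 0 (a b)) b)"
    by blast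
  show ?case
  proof (cases "\<exists>w0\<in>W. coeff (w0 q0) m0 \<noteq> 0")
    case False
    then have "W = W'" by (auto simp: W'_def)
    then show ?thesis using B by blast
  next
    case True
    then obtain w0 where w0: "w0 \<in> W" "coeff (w0 q0) m0 \<noteq> 0" by blast
    have "w0 \<notin> B" using w0 B(1) by (auto simp: W'_def)
    have comb: "\<exists>a. w = (\<Sum>b\<in>insert w0 B. smul (sing 0 (a b)) b)" if w: "w \<in> W" for w
    proof -
      define \<alpha> where "\<alpha> = coeff (w q0) m0 / coeff (w0 q0) m0"
      have "w + smul (sing 0 (- \<alpha>)) w0 \<in> W"
        by (rule insert.prems(2)[OF w insert.prems(3)[OF w0(1)]])
      moreover have "coeff ((w + smul (sing 0 (- \<alpha>)) w0) q0) m0 = 0"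
        using w0(2) by (simp add: lookup_add coeff_const_mult \<alpha>_def)
      ultimately have "w + smul (sing 0 (- \<alpha>)) w0 \<in> W'" unfolding W'_def by blast
      then obtain a where a: "w + smul (sing 0 (- \<alpha>)) w0 = (\<Sum>b\<in>B. smul (sing 0 (a b)) b)"
        using B(3) by blast
      have "w = smul (sing 0 \<alpha>) w0 + (w + smul (sing 0 (- \<alpha>)) w0)"
        by (rule ext) (simp add: single_uminus)
      also have "\<dots> = (\<Sum>b\<in>insert w0 B. smul (sing 0 ((a(w0 := \<alpha>)) b)) b)"
        unfolding a using \<open>w0 \<notin> B\<close> B(2) by (auto intro!: sum.cong arg_cong2[where f = "(+)"])
      finally show ?thesis by blast
    qed
    have "insert w0 B \<subseteq> W" using B(1) w0(1) unfolding W'_def by blast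
    then show ?thesis using comb B(2) by (intro exI[of _ "insert w0 B"] conjI ballI finite.insertI)
  qed
qed

definition module_span :: "'v set \<Rightarrow> ('v, 'k::comm_ring_1) poly_vec set \<Rightarrow> ('v, 'k) poly_vec set" where
  "module_span V G = {\<Sum>g\<in>G. smul (a g) g | a. \<forall>g. a g \<in> poly_ring V}"

context
  fixes V :: "'v set" and G :: "('v, 'k::comm_ring_1) poly_vec set"
begin

lemma module_span_zero: "0 \<in> module_span V G"
  unfolding module_span_def
  by (intro CollectI exI[of _ "\<lambda>_. 0"] conjI) (auto simp: smul_def fun_eq_iff sum_fun_apply)

lemma module_span_add:
  assumes "f \<in> module_span V G" "g \<in> module_span V G"
  shows "f + g \<in> module_span V G"
proof -
  obtain a b where "f = (\<Sum>g\<in>G. smul (a g) g)" "\<forall>g. a g \<in> poly_ring V"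
    "g = (\<Sum>g\<in>G. smul (b g) g)" "\<forall>g. b g \<in> poly_ring V"
    using assms unfolding module_span_def by blast
  moreover have "(\<Sum>g\<in>G. smul (a g) g) + (\<Sum>g\<in>G. smul (b g) g) = (\<Sum>g\<in>G. smul (a g + b g) g)"
    by (rule ext) (simp add: sum_fun_apply sum.distrib distrib_right)
  ultimately show ?thesis unfolding module_span_def
    by (intro CollectI exI[of _ "\<lambda>g. a g + b g"]) (simp add: poly_ring_add)
qed

lemma module_span_smul:
  assumes "f \<in> module_span V G" "c \<in> poly_ring V"
  shows "smul c f \<in> module_span V G"
proof -
  obtain a where "f = (\<Sum>g\<in>G. smul (a g) g)" "\<forall>g. a g \<in> poly_ring V"
    using assms(1) unfolding module_span_def by blast
  moreover have "smul c (\<Sum>g\<in>G. smul (a g) g) = (\<Sum>g\<in>G. smul (c * a g) g)"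
    by (rule ext) (simp add: sum_fun_apply sum_distrib_left mult.assoc)
  ultimately show ?thesis unfolding module_span_def
    by (intro CollectI exI[of _ "\<lambda>g. c * a g"]) (simp add: poly_ring_mult assms(2))
qed

lemma module_span_sum: "(\<And>i. i \<in> I \<Longrightarrow> f i \<in> module_span V G) \<Longrightarrow> (\<Sum>i\<in>I. f i) \<in> module_span V G"
  by (induction I rule: infinite_finite_induct) (auto intro: module_span_zero module_span_add)

lemma module_span_base: "finite G \<Longrightarrow> g \<in> G \<Longrightarrow> g \<in> module_span V G"
proof -
  assume G: "finite G" "g \<in> G"
  have "(\<Sum>h\<in>G. smul (if h = g then 1 else 0) h) = g"
  proof (rule ext)
    fix q
    have "(\<Sum>h\<in>G. (if h = g then 1 else 0) * h q) = (\<Sum>h\<in>G. if h = g then g q else 0)"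
      by (rule sum.cong) auto
    then show "(\<Sum>h\<in>G. smul (if h = g then 1 else 0) h) q = g q" using G by (simp add: sum_fun_apply)
  qed
  then show ?thesis unfolding module_span_def
    by (intro CollectI exI[of _ "\<lambda>h. if h = g then 1 else 0"]) auto
qed

end

lemma module_span_subset:
  assumes "G \<subseteq> module_span V H"
  shows "module_span V G \<subseteq> module_span V H"
proof
  fix f assume "f \<in> module_span V G"
  then obtain a where "f = (\<Sum>g\<in>G. smul (a g) g)" "\<forall>g. a g \<in> poly_ring V"
    unfolding module_span_def by blast
  then show "f \<in> module_span V H" using assms by (auto intro!: module_span_sum module_span_smul)
qed

definition homogeneous_generators ::
  "'v set \<Rightarrow> (nat \<Rightarrow> nat) \<Rightarrow> ('v, 'k::comm_ring_1) poly_vec set \<Rightarrow> ('v, 'k) poly_vec set \<Rightarrow> bool" where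
  "homogeneous_generators V sh Z G \<longleftrightarrow> finite G \<and> G \<subseteq> Z \<and> Z \<subseteq> module_span V G \<and>
     (\<forall>g\<in>G. \<exists>j. homogeneous sh 0 j g)"

lemma eq_sum_hom_parts:
  assumes "f \<in> free_mod V n"
  shows "f = (\<Sum>j\<in>(\<Union>q<n. (\<lambda>m. monom_deg m + sh q) ` supp (f q)). hom_part sh 0 j f)"
    (is "f = (\<Sum>j\<in>?J. _)")
proof (rule ext, rule poly_mapping_eqI)
  fix q m
  have "coeff ((\<Sum>j\<in>?J. hom_part sh 0 j f) q) m = (\<Sum>j\<in>?J. if monom_deg m + sh q = j then coeff (f q) m else 0)"
    by (simp add: sum_fun_apply lookup_sum hom_part_def coeff_poly_filter)
  also have "\<dots> = (if monom_deg m + sh q \<in> ?J then coeff (f q) m else 0)" by (simp add: sum.delta')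
  also have "\<dots> = coeff (f q) m"
  proof (cases "coeff (f q) m = 0")
    case False
    then have "q < n" using assms unfolding free_mod_def by (metis (mono_tags, lifting) lookup_zero mem_Collect_eq not_less)
    moreover have "m \<in> supp (f q)" using False by (simp add: in_keys_iff)
    ultimately have "monom_deg m + sh q \<in> ?J" by blast
    then show ?thesis by simp
  qed simp
  finally show "coeff (f q) m = coeff ((\<Sum>j\<in>?J. hom_part sh 0 j f) q) m" by simp
qed

context koszul
begin

text \<open>The graded form of Nakayama's lemma. An element of degree \<open>j > d\<close> is a combination of the variables with
  coefficients in \<open>Z\<close> of degree \<open>j - 1\<close>, so the finite-dimensional pieces of degree at most \<open>d\<close> generate.\<close>

lemma homogeneous_generators_exist:
  fixes Z :: "('v, 'k::field) poly_vec set"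
  assumes Z: "graded_submodule V sh n Z" and d: "\<And>j. j > d \<Longrightarrow> exact_at sh Z 0 j"
  shows "\<exists>G. homogeneous_generators V sh Z G"
proof -
  define W where "W j = {f \<in> Z. homogeneous sh 0 j f}" for j
  have "\<exists>B\<subseteq>W j. finite B \<and> (\<forall>w\<in>W j. \<exists>a. w = (\<Sum>b\<in>B. smul (sing 0 (a b)) b))" for j
  proof (rule finite_dim_span)
    show "finite ({..<n} \<times> {m :: 'v \<Rightarrow>\<^sub>0 nat. supp m \<subseteq> V \<and> monom_deg m \<le> j})"
      using finite_monoms_of_degree[OF finV] by simp
    show "0 \<in> W j" using graded_submodule_zero[OF Z] by (simp add: W_def)
    show "f + g \<in> W j" if "f \<in> W j" "g \<in> W j" for f g
      using that graded_submodule_add[OF Z] homogeneous_add by (auto simp: W_def)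
    show "smul (sing 0 a) f \<in> W j" if "f \<in> W j" for a f
    proof -
      have "f \<in> Z" "homogeneous sh 0 j f" using that by (auto simp: W_def)
      then have "homogeneous sh 0 (0 + j) (smul (sing 0 a) f)"
        by (intro homogeneous_smul) (simp_all split: if_splits)
      moreover have "smul (sing 0 a) f \<in> Z"
        by (intro graded_submodule_smul[OF Z] poly_ring_single \<open>f \<in> Z\<close>) simp
      ultimately show ?thesis unfolding W_def by simp
    qed
    fix f q m assume f: "f \<in> W j" and nz: "coeff (f q) m \<noteq> 0"
    have fr: "f \<in> free_mod V n" using f graded_submodule_free[OF Z] by (simp add: W_def)
    have "q < n" using nz fr unfolding free_mod_def by (metis (mono_tags, lifting) lookup_zero mem_Collect_eq not_less)
    moreover have "supp m \<subseteq> V"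
      using fr nz \<open>q < n\<close> by (auto simp: free_mod_def poly_ring_def in_keys_iff)
    moreover have "monom_deg m + sh q + 0 = j"
      using f nz unfolding W_def homogeneous_def in_keys_iff[symmetric] by blast
    ultimately show "(q, m) \<in> {..<n} \<times> {m. supp m \<subseteq> V \<and> monom_deg m \<le> j}" by simp
  qed
  then have "\<forall>j. \<exists>B. B \<subseteq> W j \<and> finite B \<and> (\<forall>w\<in>W j. \<exists>a. w = (\<Sum>b\<in>B. smul (sing 0 (a b)) b))"
    by (intro allI)
  from choice[OF this] obtain B where
    Ball: "\<forall>j. B j \<subseteq> W j \<and> finite (B j) \<and> (\<forall>w\<in>W j. \<exists>a. w = (\<Sum>b\<in>B j. smul (sing 0 (a b)) b))" ..
  have B: "B j \<subseteq> W j" "finite (B j)"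
    "w \<in> W j \<Longrightarrow> \<exists>a. w = (\<Sum>b\<in>B j. smul (sing 0 (a b)) b)" for j w
    using spec[OF Ball, of j] by blast+
  define G where "G = (\<Union>j\<le>d. B j)"
  have finG: "finite G" using B(2) by (simp add: G_def)
  have W_span: "w \<in> module_span V G" if "w \<in> W j" for w j
    using that
  proof (induction j arbitrary: w rule: less_induct)
    case (less j)
    show ?case
    proof (cases "j \<le> d")
      case True
      obtain a where a: "w = (\<Sum>b\<in>B j. smul (sing 0 (a b)) b)" using B(3)[OF less.prems] by blast
      have "b \<in> module_span V G" if "b \<in> B j" for b
        using that True module_span_base[OF finG] by (auto simp: G_def)
      then show ?thesis unfolding a
        by (intro module_span_sum module_span_smul poly_ring_single) auto
    next
      case False
      \<comment> \<open>Exactness at index \<open>0\<close> writes \<open>w\<close>, as the coefficient of the empty set, through the variables.\<close>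
      define c where "c S = (if S = {} then w else 0)" for S :: "'v set"
      have w: "w \<in> Z" "homogeneous sh 0 j w" using less.prems by (auto simp: W_def)
      have c: "chain sh Z 0 j c"
      proof (rule chainI)
        fix S assume S: "S \<subseteq> V" "card S = 0"
        then have "S = {}" using finite_subset[OF S(1) finV] by simp
        then show "c S \<in> Z" "homogeneous sh 0 j (c S)" using w by (auto simp: c_def)
      qed (auto simp: c_def)
      have "koszul_diff c = 0" by (rule ext, rule ext) (simp add: koszul_diff_apply c_def)
      then obtain e where e: "chain sh Z (Suc 0) j e" "koszul_diff e = c"
        using d[of j] False c unfolding exact_at_def by auto
      have "w = (\<Sum>s\<in>V. smul (ksign s {} * var s) (e {s}))"
        using fun_cong[OF e(2), of "{}"] by (simp add: koszul_diff_def c_def)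
      moreover have "e {s} \<in> module_span V G" if s: "s \<in> V" for s
      proof (rule less.IH)
        show "j - 1 < j" using False by simp
        have "homogeneous sh (Suc 0) j (e {s})" using chain_homogeneous[OF e(1), of "{s}"] s by simp
        then have "homogeneous sh 0 (j - 1) (e {s})"
          unfolding homogeneous_def by (metis add.commute add_0 diff_Suc_1 plus_1_eq_Suc add_Suc_right)
        then show "e {s} \<in> W (j - 1)" using chain_in[OF e(1), of "{s}"] s by (simp add: W_def)
      qed
      ultimately show ?thesis
        by (auto intro!: module_span_sum module_span_smul poly_ring_mult poly_ring_var ksign_poly_ring)
    qed
  qed
  have "Z \<subseteq> module_span V G"
  proof
    fix f assume f: "f \<in> Z"
    have "hom_part sh 0 j f \<in> module_span V G" for j
      by (rule W_span[of _ j]) (simp add: W_def homogeneous_hom_part graded_submodule_hom_part[OF Z f])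
    then show "f \<in> module_span V G"
      by (subst eq_sum_hom_parts[OF graded_submodule_free[OF Z f], of sh]) (rule module_span_sum)
  qed
  moreover have "G \<subseteq> Z" "\<forall>g\<in>G. \<exists>j. homogeneous sh 0 j g"
    using B(1) by (auto simp: G_def W_def)
  ultimately show ?thesis using finG unfolding homogeneous_generators_def by blast
qed

text \<open>A generating set of least cardinality works: a relation with a nonzero constant coefficient, cut down to
  the degree of the corresponding generator, expresses this generator through the others.\<close>

lemma minimal_presentation_exists:
  fixes Z :: "('v, 'k::field) poly_vec set"
  assumes Z: "graded_submodule V sh n Z" and d: "\<And>j. j > d \<Longrightarrow> exact_at sh Z 0 j"
  shows "\<exists>r e A. graded_matrix V sh n e r A \<and> mat_map n r A ` free_mod V r = Z \<and>
    (\<forall>f\<in>mat_kernel V n r A. \<forall>q. coeff (f q) 0 = 0)"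
proof -
  define P where "P k \<longleftrightarrow> (\<exists>G. homogeneous_generators V sh Z G \<and> card G = k)" for k
  have "\<exists>k. P k" using homogeneous_generators_exist[OF assms] unfolding P_def by blast
  then have "P (LEAST k. P k)" by (rule LeastI_ex)
  then obtain G where G: "homogeneous_generators V sh Z G" and least: "card G = (LEAST k. P k)"
    unfolding P_def[of "LEAST k. P k"] by blast
  have G_min: "card G \<le> card H" if "homogeneous_generators V sh Z H" for H
    unfolding least by (rule Least_le) (use that P_def in blast)
  have finG: "finite G" and GZ: "G \<subseteq> Z" and Gspan: "Z \<subseteq> module_span V G"
    and Ghom: "\<And>g. g \<in> G \<Longrightarrow> \<exists>j. homogeneous sh 0 j g"
    using G unfolding homogeneous_generators_def by blast+
  define r where "r = card G"
  obtain h where h: "bij_betw h {..<r} G"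
    using ex_bij_betw_nat_finite[OF finG] unfolding r_def lessThan_atLeast0 by blast
  have hG: "h q \<in> G" if "q < r" for q using h that by (auto simp: bij_betw_def)
  define e where "e q = (SOME j. homogeneous sh 0 j (h q))" for q
  have e: "homogeneous sh 0 (e q) (h q)" if "q < r" for q
    using someI_ex[OF Ghom[OF hG[OF that]]] unfolding e_def .
  have hfree: "h q \<in> free_mod V n" if "q < r" for q
    using graded_submodule_free[OF Z] GZ hG[OF that] by blast
  define A where "A p q = h q p" for p q
  have A: "graded_matrix V sh n e r A"
    unfolding graded_matrix_def A_def
  proof (intro allI impI conjI ballI)
    fix p q assume pq: "p < n" "q < r"
    show "h q p \<in> poly_ring V" using hfree[OF pq(2)] pq(1) by (simp add: free_mod_def)
    fix m assume "m \<in> supp (h q p)"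
    then show "monom_deg m + sh p = e q" using e[OF pq(2)] unfolding homogeneous_def by fastforce
  qed
  have A_sum: "mat_map n r A f = (\<Sum>q<r. smul (f q) (h q))" for f
  proof (rule ext)
    fix p
    show "mat_map n r A f p = (\<Sum>q<r. smul (f q) (h q)) p"
      using hfree by (cases "p < n") (simp_all add: mat_map_def A_def sum_fun_apply free_mod_def)
  qed
  have image: "mat_map n r A ` free_mod V r = Z"
  proof (intro equalityI subsetI)
    fix z assume "z \<in> mat_map n r A ` free_mod V r"
    then obtain f where f: "f \<in> free_mod V r" "z = (\<Sum>q<r. smul (f q) (h q))" by (auto simp: A_sum)
    have "smul (f q) (h q) \<in> Z" if "q < r" for q
      using f(1) that GZ hG[OF that] by (intro graded_submodule_smul[OF Z]) (auto simp: free_mod_def)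
    then show "z \<in> Z" unfolding f(2) by (intro graded_submodule_sum[OF Z]) simp
  next
    fix z assume "z \<in> Z"
    then obtain a where a: "z = (\<Sum>g\<in>G. smul (a g) g)" "\<forall>g. a g \<in> poly_ring V"
      using Gspan unfolding module_span_def by blast
    define f where "f q = (if q < r then a (h q) else 0)" for q
    have "z = (\<Sum>q<r. smul (a (h q)) (h q))"
      unfolding a(1) using sum.reindex_bij_betw[OF h, of "\<lambda>g. smul (a g) g"] by simp
    also have "\<dots> = mat_map n r A f" unfolding A_sum by (rule sum.cong) (simp_all add: f_def)
    finally have "z = mat_map n r A f" .
    moreover have "f \<in> free_mod V r" using a(2) by (simp add: f_def free_mod_def)
    ultimately show "z \<in> mat_map n r A ` free_mod V r" by blast
  qed
  have "coeff (f q0) 0 = 0" if f: "f \<in> mat_kernel V n r A" for f q0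
  proof (rule ccontr)
    assume nz: "coeff (f q0) 0 \<noteq> 0"
    have q0: "q0 < r"
    proof (rule ccontr)
      assume "\<not> q0 < r"
      then have "f q0 = 0" using f by (simp add: mat_kernel_def free_mod_def)
      then show False using nz by simp
    qed
    \<comment> \<open>In this degree the coordinate at \<open>q0\<close> is reduced to its constant term.\<close>
    define k where "k = hom_part e 0 (e q0) f"
    have k: "k \<in> mat_kernel V n r A"
      unfolding k_def by (rule graded_submodule_hom_part[OF graded_submodule_mat_kernel[OF A] f])
    define \<alpha> where "\<alpha> = coeff (f q0) 0"
    have kq0: "k q0 = sing 0 \<alpha>"
      by (rule poly_mapping_eqI)
        (auto simp: k_def hom_part_def coeff_poly_filter \<alpha>_def lookup_single when_def monom_deg_eq_0_iff)
    have kr: "k q \<in> poly_ring V" for q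
      using k by (cases "q < r") (auto simp: mat_kernel_def free_mod_def)
    define b where "b q = sing 0 (- inverse \<alpha>) * k q" for q
    have b: "b q \<in> poly_ring V" for q
      unfolding b_def by (intro poly_ring_mult poly_ring_single kr) simp
    have "0 = mat_map n r A k" using k by (simp add: mat_kernel_def)
    also have "\<dots> = smul (sing 0 \<alpha>) (h q0) + (\<Sum>q\<in>{..<r} - {q0}. smul (k q) (h q))"
      unfolding A_sum using q0 by (subst sum.remove[of _ q0]) (auto simp: kq0)
    finally have rel: "smul (sing 0 \<alpha>) (h q0) + (\<Sum>q\<in>{..<r} - {q0}. smul (k q) (h q)) = 0" by simp
    have hq0: "h q0 = (\<Sum>q\<in>{..<r} - {q0}. smul (b q) (h q))"
    proof (rule ext)
      fix p
      let ?s = "\<Sum>q\<in>{..<r} - {q0}. k q * h q p"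
      have "sing 0 \<alpha> * h q0 p + ?s = 0" using fun_cong[OF rel, of p] by (simp add: sum_fun_apply)
      then have "?s = - (sing 0 \<alpha> * h q0 p)" by (simp only: add_eq_0_iff)
      then have "sing 0 (- inverse \<alpha>) * ?s = (sing 0 (inverse \<alpha>) * sing 0 \<alpha>) * h q0 p"
        by (simp add: single_uminus mult.assoc)
      also have "sing 0 (inverse \<alpha>) * sing 0 \<alpha> = (1 :: ('v, 'k) mpoly)"
        using nz by (simp add: mult_single \<alpha>_def)
      finally show "h q0 p = (\<Sum>q\<in>{..<r} - {q0}. smul (b q) (h q)) p"
        by (simp add: sum_fun_apply b_def sum_distrib_left mult.assoc)
    qed
    define H where "H = G - {h q0}"
    have hH: "h q \<in> H" if "q \<in> {..<r} - {q0}" for q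
      using that h q0 hG unfolding H_def bij_betw_def inj_on_def by auto
    have finH: "finite H" using finG by (simp add: H_def)
    have "h q0 \<in> module_span V H"
      by (subst hq0) (intro module_span_sum module_span_smul module_span_base finH hH b)
    then have "G \<subseteq> module_span V H"
      using module_span_base[OF finH] by (auto simp: H_def)
    then have "homogeneous_generators V sh Z H"
      using module_span_subset[of G V H] Gspan finH GZ Ghom
      unfolding homogeneous_generators_def H_def by blast
    then have "card G \<le> card H" by (rule G_min)
    then show False using hG[OF q0] finG unfolding H_def by (metis card_Diff1_less not_less)
  qed
  then show ?thesis using A image by blast
qed

end

section \<open>Minimal resolutions and Koszul homology\<close>

text \<open>The ideal is treated as a submodule of the free module of rank one, so that the augmentation is a map
  between free modules like all the others.\<close>

definition embed :: "('v, 'k::comm_ring_1) mpoly \<Rightarrow> ('v, 'k) poly_vec" where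
  "embed p = (\<lambda>q. if q = 0 then p else 0)"

lemma inj_embed: "inj embed"
  by (rule injI) (metis embed_def)

lemma embed_eq_0_iff: "embed p = 0 \<longleftrightarrow> p = 0"
  by (auto simp: embed_def fun_eq_iff)

definition res_rank :: "'r free_complex \<Rightarrow> nat \<Rightarrow> nat" where
  "res_rank F i = (case i of 0 \<Rightarrow> 1 | Suc k \<Rightarrow> rank F k)"

definition res_shift :: "'r free_complex \<Rightarrow> nat \<Rightarrow> nat \<Rightarrow> nat" where
  "res_shift F i = (case i of 0 \<Rightarrow> \<lambda>_. 0 | Suc k \<Rightarrow> shift F k)"

definition res_matrix :: "'r free_complex \<Rightarrow> nat \<Rightarrow> nat \<Rightarrow> nat \<Rightarrow> 'r" where
  "res_matrix F i = (case i of 0 \<Rightarrow> (\<lambda>_ q. aug F q) | Suc k \<Rightarrow> diff F k)"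

definition syzygies ::
  "'v set \<Rightarrow> ('v, 'k::comm_ring_1) mpoly set \<Rightarrow> ('v, 'k) mpoly free_complex \<Rightarrow> nat \<Rightarrow> ('v, 'k) poly_vec set" where
  "syzygies V I F i = (case i of 0 \<Rightarrow> embed ` I
     | Suc k \<Rightarrow> mat_kernel V (res_rank F k) (rank F k) (res_matrix F k))"

lemma mat_map_aug: "mat_map (Suc 0) (rank F 0) (\<lambda>_ q. aug F q) f = embed (aug_map F f)"
  by (rule ext) (simp add: mat_map_def embed_def aug_map_def)

lemma mat_map_res_diff: "mat_map (rank F i) (rank F (Suc i)) (diff F i) f = diff_map F i f"
  by (rule ext) (simp add: mat_map_def diff_map_def)

text \<open>The augmentation and the differentials in uniform notation. Minimality becomes the statement that
  syzygies have no constant terms: the entries of the next matrix are the coordinates of syzygies.\<close>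

theorem minimal_graded_free_resolution_iff:
  fixes I :: "('v, 'k::comm_ring_1) mpoly set"
  shows "minimal_graded_free_resolution V I F \<longleftrightarrow>
    (\<forall>i. graded_matrix V (res_shift F i) (res_rank F i) (shift F i) (rank F i) (res_matrix F i) \<and>
      mat_map (res_rank F i) (rank F i) (res_matrix F i) ` free_mod V (rank F i) = syzygies V I F i \<and>
      (\<forall>f\<in>syzygies V I F (Suc i). \<forall>q. coeff (f q) 0 = 0))"
    (is "_ \<longleftrightarrow> (\<forall>i. ?G i \<and> ?R i \<and> ?M i)")
proof -
  have split: "(\<forall>i. P i) \<longleftrightarrow> P 0 \<and> (\<forall>i. P (Suc i))" for P :: "nat \<Rightarrow> bool"
    by (metis not0_implies_Suc)
  have graded: "graded_maps V F \<longleftrightarrow> (\<forall>i. ?G i)"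
    unfolding split[of ?G] graded_maps_def
    by (simp add: graded_matrix_def res_shift_def res_rank_def res_matrix_def)
  have ker0: "syzygies V I F (Suc 0) = {f \<in> free_mod V (rank F 0). aug_map F f = 0}"
    by (simp add: syzygies_def mat_kernel_def res_rank_def res_matrix_def mat_map_aug embed_eq_0_iff)
  have kerS: "syzygies V I F (Suc (Suc i)) = {f \<in> free_mod V (rank F (Suc i)). diff_map F i f = (\<lambda>_. 0)}" for i
    by (simp add: syzygies_def mat_kernel_def res_rank_def res_matrix_def mat_map_res_diff zero_fun_def)
  have R0: "?R 0 \<longleftrightarrow> aug_map F ` free_mod V (rank F 0) = I"
  proof -
    have "?R 0 \<longleftrightarrow> embed ` (aug_map F ` free_mod V (rank F 0)) = embed ` I"
      by (simp add: syzygies_def res_rank_def res_matrix_def mat_map_aug image_image)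
    then show ?thesis by (simp add: inj_image_eq_iff[OF inj_embed])
  qed
  have RS: "?R (Suc i) \<longleftrightarrow> diff_map F i ` free_mod V (rank F (Suc i)) = syzygies V I F (Suc i)" for i
    by (simp add: res_rank_def res_matrix_def mat_map_res_diff)
  have resolves: "resolves V I F \<longleftrightarrow> (\<forall>i. ?R i)"
    unfolding split[of ?R] R0 RS
    by (subst split) (simp add: resolves_def ker0 kerS)
  have minimal: "minimal_complex V F \<longleftrightarrow> (\<forall>i. ?M i)" if G: "\<forall>i. ?G i" and R: "\<forall>i. ?R i"
  proof
    assume m: "minimal_complex V F"
    show "\<forall>i. ?M i"
    proof (intro allI ballI)
      fix i f q assume "f \<in> syzygies V I F (Suc i)"
      then obtain g where g: "f = diff_map F i g" using R RS[of i] by blast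
      show "coeff (f q) 0 = 0"
      proof (cases "q < rank F i")
        case True
        have "coeff (g k * diff F i q k) 0 = 0" if "k < rank F (Suc i)" for k
          using m True that unfolding minimal_complex_def irrelevant_ideal_iff
          by (intro coeff_mult_zero_monom) blast
        then show ?thesis using True by (simp add: g diff_map_def lookup_sum)
      qed (simp add: g diff_map_def)
    qed
  next
    assume M: "\<forall>i. ?M i"
    show "minimal_complex V F" unfolding minimal_complex_def irrelevant_ideal_iff
    proof (intro allI impI conjI)
      fix i p q assume pq: "p < rank F i" "q < rank F (Suc i)"
      show "diff F i p q \<in> poly_ring V"
        using graded G pq unfolding graded_maps_def by blast
      define u :: "('v, 'k) poly_vec" where "u = (\<lambda>k. if k = q then 1 else 0)"
      have "u \<in> free_mod V (rank F (Suc i))" using pq by (simp add: u_def free_mod_def)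
      then have "diff_map F i u \<in> syzygies V I F (Suc i)" using R RS[of i] by blast
      then have "coeff (diff_map F i u p) 0 = 0" using M by blast
      moreover have "diff_map F i u p = diff F i p q"
      proof -
        have "(\<Sum>k<rank F (Suc i). u k * diff F i p k) =
            (\<Sum>k<rank F (Suc i). if k = q then diff F i p q else 0)"
          by (rule sum.cong) (auto simp: u_def)
        then show ?thesis using pq by (simp add: diff_map_def)
      qed
      ultimately show "coeff (diff F i p q) 0 = 0" by simp
    qed
  qed
  show ?thesis
    unfolding minimal_graded_free_resolution_def graded resolves using minimal by blast
qed

context koszul
begin

text \<open>Dimension shifting moves the Koszul homology of \<open>I\<close> at index \<open>i\<close> to that of the \<open>i\<close>-th syzygy
  module at index \<open>0\<close>, where it counts the basis elements of \<open>F\<^sub>i\<close>. In particular the degrees in a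
  minimal resolution do not depend on its choice.\<close>

theorem shifts_of_minimal_resolution:
  fixes I :: "('v, 'k::comm_ring_1) mpoly set"
  assumes F: "minimal_graded_free_resolution V I F"
  shows "(\<exists>q<rank F i. shift F i q = j) \<longleftrightarrow> \<not> exact_at (\<lambda>_. 0) (embed ` I) i j"
proof -
  have G: "graded_matrix V (res_shift F i) (res_rank F i) (shift F i) (rank F i) (res_matrix F i)"
    and R: "mat_map (res_rank F i) (rank F i) (res_matrix F i) ` free_mod V (rank F i) = syzygies V I F i"
    and M: "\<And>f q. f \<in> syzygies V I F (Suc i) \<Longrightarrow> coeff (f q) 0 = 0" for i
    using F unfolding minimal_graded_free_resolution_iff by blast+
  have K: "syzygies V I F (Suc i) = mat_kernel V (res_rank F i) (rank F i) (res_matrix F i)" for i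
    by (simp add: syzygies_def)
  have S: "res_shift F (Suc i) = shift F i" for i by (simp add: res_shift_def)
  have step: "exact_at (res_shift F (Suc i)) (syzygies V I F (Suc i)) p j \<longleftrightarrow>
      exact_at (res_shift F i) (syzygies V I F i) (Suc p) j" for i p
    using exact_at_kernel_iff[OF G[of i], of p j] M[of _ i] R[of i] unfolding K S by simp
  have "exact_at (res_shift F i) (syzygies V I F i) p j \<longleftrightarrow>
      exact_at (res_shift F 0) (syzygies V I F 0) (i + p) j" for i p
    by (induction i arbitrary: p) (simp_all add: step)
  from this[of i 0] have "exact_at (res_shift F i) (syzygies V I F i) 0 j \<longleftrightarrow>
      exact_at (\<lambda>_. 0) (embed ` I) i j"
    by (simp add: res_shift_def syzygies_def)
  moreover have "exact_at (res_shift F i) (syzygies V I F i) 0 j \<longleftrightarrow> (\<forall>q<rank F i. shift F i q \<noteq> j)"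
    using exact_at_zero_iff_no_generator[OF G[of i], of j] M[of _ i] R[of i] unfolding K by simp
  ultimately show ?thesis by blast
qed

text \<open>The hypothesis on the Koszul homology passes from each module to its syzygies by dimension shifting,
  so the construction of a minimal presentation can be repeated.\<close>

theorem minimal_graded_free_resolution_exists:
  fixes I :: "('v, 'k::field) mpoly set"
  assumes I: "graded_submodule V (\<lambda>_. 0) 1 (embed ` I)"
    and reg: "\<And>p. \<exists>d. \<forall>j>d. exact_at (\<lambda>_. 0) (embed ` I) p j"
  shows "\<exists>F. minimal_graded_free_resolution V I F"
proof -
  define good :: "nat \<times> (nat \<Rightarrow> nat) \<times> ('v, 'k) poly_vec set \<Rightarrow> bool" where
    "good x \<longleftrightarrow> (case x of (n, sh, Z) \<Rightarrow> graded_submodule V sh n Z \<and> (\<forall>p. \<exists>d. \<forall>j>d. exact_at sh Z p j))" for x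
  define step :: "nat \<times> (nat \<Rightarrow> nat) \<times> ('v, 'k) poly_vec set \<Rightarrow> nat \<times> (nat \<Rightarrow> nat) \<times> ('v, 'k) poly_vec set \<Rightarrow>
      (nat \<Rightarrow> nat \<Rightarrow> ('v, 'k) mpoly) \<Rightarrow> bool" where
    "step x y A \<longleftrightarrow> (case x of (n, sh, Z) \<Rightarrow> case y of (r, e, Z') \<Rightarrow>
      graded_matrix V sh n e r A \<and> mat_map n r A ` free_mod V r = Z \<and> Z' = mat_kernel V n r A \<and>
      (\<forall>f\<in>Z'. \<forall>q. coeff (f q) 0 = 0))" for x y A
  have next_step: "\<exists>y. good y \<and> (\<exists>A. step x y A)" if x: "good x" for x
  proof -
    obtain n sh Z where xe: "x = (n, sh, Z)" by (cases x)
    have Z: "graded_submodule V sh n Z" and Zreg: "\<And>p. \<exists>d. \<forall>j>d. exact_at sh Z p j"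
      using x by (auto simp: good_def xe)
    obtain d where d: "\<And>j. j > d \<Longrightarrow> exact_at sh Z 0 j" using Zreg[of 0] by blast
    obtain r e A where A: "graded_matrix V sh n e r A" "mat_map n r A ` free_mod V r = Z"
      "\<And>f q. f \<in> mat_kernel V n r A \<Longrightarrow> coeff (f q) 0 = 0"
      using minimal_presentation_exists[OF Z d] by blast
    have "exact_at e (mat_kernel V n r A) p j \<longleftrightarrow> exact_at sh Z (Suc p) j" for p j
      unfolding A(2)[symmetric] by (rule exact_at_kernel_iff[OF A(1)]) (rule A(3))
    then have "\<exists>d. \<forall>j>d. exact_at e (mat_kernel V n r A) p j" for p
      using Zreg[of "Suc p"] by simp
    then have "good (r, e, mat_kernel V n r A)"
      using graded_submodule_mat_kernel[OF A(1)] by (simp add: good_def)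
    moreover have "step x (r, e, mat_kernel V n r A) A" using A by (simp add: step_def xe)
    ultimately show ?thesis by blast
  qed
  define x0 :: "nat \<times> (nat \<Rightarrow> nat) \<times> ('v, 'k) poly_vec set" where "x0 = (1, \<lambda>_. 0, embed ` I)"
  have "\<exists>x. \<forall>i. (good (x i) \<and> (i = 0 \<longrightarrow> x i = x0)) \<and> (\<exists>A. step (x i) (x (Suc i)) A)"
  proof (rule dependent_nat_choice)
    show "\<exists>x. good x \<and> ((0::nat) = 0 \<longrightarrow> x = x0)"
      using I reg by (intro exI[of _ x0]) (simp add: good_def x0_def)
    fix x and i :: nat assume "good x \<and> (i = 0 \<longrightarrow> x = x0)"
    then show "\<exists>y. (good y \<and> (Suc i = 0 \<longrightarrow> y = x0)) \<and> (\<exists>A. step x y A)" using next_step by blast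
  qed
  then obtain x where x0: "x 0 = x0" and ex: "\<forall>i. \<exists>A. step (x i) (x (Suc i)) A" by blast
  from choice[OF ex] obtain A where A: "\<And>i. step (x i) (x (Suc i)) (A i)" by blast
  define n where "n i = fst (x i)" for i
  define sh where "sh i = fst (snd (x i))" for i
  define Z where "Z i = snd (snd (x i))" for i
  have x: "x i = (n i, sh i, Z i)" for i by (simp add: n_def sh_def Z_def)
  have base: "n 0 = 1" "sh 0 = (\<lambda>_. 0)" "Z 0 = embed ` I" by (simp_all add: n_def sh_def Z_def x0 x0_def)
  have S: "graded_matrix V (sh i) (n i) (sh (Suc i)) (n (Suc i)) (A i)"
    "mat_map (n i) (n (Suc i)) (A i) ` free_mod V (n (Suc i)) = Z i"
    "Z (Suc i) = mat_kernel V (n i) (n (Suc i)) (A i)"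
    "\<And>f q. f \<in> Z (Suc i) \<Longrightarrow> coeff (f q) 0 = 0" for i
    using A[of i] unfolding step_def x[of i] x[of "Suc i"] by auto
  define F :: "('v, 'k) mpoly free_complex" where
    "F = \<lparr>rank = \<lambda>i. n (Suc i), shift = \<lambda>i. sh (Suc i), aug = A 0 0, diff = \<lambda>i. A (Suc i)\<rparr>"
  have rk: "rank F i = n (Suc i)" "shift F i = sh (Suc i)" for i by (simp_all add: F_def)
  have rr: "res_rank F i = n i" "res_shift F i = sh i" for i
    by (cases i; simp add: res_rank_def res_shift_def F_def base)+
  have mat: "res_matrix F i p q = A i p q" if "p < n i" for i p q
    using that base by (cases i) (simp_all add: res_matrix_def F_def)
  have gm: "graded_matrix V (sh i) (n i) (sh (Suc i)) (n (Suc i)) (res_matrix F i)" for i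
    using S(1)[of i] by (simp add: graded_matrix_def mat)
  have mm: "mat_map (n i) r (res_matrix F i) = mat_map (n i) r (A i)" for i r
    by (rule ext, rule ext) (simp add: mat_map_def mat)
  have syz: "syzygies V I F i = Z i" for i
    by (cases i) (simp_all add: syzygies_def base S(3) mat_kernel_def rk rr mm)
  have "minimal_graded_free_resolution V I F"
    unfolding minimal_graded_free_resolution_iff rk rr mm syz
    using gm S(2,4) by blast
  then show ?thesis by blast
qed

section \<open>Strands of the Koszul complex and independence complexes\<close>

lemma strand_diff_strand_diff:
  fixes f :: "'v set \<Rightarrow> 'k::comm_ring_1"
  shows "strand_diff (strand_diff f) T = 0"
proof -
  define g where "g s t = (ksign s T * ksign t (insert s T)) * f (insert t (insert s T))" for s t
  have "V - insert s T = V - T - {s}" for s by auto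
  then have "strand_diff (strand_diff f) T = (\<Sum>s\<in>V - T. \<Sum>t\<in>V - T - {s}. g s t)"
    by (simp add: strand_diff_def g_def sum_distrib_left mult.assoc)
  also have "\<dots> = 0"
  proof (rule antisym_sum_zero)
    show "finite (V - T)" using finV by simp
    fix t s assume st: "t \<in> V - T" "s \<in> V - T" "t \<noteq> s"
    have "g t s = - (g s t)"
      unfolding g_def using ksign_swap[of t s T, where 'r = 'k] st by (simp add: insert_commute)
    then show "g t s + g s t = 0" by simp
  qed
  finally show ?thesis .
qed

lemma strand_diff_diff: "strand_diff (\<lambda>S. f S - g S) T = strand_diff f T - strand_diff g T"
  by (simp add: strand_diff_def right_diff_distrib sum_subtractf)

lemma strand_diff_cong: "(\<And>S. S \<subseteq> V \<Longrightarrow> f S = g S) \<Longrightarrow> T \<subseteq> V \<Longrightarrow> strand_diff f T = strand_diff g T"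
  unfolding strand_diff_def by (rule sum.cong) auto

text \<open>The signs of the Koszul complex, read off at complements in \<open>W\<close>.\<close>

definition dual_sign :: "'v set \<Rightarrow> 'v \<Rightarrow> 'v set \<Rightarrow> 'r::comm_ring_1" where
  "dual_sign W s T = ksign s (W - insert s T)"

lemma sign_system_dual_sign:
  assumes "W \<subseteq> V"
  shows "sign_system W (dual_sign W :: 'v \<Rightarrow> 'v set \<Rightarrow> 'k::field)"
  unfolding sign_system_def
proof (intro conjI allI ballI impI)
  show "dual_sign W s T * dual_sign W s T = (1 :: 'k)" for s T
    by (simp add: dual_sign_def ksign_square)
  fix s t T assume st: "s \<in> W" "t \<in> W" "T \<subseteq> W" "s \<noteq> t" "s \<notin> T" "t \<notin> T"
  define U where "U = W - insert s (insert t T)"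
  have U: "W - insert s T = insert t U" "W - insert t T = insert s U"
    "W - insert t (insert s T) = U" "W - insert s (insert t T) = U" "s \<notin> U" "t \<notin> U"
    using st by (auto simp: U_def)
  have "ksign s U * ksign t (insert s U) = - (ksign t U * ksign s (insert t U) :: 'k)"
    using st assms U by (intro ksign_swap) auto
  then show "dual_sign W s T * dual_sign W t (insert s T) = - (dual_sign W t T * dual_sign W s (insert t T) :: 'k)"
    unfolding dual_sign_def U by (simp add: mult.commute)
qed

text \<open>Removing an element from \<open>T\<close> adds it to the complement, so the boundary of the strands is the coboundary
  of the complements.\<close>

lemma strand_diff_complement:
  fixes f :: "'v set \<Rightarrow> 'k::field"
  assumes W: "W \<subseteq> V" and f: "\<And>S. \<not> S \<subseteq> W \<Longrightarrow> f S = 0" and T: "T \<subseteq> W"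
  shows "strand_diff f (W - T) = coboundary (dual_sign W) (\<lambda>T. f (W - T)) T"
proof -
  have "strand_diff f (W - T) = (\<Sum>s\<in>T. ksign s (W - T) * f (insert s (W - T)))"
    unfolding strand_diff_def
  proof (rule sum.mono_neutral_right)
    show "\<forall>s\<in>V - (W - T) - T. ksign s (W - T) * f (insert s (W - T)) = 0"
    proof
      fix s assume "s \<in> V - (W - T) - T"
      then have "\<not> insert s (W - T) \<subseteq> W" by blast
      then show "ksign s (W - T) * f (insert s (W - T)) = 0" using f by simp
    qed
  qed (use finV W T in auto)
  also have "\<dots> = coboundary (dual_sign W) (\<lambda>T. f (W - T)) T"
    unfolding coboundary_def dual_sign_def
  proof (rule sum.cong[OF refl])
    fix t assume t: "t \<in> T"
    then have "insert t (T - {t}) = T" "W - (T - {t}) = insert t (W - T)" using T by auto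
    then show "ksign t (W - T) * f (insert t (W - T)) = ksign t (W - insert t (T - {t})) * f (W - (T - {t}))"
      by simp
  qed
  finally show ?thesis .
qed

definition nonindependent_complements :: "'v set set \<Rightarrow> 'v set \<Rightarrow> 'v set set" where
  "nonindependent_complements E W = {S. S \<subseteq> W \<and> \<not> independent E (W - S)}"

text \<open>Alexander duality. Complementation turns the quotient of the full simplex on \<open>W\<close> by the given complex
  into the cochain complex of the independence complex. The simplex is acyclic, as \<open>W\<close> is nonempty, so
  the homology of the subcomplex at \<open>p\<close> is that of the quotient at \<open>p + 1\<close>, and complements of sets of
  size \<open>p + 1\<close> have size \<open>r\<close>.\<close>

theorem comb_exact_iff_cohomology_vanishes:
  assumes W: "W \<subseteq> V" "W \<noteq> {}" and card: "card W = p + 1 + r"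
  shows "comb_exact TYPE('k::field) (nonindependent_complements E W) p \<longleftrightarrow>
    cohomology_vanishes E (dual_sign W :: 'v \<Rightarrow> 'v set \<Rightarrow> 'k) W r"
proof
  let ?\<F> = "nonindependent_complements E W"
  have fW: "finite W" using W finV finite_subset by blast
  have cardD: "card (W - S) + card S = card W" if "S \<subseteq> W" for S
    using that fW by (metis card_Diff_subset card_mono finite_subset le_add_diff_inverse2)
  have full: "comb_exact TYPE('k) (Pow W) p" for p
  proof -
    obtain v where "v \<in> W" using W by blast
    then show ?thesis using W by (intro comb_exact_cone[of v]) auto
  qed
  {
    assume van: "cohomology_vanishes E (dual_sign W :: 'v \<Rightarrow> 'v set \<Rightarrow> 'k) W r"
    show "comb_exact TYPE('k) ?\<F> p" unfolding comb_exact_def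
    proof (intro allI impI)
      fix f :: "'v set \<Rightarrow> 'k"
      assume f: "comb_chain ?\<F> p f" and cyc: "\<forall>T\<subseteq>V. strand_diff f T = 0"
      have "comb_chain (Pow W) p f"
        using f unfolding comb_chain_def nonindependent_complements_def by blast
      then obtain g where g: "comb_chain (Pow W) (Suc p) g" "\<And>T. T \<subseteq> V \<Longrightarrow> strand_diff g T = f T"
        using full[of p] cyc unfolding comb_exact_def by blast
      have gW: "g S = 0" if "\<not> S \<subseteq> W" for S using g(1) that by (auto simp: comb_chain_def)
      have "coboundary (dual_sign W) (\<lambda>T. g (W - T)) T = 0"
        if T: "T \<subseteq> W" "independent E T" "card T = Suc r" for T
      proof -
        have "W - (W - T) = T" using T by auto
        then have "W - T \<notin> ?\<F>" using T by (simp add: nonindependent_complements_def)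
        then have "f (W - T) = 0" using f by (auto simp: comb_chain_def)
        then show ?thesis using strand_diff_complement[OF W(1) gW T(1)] g(2)[of "W - T"] W by auto
      qed
      then obtain d where d: "\<And>T. T \<subseteq> W \<Longrightarrow> independent E T \<Longrightarrow> card T = r \<Longrightarrow>
          coboundary (dual_sign W) d T = g (W - T)"
        using van unfolding cohomology_vanishes_def by (elim allE[of _ "\<lambda>T. g (W - T)"]) blast
      \<comment> \<open>On complements of independent sets \<open>g\<close> is the boundary of \<open>h\<close>; subtracting it moves \<open>g\<close> into the subcomplex.\<close>
      define h where "h S = (if S \<subseteq> W \<and> card S = Suc (Suc p) then d (W - S) else 0)" for S
      have hW: "h S = 0" if "\<not> S \<subseteq> W" for S using that by (simp add: h_def)
      define g' where "g' S = (if S \<in> ?\<F> \<and> card S = Suc p then g S - strand_diff h S else 0)" for S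
      have g': "g' S = g S - strand_diff h S" if S: "S \<subseteq> V" for S
      proof -
        have fS: "finite S" using S finV finite_subset by blast
        consider "\<not> S \<subseteq> W" | "S \<subseteq> W" "card S \<noteq> Suc p" | "S \<in> ?\<F>" "card S = Suc p"
          | "S \<subseteq> W" "card S = Suc p" "independent E (W - S)"
          by (auto simp: nonindependent_complements_def)
        then show ?thesis
        proof cases
          case 1
          then have "strand_diff h S = 0" unfolding strand_diff_def by (intro sum.neutral) (auto intro!: hW)
          then show ?thesis using 1 gW by (auto simp: g'_def nonindependent_complements_def)
        next
          case 2
          have "h (insert s S) = 0" if "s \<in> V - S" for s using that 2(2) fS by (simp add: h_def)
          then have "strand_diff h S = 0" unfolding strand_diff_def by (intro sum.neutral) simp
          moreover have "g S = 0" using g(1) 2(2) by (auto simp: comb_chain_def)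
          ultimately show ?thesis using 2(2) by (simp add: g'_def)
        next
          case 3
          then show ?thesis by (simp add: g'_def)
        next
          case 4
          define T where "T = W - S"
          have T: "T \<subseteq> W" "W - T = S" "card T = r" "finite T"
            using 4 cardD[OF 4(1)] card fW by (auto simp: T_def)
          have "strand_diff h S = coboundary (dual_sign W) (\<lambda>T. h (W - T)) T"
            using strand_diff_complement[OF W(1) hW T(1)] T(2) by simp
          also have "\<dots> = coboundary (dual_sign W) d T"
          proof (rule coboundary_cong)
            fix t assume t: "t \<in> T"
            have "W - (W - (T - {t})) = T - {t}" using T by auto
            moreover have "card (W - (T - {t})) = Suc (Suc p)"
              using cardD[of "T - {t}"] card_Suc_Diff1[OF T(4) t] T(1,3) card by fastforce
            ultimately show "h (W - (T - {t})) = d (T - {t})" by (simp add: h_def)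
          qed
          also have "\<dots> = g S" using d[of T] T 4 by (simp add: T_def)
          finally show ?thesis using 4 by (simp add: g'_def nonindependent_complements_def)
        qed
      qed
      have "strand_diff g' T = f T" if T: "T \<subseteq> V" for T
      proof -
        have "strand_diff g' T = strand_diff (\<lambda>S. g S - strand_diff h S) T"
          by (rule strand_diff_cong[OF g' T])
        then show ?thesis using g(2)[OF T] by (simp add: strand_diff_diff strand_diff_strand_diff)
      qed
      moreover have "comb_chain ?\<F> (Suc p) g'" by (auto simp: comb_chain_def g'_def)
      ultimately show "\<exists>g. comb_chain ?\<F> (Suc p) g \<and> (\<forall>T\<subseteq>V. strand_diff g T = f T)" by blast
    qed
  }
  {
    assume ex: "comb_exact TYPE('k) ?\<F> p"
    show "cohomology_vanishes E (dual_sign W :: 'v \<Rightarrow> 'v set \<Rightarrow> 'k) W r"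
      unfolding cohomology_vanishes_def
    proof (intro allI impI)
      fix c :: "'v set \<Rightarrow> 'k"
      assume c: "\<forall>T\<subseteq>W. independent E T \<longrightarrow> card T = Suc r \<longrightarrow> coboundary (dual_sign W) c T = 0"
      \<comment> \<open>The boundary of the lift \<open>g\<close> of a cocycle of the quotient is a cycle of the subcomplex (connecting map).\<close>
      define g where "g S = (if S \<subseteq> W \<and> card S = Suc p \<and> S \<notin> ?\<F> then c (W - S) else 0)" for S
      have gW: "g S = 0" if "\<not> S \<subseteq> W" for S using that by (simp add: g_def)
      define f where "f S = (if S \<subseteq> V then strand_diff g S else 0)" for S
      have "comb_chain ?\<F> p f" unfolding comb_chain_def
      proof (intro allI impI)
        fix S assume "f S \<noteq> 0"
        then have S: "S \<subseteq> V" "strand_diff g S \<noteq> 0" by (auto simp: f_def split: if_splits)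
        have fS: "finite S" using S finV finite_subset by blast
        obtain s where s: "s \<in> V - S" "g (insert s S) \<noteq> 0"
        proof (rule ccontr)
          assume "\<not> thesis"
          then have "strand_diff g S = 0" unfolding strand_diff_def using that by (intro sum.neutral) auto
          then show False using S by simp
        qed
        then have SW: "S \<subseteq> W" "card S = p" using fS by (auto simp: g_def split: if_splits)
        have "\<not> independent E (W - S)"
        proof
          assume ind: "independent E (W - S)"
          define T where "T = W - S"
          have T: "T \<subseteq> W" "W - T = S" "card T = Suc r" "independent E T"
            using SW cardD[OF SW(1)] card ind by (auto simp: T_def)
          have "strand_diff g S = coboundary (dual_sign W) (\<lambda>T. g (W - T)) T"
            using strand_diff_complement[OF W(1) gW T(1)] T(2) by simp
          also have "\<dots> = coboundary (dual_sign W) c T"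
          proof (rule coboundary_cong)
            fix t assume t: "t \<in> T"
            have 1: "W - (W - (T - {t})) = T - {t}" using T by auto
            have fT: "finite T" using T fW finite_subset by blast
            have 2: "card (W - (T - {t})) = Suc p"
              using cardD[of "T - {t}"] card_Suc_Diff1[OF fT t] T(1,3) card by fastforce
            have "independent E (T - {t})" using T independent_subset by blast
            then have "W - (T - {t}) \<notin> ?\<F>" using 1 by (simp add: nonindependent_complements_def)
            then show "g (W - (T - {t})) = c (T - {t})" using 1 2 by (simp add: g_def)
          qed
          also have "\<dots> = 0" using c T by blast
          finally show False using S by simp
        qed
        then show "S \<in> ?\<F> \<and> card S = p" using SW by (simp add: nonindependent_complements_def)
      qed
      moreover have "strand_diff f T = 0" if T: "T \<subseteq> V" for T
      proof -
        have "strand_diff f T = strand_diff (strand_diff g) T"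
          by (rule strand_diff_cong[OF _ T]) (simp add: f_def)
        then show ?thesis by (simp add: strand_diff_strand_diff)
      qed
      ultimately obtain g2 where g2: "comb_chain ?\<F> (Suc p) g2" "\<And>T. T \<subseteq> V \<Longrightarrow> strand_diff g2 T = f T"
        using ex unfolding comb_exact_def by blast
      have "comb_chain (Pow W) (Suc p) (\<lambda>S. g S - g2 S)"
        unfolding comb_chain_def
      proof (intro allI impI)
        fix S assume "g S - g2 S \<noteq> 0"
        then consider "g S \<noteq> 0" | "g2 S \<noteq> 0" by fastforce
        then show "S \<in> Pow W \<and> card S = Suc p"
        proof cases
          case 1
          then show ?thesis by (simp add: g_def split: if_splits)
        next
          case 2
          then have "S \<in> ?\<F> \<and> card S = Suc p" using g2(1) unfolding comb_chain_def by simp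
          then show ?thesis by (simp add: nonindependent_complements_def)
        qed
      qed
      moreover have "strand_diff (\<lambda>S. g S - g2 S) T = 0" if "T \<subseteq> V" for T
        using g2(2)[OF that] that by (simp add: strand_diff_diff f_def)
      ultimately obtain h where h: "comb_chain (Pow W) (Suc (Suc p)) h" "\<And>T. T \<subseteq> V \<Longrightarrow> strand_diff h T = g T - g2 T"
        using full[of "Suc p"] unfolding comb_exact_def by blast
      have hW: "h S = 0" if "\<not> S \<subseteq> W" for S using h(1) that by (auto simp: comb_chain_def)
      show "\<exists>d. \<forall>T\<subseteq>W. independent E T \<longrightarrow> card T = r \<longrightarrow> coboundary (dual_sign W) d T = c T"
      proof (intro exI[of _ "\<lambda>T. h (W - T)"] allI impI)
        fix T assume T: "T \<subseteq> W" "independent E T" "card T = r"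
        have "W - (W - T) = T" using T by auto
        then have notF: "W - T \<notin> ?\<F>" using T by (simp add: nonindependent_complements_def)
        have "coboundary (dual_sign W) (\<lambda>T. h (W - T)) T = g (W - T) - g2 (W - T)"
          using strand_diff_complement[OF W(1) hW T(1)] h(2)[of "W - T"] W by auto
        also have "g2 (W - T) = 0" using g2(1) notF by (auto simp: comb_chain_def)
        also have "g (W - T) = c T"
          using notF cardD[OF T(1)] T card \<open>W - (W - T) = T\<close> by (simp add: g_def)
        finally show "coboundary (dual_sign W) (\<lambda>T. h (W - T)) T = c T" by simp
      qed
    qed
  }
qed

end

section \<open>Edge ideals\<close>

text \<open>The usual sign of \<open>s\<close> and \<open>T\<close> for an enumeration of \<open>V\<close>: the parity of the number of elements of \<open>T\<close>
  that precede \<open>s\<close>. Intersecting \<open>T\<close> with \<open>V\<close> makes the count meaningful for arbitrary sets.\<close>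

lemma koszul_exists:
  fixes V :: "'v set"
  assumes "finite V"
  shows "\<exists>sign_exp. koszul V sign_exp"
proof -
  obtain ord :: "'v \<Rightarrow> nat" where ord: "inj_on ord V"
    using finite_imp_inj_to_nat_seg[OF assms] by blast
  define N where "N s T = {x \<in> T \<inter> V. ord x < ord s}" for s T
  have fin: "finite (N s T)" for s T using assms by (simp add: N_def)
  have ins: "card (N t (insert s T)) = card (N t T) + (if ord s < ord t then 1 else 0)"
    if "s \<in> V" "s \<notin> T" for s t T
  proof (cases "ord s < ord t")
    case True
    then have "N t (insert s T) = insert s (N t T)" "s \<notin> N t T" using that by (auto simp: N_def)
    then show ?thesis using True fin by simp
  next
    case False
    then have "N t (insert s T) = N t T" by (auto simp: N_def)
    then show ?thesis using False by simp
  qed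
  have "koszul V (\<lambda>s T. card (N s T))"
  proof
    show "finite V" by fact
    fix s t T assume st: "s \<in> V" "t \<in> V" "s \<noteq> t" "s \<notin> T" "t \<notin> T"
    then have "ord s \<noteq> ord t" using ord by (auto dest: inj_onD)
    then show "odd (card (N s T) + card (N t (insert s T)) + card (N t T) + card (N s (insert t T)))"
      using ins[of s T t] ins[of t T s] st by (cases "ord s < ord t") auto
  qed
  then show ?thesis by blast
qed

definition edge_monomials :: "'v set \<Rightarrow> 'v set set \<Rightarrow> nat \<Rightarrow> ('v \<Rightarrow>\<^sub>0 nat) set" where
  "edge_monomials V E q = (if q = 0 then {m. supp m \<subseteq> V \<and> \<not> independent E (supp m)} else {})"

lemma edge_ideal_eq:
  fixes V :: "'v set" and E :: "'v set set"
  assumes G: "simple_graph V E"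
  shows "edge_ideal V E = {p :: ('v, 'k::comm_ring_1) mpoly. \<forall>m\<in>supp p. supp m \<subseteq> V \<and> \<not> independent E (supp m)}"
proof -
  have edge: "e \<in> E \<Longrightarrow> finite e \<and> e \<subseteq> V" for e
    using G unfolding simple_graph_def by (metis finite_subset)
  have pair: "\<exists>a b. e = {a, b} \<and> a \<noteq> b" if "e \<in> E" for e
    using G that unfolding simple_graph_def by (meson card_2_iff)
  have gens: "{var a * var b | a b. {a, b} \<in> E} = (\<lambda>u. sing u (1::'k)) ` sqfree_monom ` E"
  proof -
    have mono: "var a * var b = sing (sqfree_monom {a, b}) (1::'k)" if "{a, b} \<in> E" for a b
    proof -
      have "a \<noteq> b" using that G unfolding simple_graph_def by force
      then show ?thesis by (simp add: var_def mult_single sqfree_monom_def)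
    qed
    show ?thesis
    proof (intro equalityI subsetI)
      fix x :: "('v, 'k) mpoly" assume "x \<in> {var a * var b | a b. {a, b} \<in> E}"
      then show "x \<in> (\<lambda>u. sing u 1) ` sqfree_monom ` E" using mono by blast
    next
      fix x :: "('v, 'k) mpoly" assume "x \<in> (\<lambda>u. sing u 1) ` sqfree_monom ` E"
      then obtain e where e: "e \<in> E" "x = sing (sqfree_monom e) 1" by blast
      then obtain a b where ab: "{a, b} \<in> E" "x = sing (sqfree_monom {a, b}) 1" using pair by blast
      then have "x = var a * var b" using mono[OF ab(1)] by simp
      then show "x \<in> {var a * var b | a b. {a, b} \<in> E}" using ab(1) by blast
    qed
  qed
  have "edge_ideal V E = {p :: ('v, 'k) mpoly. \<forall>m\<in>supp p. \<exists>u\<in>sqfree_monom ` E. \<exists>x. supp x \<subseteq> V \<and> m = x + u}"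
    unfolding edge_ideal_def gens
  proof (rule ideal_gen_monomials)
    fix u :: "'v \<Rightarrow>\<^sub>0 nat" assume "u \<in> sqfree_monom ` E"
    then obtain e where e: "e \<in> E" "u = sqfree_monom e" by blast
    show "supp u \<subseteq> V" using edge[OF e(1)] by (simp add: e(2) supp_sqfree_monom)
  qed
  moreover have "(\<exists>u\<in>sqfree_monom ` E. \<exists>x. supp x \<subseteq> V \<and> m = x + u) \<longleftrightarrow> supp m \<subseteq> V \<and> \<not> independent E (supp m)"
    for m :: "'v \<Rightarrow>\<^sub>0 nat"
  proof
    assume "\<exists>u\<in>sqfree_monom ` E. \<exists>x. supp x \<subseteq> V \<and> m = x + u"
    then obtain e x where ex: "e \<in> E" "supp x \<subseteq> V" "m = x + sqfree_monom e" by blast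
    then have "supp m = supp x \<union> e" using edge by (simp add: supp_add_monom supp_sqfree_monom)
    then show "supp m \<subseteq> V \<and> \<not> independent E (supp m)"
      using ex edge[OF ex(1)] unfolding independent_def by auto
  next
    assume m: "supp m \<subseteq> V \<and> \<not> independent E (supp m)"
    then obtain e where e: "e \<in> E" "e \<subseteq> supp m" unfolding independent_def by blast
    have "m = (m - sqfree_monom e) + sqfree_monom e"
      using split_sqfree_monom[of e m] edge e by simp
    moreover have "supp (m - sqfree_monom e) \<subseteq> V" using m by (auto simp: in_keys_iff lookup_minus)
    ultimately show "\<exists>u\<in>sqfree_monom ` E. \<exists>x. supp x \<subseteq> V \<and> m = x + u" using e by blast
  qed
  ultimately show ?thesis by simp
qed

lemma embed_edge_ideal:
  assumes "simple_graph V E"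
  shows "embed ` edge_ideal V E = (monomial_span (edge_monomials V E) :: ('v, 'k::comm_ring_1) poly_vec set)"
proof (intro equalityI subsetI)
  fix f :: "('v, 'k) poly_vec" assume "f \<in> embed ` edge_ideal V E"
  then show "f \<in> monomial_span (edge_monomials V E)"
    unfolding edge_ideal_eq[OF assms] by (auto simp: monomial_span_def edge_monomials_def embed_def)
next
  fix f :: "('v, 'k) poly_vec" assume f: "f \<in> monomial_span (edge_monomials V E)"
  have "f q = 0" if "q \<noteq> 0" for q
  proof -
    have "supp (f q) \<subseteq> edge_monomials V E q" using f unfolding monomial_span_def by blast
    then have "supp (f q) \<subseteq> {}" using that by (simp add: edge_monomials_def)
    then show ?thesis by (simp only: supp_empty_iff)
  qed
  then have "f = embed (f 0)" by (auto simp: embed_def)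
  moreover have "supp (f 0) \<subseteq> edge_monomials V E 0" using f unfolding monomial_span_def by blast
  then have "f 0 \<in> edge_ideal V E"
    unfolding edge_ideal_eq[OF assms] by (auto simp: edge_monomials_def)
  ultimately show "f \<in> embed ` edge_ideal V E" by blast
qed

lemma graded_submodule_edge_ideal:
  assumes "simple_graph V E"
  shows "graded_submodule V sh 1 (monomial_span (edge_monomials V E) :: ('v, 'k::comm_ring_1) poly_vec set)"
proof (rule graded_submodule_monomial_span)
  fix q and m u :: "'v \<Rightarrow>\<^sub>0 nat" assume "m \<in> edge_monomials V E q" "supp u \<subseteq> V"
  then show "u + m \<in> edge_monomials V E q"
    using independent_subset[of E "supp u \<union> supp m" "supp m"]
    by (auto simp: edge_monomials_def supp_add_monom split: if_splits)
qed (auto simp: edge_monomials_def split: if_splits)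

context koszul
begin

lemma monomial_strand_edge_monomials:
  assumes "supp m \<subseteq> V"
  shows "monomial_strand (edge_monomials V E) 0 m =
    {S. S \<subseteq> supp m \<and> \<not> independent E (supp (m - sqfree_monom S))}"
proof -
  have "supp (m - sqfree_monom S) \<subseteq> supp m" for S by (auto simp: in_keys_iff lookup_minus)
  then have "supp (m - sqfree_monom S) \<subseteq> V" for S using assms by blast
  then show ?thesis by (simp add: monomial_strand_def edge_monomials_def)
qed

text \<open>Membership in the edge ideal depends only on the support of a monomial, and dividing by a variable of
  exponent at least two does not change the support; hence this variable is the apex of a cone.\<close>

lemma comb_exact_edge_monomials_not_squarefree:
  assumes m: "supp m \<subseteq> V" and v: "coeff m v \<ge> 2"
  shows "comb_exact TYPE('k::comm_ring_1) (monomial_strand (edge_monomials V E) 0 m) p"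
  unfolding monomial_strand_edge_monomials[OF m]
proof (rule comb_exact_cone)
  have vm: "v \<in> supp m" using v by (simp add: in_keys_iff)
  then show "v \<in> V" using m by blast
  show "{S. S \<subseteq> supp m \<and> \<not> independent E (supp (m - sqfree_monom S))} \<subseteq> Pow V" using m by blast
  fix S assume S: "S \<in> {S. S \<subseteq> supp m \<and> \<not> independent E (supp (m - sqfree_monom S))}"
  then have "S \<subseteq> supp m" by blast
  then have fS: "finite S" using finite_subset finite_keys by blast
  have "supp (m - sqfree_monom (insert v S)) = supp (m - sqfree_monom S)"
    using v fS by (auto simp: in_keys_iff lookup_minus coeff_sqfree_monom split: if_splits)
  then show "insert v S \<in> {S. S \<subseteq> supp m \<and> \<not> independent E (supp (m - sqfree_monom S))}"
    using S vm by simp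
qed

lemma monomial_strand_edge_monomials_squarefree:
  assumes W: "W \<subseteq> V"
  shows "monomial_strand (edge_monomials V E) 0 (sqfree_monom W) = nonindependent_complements E W"
proof -
  have fW: "finite W" using W finV finite_subset by blast
  have "supp (sqfree_monom W - sqfree_monom S) = W - S" if "S \<subseteq> W" for S
    using finite_subset[OF that fW] fW by (auto simp: in_keys_iff lookup_minus coeff_sqfree_monom split: if_splits)
  then show ?thesis
    using monomial_strand_edge_monomials[of "sqfree_monom W" E] W
    by (auto simp: supp_sqfree_monom[OF fW] nonindependent_complements_def)
qed

text \<open>A \<open>p\<close>-element set alone has degree \<open>p\<close>.\<close>

lemma exact_at_below_diagonal:
  assumes "graded_submodule V sh n Z" and "j < p"
  shows "exact_at sh Z p j"
  unfolding exact_at_def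
proof (intro allI impI)
  fix c assume c: "chain sh Z p j c"
  have "c S = 0" for S
  proof (cases "S \<subseteq> V \<and> card S = p")
    case True
    then have "homogeneous sh p j (c S)" using chain_homogeneous[OF c] by blast
    then have "c S = hom_part sh p j (c S)" by (rule hom_part_homogeneous[symmetric])
    also have "\<dots> = 0" by (rule hom_part_degree_zero[OF assms(2)])
    finally show ?thesis .
  next
    case False
    then show ?thesis by (rule chain_outside[OF c])
  qed
  then have "c = 0" by (intro ext) simp
  moreover have "chain sh Z (Suc p) j 0"
    by (rule chainI) (simp_all add: graded_submodule_zero[OF assms(1)])
  ultimately show "\<exists>d. chain sh Z (Suc p) j d \<and> koszul_diff d = c" using koszul_diff_zero by blast
qed

text \<open>Only squarefree multidegrees matter, and there duality turns the bound \<open>c + p + 1 < j\<close> into \<open>c < r\<close>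
  for \<open>r = j - p - 1\<close>.\<close>

theorem exact_at_edge_ideal:
  fixes E :: "'v set set"
  assumes G: "simple_graph V E" and ch: "chordal E"
    and big: "\<And>M. induced_matching E M \<Longrightarrow> card M + p + 1 < j"
  shows "exact_at (\<lambda>_. 0) (embed ` edge_ideal V E :: ('v, 'k::field) poly_vec set) p j"
  unfolding embed_edge_ideal[OF G]
proof (subst exact_at_monomial_span[OF graded_submodule_edge_ideal[OF G]])
  have E2: "\<forall>e\<in>E. card e = 2" using G by (simp add: simple_graph_def)
  show "\<And>q m. m \<in> edge_monomials V E q \<Longrightarrow> supp m \<subseteq> V" by (auto simp: edge_monomials_def split: if_splits)
  show "\<forall>q m. supp m \<subseteq> V \<longrightarrow> monom_deg m + 0 = j \<longrightarrow>
      comb_exact TYPE('k) (monomial_strand (edge_monomials V E) q m) p"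
  proof (intro allI impI)
    fix q m assume m: "supp m \<subseteq> V" "monom_deg m + 0 = j"
    show "comb_exact TYPE('k) (monomial_strand (edge_monomials V E) q m) p"
    proof (cases "q = 0")
      case False
      then have "monomial_strand (edge_monomials V E) q m = {}"
        by (simp add: monomial_strand_def edge_monomials_def)
      then show ?thesis unfolding comb_exact_def
        by (intro allI impI exI[of _ "\<lambda>_. 0"]) (auto simp: comb_chain_def strand_diff_def)
    next
      case True
      show ?thesis
      proof (cases "\<exists>v. coeff m v \<ge> 2")
        case True
        then show ?thesis using comb_exact_edge_monomials_not_squarefree[OF m(1)] \<open>q = 0\<close> by blast
      next
        case False
        define W where "W = supp m"
        have fW: "finite W" by (simp add: W_def)
        have "m = sqfree_monom W"
        proof (rule poly_mapping_eqI)
          fix v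
          have "coeff m v < 2" using False by (metis not_le)
          then show "coeff m v = coeff (sqfree_monom W) v"
            using coeff_sqfree_monom[OF fW, of v] by (auto simp: W_def in_keys_iff)
        qed
        then have cW: "card W = j" using m(2) monom_deg_sqfree_monom[OF fW] by simp
        have "card ({} :: 'v set set) + p + 1 < j" by (rule big) (simp add: induced_matching_def)
        define r where "r = j - p - 1"
        have cW': "card W = p + 1 + r" using cW \<open>card {} + p + 1 < j\<close> by (simp add: r_def)
        have WV: "W \<subseteq> V" "W \<noteq> {}" using m cW' by (auto simp: W_def)
        have "cohomology_vanishes E (dual_sign W :: 'v \<Rightarrow> 'v set \<Rightarrow> 'k) W r"
        proof (rule cohomology_vanishes_chordal[OF ch E2 fW sign_system_dual_sign[OF WV(1)]])
          fix M assume "induced_matching E M"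
          then show "card M < r" using big[of M] by (simp add: r_def)
        qed
        then have "comb_exact TYPE('k) (nonindependent_complements E W) p"
          by (simp only: comb_exact_iff_cohomology_vanishes[OF WV cW'])
        then show ?thesis
          using monomial_strand_edge_monomials_squarefree[OF WV(1), of E] \<open>m = sqfree_monom W\<close> \<open>q = 0\<close>
          by simp
      qed
    qed
  qed
qed

text \<open>The multidegree is the product of the vertices of the matching, which has degree \<open>2 * card M\<close> because
  the edges are disjoint.\<close>

theorem not_exact_at_edge_ideal:
  fixes E :: "'v set set"
  assumes G: "simple_graph V E" and M: "induced_matching E M" "M \<noteq> {}"
  shows "\<not> exact_at (\<lambda>_. 0) (embed ` edge_ideal V E :: ('v, 'k::field) poly_vec set) (card M - 1) (2 * card M)"
proof
  have E2: "\<forall>e\<in>E. card e = 2" using G by (simp add: simple_graph_def)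
  have ME: "M \<subseteq> E" using M by (simp add: induced_matching_def)
  then have MV: "M \<subseteq> Pow V" using G by (auto simp: simple_graph_def)
  then have finM: "finite M" using finV finite_subset by blast
  define W where "W = \<Union>M"
  have WV: "W \<subseteq> V" using MV by (auto simp: W_def)
  then have fW: "finite W" using finV finite_subset by blast
  have "pairwise disjnt M" unfolding pairwise_def disjnt_def
  proof (intro ballI impI)
    fix e h assume eh: "e \<in> M" "h \<in> M" "e \<noteq> h"
    then have "gap E e h" using M(1) by (auto simp: induced_matching_def pairwise_def)
    then have "e \<inter> e = {} \<or> e \<inter> h = {}" using eh(1) ME unfolding gap_def by blast
    moreover have "e \<noteq> {}" using E2 ME eh(1) by force
    ultimately show "e \<inter> h = {}" by simp
  qed
  then have "card W = (\<Sum>e\<in>M. card e)"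
    unfolding W_def using MV finV finite_subset by (intro card_Union_disjoint) blast+
  also have "\<dots> = (\<Sum>e\<in>M. 2)" using E2 ME by (intro sum.cong) auto
  finally have cW: "card W = 2 * card M" by simp
  have pos: "card M > 0" using finM M(2) by (simp add: card_gt_0_iff)
  have cW': "card W = (card M - 1) + 1 + card M" using cW pos by simp
  have Wne: "W \<noteq> {}" using cW pos by auto
  assume "exact_at (\<lambda>_. 0) (embed ` edge_ideal V E :: ('v, 'k) poly_vec set) (card M - 1) (2 * card M)"
  then have all: "\<forall>q m. supp m \<subseteq> V \<longrightarrow> monom_deg m + 0 = 2 * card M \<longrightarrow>
      comb_exact TYPE('k) (monomial_strand (edge_monomials V E) q m) (card M - 1)"
    unfolding embed_edge_ideal[OF G]
    by (subst (asm) exact_at_monomial_span[OF graded_submodule_edge_ideal[OF G]])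
      (auto simp: edge_monomials_def split: if_splits)
  have "comb_exact TYPE('k) (monomial_strand (edge_monomials V E) 0 (sqfree_monom W)) (card M - 1)"
    using all[rule_format, of "sqfree_monom W" 0] WV cW
    by (simp add: supp_sqfree_monom[OF fW] monom_deg_sqfree_monom[OF fW])
  then have "comb_exact TYPE('k) (nonindependent_complements E W) (card M - 1)"
    by (simp only: monomial_strand_edge_monomials_squarefree[OF WV])
  then have "cohomology_vanishes E (dual_sign W :: 'v \<Rightarrow> 'v set \<Rightarrow> 'k) W (card M)"
    by (simp only: comb_exact_iff_cohomology_vanishes[OF WV Wne cW'])
  moreover have "\<not> cohomology_vanishes E (dual_sign W :: 'v \<Rightarrow> 'v set \<Rightarrow> 'k) W (card M)"
    unfolding W_def
    by (rule cohomology_induced_matching_nonzero[OF E2 finM M(1)])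
      (use sign_system_dual_sign[OF WV] W_def in simp)
  ultimately show False by contradiction
qed

end

theorem corollary1p7:
  fixes V :: "'v set" and E :: "'v set set"
  assumes "simple_graph V E" and "chordal E"
  shows "regularity V (edge_ideal V E :: ('v, 'k::field) mpoly set) = int (max_three_disjoint E) + 1"
proof (cases "E = {}")
  case True
  have "edge_ideal V E = ({0} :: ('v, 'k) mpoly set)"
    unfolding True edge_ideal_def ideal_gen_def by auto
  moreover have "max_three_disjoint E = 0"
    unfolding max_three_disjoint_def True by (simp add: pairwise_def cong: conj_cong)
  ultimately show ?thesis by (simp add: regularity_def)
next
  case False
  note G = assms(1) and ch = assms(2)
  let ?I = "edge_ideal V E :: ('v, 'k) mpoly set"
  have finV: "finite V" and E2: "\<forall>e\<in>E. card e = 2" and EV: "E \<subseteq> Pow V"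
    using G by (auto simp: simple_graph_def)
  have finE: "finite E" using EV finV finite_subset by blast
  obtain sign_exp where "koszul V sign_exp" using koszul_exists[OF finV] by blast
  then interpret koszul V sign_exp .
  define \<nu> where "\<nu> = max_three_disjoint E"
  have fin: "finite (card ` {M. induced_matching E M})"
  proof -
    have "{M. induced_matching E M} \<subseteq> Pow E" by (auto simp: induced_matching_def)
    then show ?thesis using finE by (meson finite_Pow_iff finite_imageI finite_subset)
  qed
  have \<nu>: "\<nu> = Max (card ` {M. induced_matching E M})"
    unfolding \<nu>_def by (rule max_three_disjoint_altdef[OF E2])
  have le: "card M \<le> \<nu>" if "induced_matching E M" for M
    unfolding \<nu> using fin that by (intro Max_ge) auto
  have "\<nu> \<in> card ` {M. induced_matching E M}" unfolding \<nu>
  proof (rule Max_in[OF fin])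
    have "induced_matching E {}" by (simp add: induced_matching_def)
    then show "card ` {M. induced_matching E M} \<noteq> {}" by blast
  qed
  then obtain M where M: "induced_matching E M" "card M = \<nu>" by auto
  \<comment> \<open>Needed for the index \<open>\<nu> - 1\<close> below to be the predecessor of \<open>\<nu>\<close>.\<close>
  have "1 \<le> \<nu>"
  proof -
    obtain e where "e \<in> E" using False by blast
    then have "induced_matching E {e}" by (simp add: induced_matching_def)
    then show ?thesis using le by fastforce
  qed
  then have Mne: "M \<noteq> {}" using M(2) by auto
  have exact: "exact_at (\<lambda>_. 0) (embed ` ?I) i j" if "\<nu> + i + 1 < j" for i j
    by (rule exact_at_edge_ideal[OF G ch]) (use le that in fastforce)
  have below: "exact_at (\<lambda>_. 0) (embed ` ?I) i j" if "j < i" for i j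
    unfolding embed_edge_ideal[OF G]
    by (rule exact_at_below_diagonal[OF graded_submodule_edge_ideal[OF G] that])
  have notex: "\<not> exact_at (\<lambda>_. 0) (embed ` ?I) (\<nu> - 1) (2 * \<nu>)"
    using not_exact_at_edge_ideal[OF G M(1) Mne] M(2) by simp
  have "\<exists>F. minimal_graded_free_resolution V ?I F"
  proof (rule minimal_graded_free_resolution_exists)
    show "graded_submodule V (\<lambda>_. 0) 1 (embed ` ?I)"
      unfolding embed_edge_ideal[OF G] by (rule graded_submodule_edge_ideal[OF G])
    show "\<exists>d. \<forall>j>d. exact_at (\<lambda>_. 0) (embed ` ?I) p j" for p
      using exact[of p] by (intro exI[of _ "\<nu> + p + 1"]) simp
  qed
  then have "minimal_graded_free_resolution V ?I (SOME F. minimal_graded_free_resolution V ?I F)"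
    by (rule someI_ex)
  note shifts = shifts_of_minimal_resolution[OF this]
  have betti: "graded_betti V ?I i j \<noteq> 0 \<longleftrightarrow> \<not> exact_at (\<lambda>_. 0) (embed ` ?I) i j" for i j
    unfolding graded_betti_def Let_def shifts[symmetric] by (auto simp: card_eq_0_iff)
  define D where "D = {int j - int i | i j. graded_betti V ?I i j \<noteq> 0}"
  have D: "0 \<le> x \<and> x \<le> int \<nu> + 1" if xD: "x \<in> D" for x
  proof -
    obtain i j where ij: "x = int j - int i" "\<not> exact_at (\<lambda>_. 0) (embed ` ?I) i j"
      using xD unfolding D_def betti by blast
    then have "\<not> j < i" "\<not> \<nu> + i + 1 < j" using below exact by blast+
    then show ?thesis using ij(1) by simp
  qed
  have "Max D = int \<nu> + 1"
  proof (rule Max_eqI)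
    have "D \<subseteq> {0..int \<nu> + 1}" using D by auto
    then show "finite D" by (rule finite_subset) simp
    show "x \<le> int \<nu> + 1" if "x \<in> D" for x using D that by blast
    have "int (2 * \<nu>) - int (\<nu> - 1) \<in> D" unfolding D_def using betti notex by blast
    moreover have "int (2 * \<nu>) - int (\<nu> - 1) = int \<nu> + 1" using \<open>1 \<le> \<nu>\<close> by simp
    ultimately show "int \<nu> + 1 \<in> D" by simp
  qed
  moreover have "?I \<noteq> {0}"
  proof
    assume I0: "?I = {0}"
    obtain e where e: "e \<in> E" using False by blast
    then have "finite e" "e \<subseteq> V" using EV finV finite_subset by blast+
    then have "sing (sqfree_monom e) 1 \<in> ?I"
      unfolding edge_ideal_eq[OF G] using e by (auto simp: supp_sqfree_monom independent_def)
    then have "sing (sqfree_monom e) (1::'k) = 0" using I0 by blast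
    then show False by (metis keys_zero keys_single insert_not_empty zero_neq_one)
  qed
  ultimately show ?thesis by (simp add: regularity_def D_def \<nu>_def)
qed

end
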